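(* Let $n\ge 0$ and let $[b_1,\ldots,b_n]$ be any even continued fraction (each $b_i$ an even nonzero integer). Then $$P[b_1,\ldots,b_n] = m[b_1,\ldots,b_n]\,\tilde F[b_1,\ldots,b_n]\quad\text{in } \mathbb{Z}(\ell,q^{1/2}),$$ where $P[b_1,\ldots,b_n]$ is the HOMFLY polynomial of the canonically oriented rational link $C([b_1,\ldots,b_n])$, $m[b_1,\ldots,b_n]$ is the inductively defined rational function given in the context, and $\tilde F[b_1,\ldots,b_n]$ is the $F$-polynomial $F[b_1,\ldots,b_n]$ of the labeled path poset $Q[b_1,\ldots,b_n]$ subject to the specialization $$y_1 = \ell^2\left(\frac{1-\ell^2q}{1-q^{-1}}\right)^{-1}\ \text{if } b_1>0,\qquad y_1 = q^{-2}\left(\frac{1-\ell^2q}{1-q^{-1}}\right)\ \text{if } b_1<0,$$ $$y_{2i} = -\ell^2 q,\qquad y_{2i+1} = -q^{-1}\qquad\text{for all } i\ge 1.$$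
   Context: Notation: $\mathbb{Z}(\ell,q^{1/2})$ is the field of rational functions in two variables $\ell$ and $q^{1/2}$ (with integer coefficients). Continued fractions: $[c_1,\ldots,c_n]=c_1+\frac{1}{c_2+\frac{1}{\cdots+\frac1{c_n}}}$, viewed as the list of its terms; $n=0$ is the empty list. For a list of nonzero integers put $\ell_0=0$, $\ell_i=|c_1|+\cdots+|c_i|$, and the type sequence $t_0=-1$, $t_i=(-1)^{i-1}\operatorname{sgn}(c_i)$ for $1\le i\le n$. Labeled path poset $Q[c_1,\ldots,c_n]$: defined whenever each $|c_i|\ge1$ and $t_i=t_{i+1}$ implies $|c_i|,|c_{i+1}|>1$ (automatic for even continued fractions). Its elements are the integers in $\{1,\ldots,\ell_n-1\}$ with those $\ell_i$ ($1\le i<n$) such that $t_i=t_{i+1}$ removed; it is empty if $n=0$. Its Hasse diagram is the path through these elements in increasing order of label, with edges oriented as follows. For consecutive elements $u,u+1$ there is a unique $i$ with $\ell_{i-1}\le u<u+1\le \ell_i$, and $u$ is below $u+1$ if $t_i=1$, above it if $t_i=-1$. For consecutive elements $\ell_i-1,\ \ell_i+1$ (when $\ell_i$ is removed), $\ell_i-1$ is above $\ell_i+1$ if $t_i=1$, below it if $t_i=-1$. $F$-polynomial: for a poset $Q$ labeled by positive integers, $F(Q)=\sum_{I}\prod_{i\in I}y_i$, the sum over all order ideals $I$ of $Q$ (down-closed subsets, including $\emptyset$ and $Q$). $F[c_1,\ldots,c_n]:=F(Q[c_1,\ldots,c_n])$. The function $m$: with $[b_1,\ldots,b_{-1}]$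 a formal symbol for the case $n=-1$, put $m[\,]=1$, $m[b_1,\ldots,b_{-1}]=-\ell^{-1}q^{-1/2}\left(\frac{1-\ell^2q}{1-q^{-1}}\right)$, and for $n\ge1$ $$m[b_1,\ldots,b_n]=\begin{cases}-\ell q^{1/2}\,m[b_1,\ldots,b_{n-1}] & \text{if } t_n=-1,\\ \ell^{-|b_n|}\,m[b_1,\ldots,b_{n-2}] & \text{if } t_{n-1}=-1,\ t_n=1,\\ \ell^{1-|b_n|}q^{1/2}\,m[b_1,\ldots,b_{n-1}] & \text{if } t_{n-1}=1,\ t_n=1.\end{cases}$$ HOMFLY polynomial: the isotopy invariant $P$ of oriented links in $\mathbb{R}^3$ with values in $\mathbb{Z}(\ell,q^{1/2})$ determined by $P(\text{unknot})=1$ and the skein relation $\ell\,P(L_+)-\ell^{-1}P(L_-)=(q^{1/2}-q^{-1/2})P(L_0)$, where $L_+,L_-,L_0$ have diagrams identical except near one crossing, which is positive in $L_+$, negative in $L_-$, and replaced by its oriented smoothing in $L_0$. Rational link $C([b_1,\ldots,b_n])$ for an even continued fraction, with its canonical orientation: take four horizontal strands, numbered $1,2,3,4$ from bottom to top. At the left end join strands $1,2$ by a cap and strands $3,4$ by a cap. Going from left to right insert, for $i=1,\ldots,n$, a twist region with $|b_i|$ crossings, between the two middle strands $2,3$ if $i$ is odd and between the two top strands $3,4$ if $i$ is even. At the right end, if $n$ is odd join strands $1,2$ and strands $3,4$ by caps; if $n$ is even join the middle strands $2,3$ by a cap and the outer strands $1,4$ by a cap. Orient the strands (outside the twist regions)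 alternately, strands $1,3$ in one horizontal direction and strands $2,4$ in the opposite direction; this is consistent since all $b_i$ are even. The over/under information is such that every crossing in the $i$-th twist region has crossing sign $t_i$. Put $P[b_1,\ldots,b_n]:=P(C([b_1,\ldots,b_n]))$. *)

theory Defs
  imports "HOL-Analysis.Analysis" "HOL-Computational_Algebra.Fraction_Field"
begin

section \<open>The field of rational functions\<close>

text \<open>
  The field of fractions of $Z[\ell][q^{1/2}]$: the coefficient polynomials are polynomials
  in the variable \<open>\<ell>\<close>, the outer polynomial variable is \<open>q\<close> to the power one half.
\<close>

type_synonym ratfun = "int poly poly fract"

definition ell :: ratfun where
  "ell = Fract [:[:0, 1:]:] 1"

definition qhalf :: ratfun where
  "qhalf = Fract [:0, 1:] 1"

abbreviation q :: ratfun where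
  "q \<equiv> qhalf ^ 2"


section \<open>Continued fractions, the poset and its F-polynomial\<close>

text \<open>
  A continued fraction $[c_1,\ldots,c_n]$ is the list of its terms; the term $c_i$ is
  \<open>cs ! (i - 1)\<close>.
\<close>

definition even_continued_fraction :: "int list \<Rightarrow> bool" where
  "even_continued_fraction cs \<longleftrightarrow> (\<forall>c\<in>set cs. even c \<and> c \<noteq> 0)"

definition cf_len :: "int list \<Rightarrow> nat \<Rightarrow> nat" where
  "cf_len cs i = (\<Sum>j<i. nat \<bar>cs ! j\<bar>)"

definition cf_type :: "int list \<Rightarrow> nat \<Rightarrow> int" where
  "cf_type cs i = (if i = 0 then -1 else (-1) ^ (i - 1) * sgn (cs ! (i - 1)))"

definition Q_elements :: "int list \<Rightarrow> nat set" where
  "Q_elements cs = {1..<cf_len cs (length cs)} -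
     {cf_len cs i | i. 1 \<le> i \<and> i < length cs \<and> cf_type cs i = cf_type cs (i + 1)}"

text \<open>\<open>(u, v) \<in> Q_covers cs\<close> means that \<open>u\<close> lies directly below \<open>v\<close> in the Hasse diagram.\<close>

definition Q_covers :: "int list \<Rightarrow> (nat \<times> nat) set" where
  "Q_covers cs =
     {(u, u + 1) | u i. u \<in> Q_elements cs \<and> u + 1 \<in> Q_elements cs \<and> 1 \<le> i \<and> i \<le> length cs \<and>
        cf_len cs (i - 1) \<le> u \<and> u + 1 \<le> cf_len cs i \<and> cf_type cs i = 1} \<union>
     {(u + 1, u) | u i. u \<in> Q_elements cs \<and> u + 1 \<in> Q_elements cs \<and> 1 \<le> i \<and> i \<le> length cs \<and>
        cf_len cs (i - 1) \<le> u \<and> u + 1 \<le> cf_len cs i \<and> cf_type cs i = -1} \<union>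
     {(cf_len cs i + 1, cf_len cs i - 1) | i. 1 \<le> i \<and> i < length cs \<and>
        cf_type cs i = 1 \<and> cf_type cs (i + 1) = 1} \<union>
     {(cf_len cs i - 1, cf_len cs i + 1) | i. 1 \<le> i \<and> i < length cs \<and>
        cf_type cs i = -1 \<and> cf_type cs (i + 1) = -1}"

definition Q_order :: "int list \<Rightarrow> (nat \<times> nat) set" where
  "Q_order cs = (Q_covers cs)\<^sup>* \<inter> Q_elements cs \<times> Q_elements cs"

text \<open>A poset is given by its set of elements and the relation \<open>(u, v) \<in> r \<longleftrightarrow> u \<le> v\<close>.\<close>

definition order_ideals :: "'a set \<Rightarrow> ('a \<times> 'a) set \<Rightarrow> 'a set set" where
  "order_ideals A r = {I. I \<subseteq> A \<and> (\<forall>v\<in>I. \<forall>u\<in>A. (u, v) \<in> r \<longrightarrow> u \<in> I)}"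

text \<open>The F-polynomial, as a function of the values given to the variables $y_1, y_2, \ldots$\<close>

definition F_poly :: "nat set \<Rightarrow> (nat \<times> nat) set \<Rightarrow> (nat \<Rightarrow> 'a::comm_ring_1) \<Rightarrow> 'a" where
  "F_poly A r y = (\<Sum>I\<in>order_ideals A r. \<Prod>i\<in>I. y i)"

definition F_cf :: "int list \<Rightarrow> (nat \<Rightarrow> 'a::comm_ring_1) \<Rightarrow> 'a" where
  "F_cf cs y = F_poly (Q_elements cs) (Q_order cs) y"

definition y_spec :: "int list \<Rightarrow> nat \<Rightarrow> ratfun" where
  "y_spec bs k =
     (if k = 1 then
        (if bs ! 0 > 0 then ell ^ 2 * inverse ((1 - ell ^ 2 * q) / (1 - inverse q))
         else inverse (q ^ 2) * ((1 - ell ^ 2 * q) / (1 - inverse q)))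
      else if even k then - (ell ^ 2 * q)
      else - inverse q)"

definition F_tilde :: "int list \<Rightarrow> ratfun" where
  "F_tilde bs = F_cf bs (y_spec bs)"

text \<open>
  The argument \<open>k\<close> of \<open>m_shift\<close> is shifted by one: \<open>m_shift bs (n + 1)\<close> is
  $m[b_1,\ldots,b_n]$, so that \<open>m_shift bs 0\<close> is the value at the formal symbol
  $[b_1,\ldots,b_{-1}]$.
\<close>

fun m_shift :: "int list \<Rightarrow> nat \<Rightarrow> ratfun" where
  "m_shift bs 0 =
     - (inverse ell * inverse qhalf * ((1 - ell ^ 2 * q) / (1 - inverse q)))"
| "m_shift bs (Suc 0) = 1"
| "m_shift bs (Suc (Suc k)) =
     (let n = k + 1 in
      if cf_type bs n = -1 then - (ell * qhalf * m_shift bs (Suc k))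
      else if cf_type bs (n - 1) = -1
        then ell powi (- \<bar>bs ! (n - 1)\<bar>) * m_shift bs k
      else ell powi (1 - \<bar>bs ! (n - 1)\<bar>) * qhalf * m_shift bs (Suc k))"

definition m_cf :: "int list \<Rightarrow> ratfun" where
  "m_cf bs = m_shift bs (length bs + 1)"


section \<open>Oriented links in three-space\<close>

text \<open>
  An oriented (tame) link is a finite disjoint union of oriented simple closed polygons, given
  by the set of its directed edges \<open>(a, b)\<close>. Every vertex has exactly one outgoing and one
  incoming edge, and two edges meet at most in common end points.
\<close>

type_synonym edges = "((real^3) \<times> (real^3)) set"

definition polygon_points :: "edges \<Rightarrow> (real^3) set" where
  "polygon_points E = (\<Union>(a, b)\<in>E. closed_segment a b)"

definition oriented_link :: "edges \<Rightarrow> bool" where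
  "oriented_link L \<longleftrightarrow>
     finite L \<and> L \<noteq> {} \<and>
     (\<forall>(a, b)\<in>L. a \<noteq> b \<and> (\<exists>!c. (b, c) \<in> L) \<and> (\<exists>!c. (c, a) \<in> L)) \<and>
     (\<forall>(a, b)\<in>L. \<forall>(c, d)\<in>L. (a, b) \<noteq> (c, d) \<longrightarrow>
        closed_segment a b \<inter> closed_segment c d \<subseteq> {a, b} \<inter> {c, d})"

text \<open>
  Isotopy of polygonal links: the equivalence relation generated by the moves replacing an edge
  \<open>(a, b)\<close> by \<open>(a, c)\<close> and \<open>(c, b)\<close>, where the triangle \<open>a b c\<close> meets the link in the edge
  only. The point \<open>c\<close> may lie on the edge, in which case the move subdivides it.
\<close>

definition triangle_move :: "edges \<Rightarrow> edges \<Rightarrow> bool" where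
  "triangle_move L L' \<longleftrightarrow> oriented_link L \<and> oriented_link L' \<and>
     (\<exists>a b c. (a, b) \<in> L \<and> L' = L - {(a, b)} \<union> {(a, c), (c, b)} \<and>
        convex hull {a, b, c} \<inter> polygon_points L = closed_segment a b)"

definition isotopic :: "edges \<Rightarrow> edges \<Rightarrow> bool" where
  "isotopic = equivclp triangle_move"

text \<open>
  Seen against the direction \<open>w\<close>, with \<open>u\<close> pointing to the right and \<open>v\<close> upwards, two strands
  run upwards from the lower to the upper corners of the parallelogram with centre \<open>p\<close> and
  corners \<open>p \<plusminus> u \<plusminus> v\<close>. At a crossing, the over strand passes through \<open>p + w\<close> and the under
  strand through \<open>p - w\<close>; the crossing is positive if the over strand is the one from the lower
  left to the upper right corner.
\<close>

definition crossing_corners :: "real^3 \<Rightarrow> real^3 \<Rightarrow> real^3 \<Rightarrow> (real^3) set" where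
  "crossing_corners p u v = {p - u - v, p + u - v, p - u + v, p + u + v}"

definition positive_crossing :: "real^3 \<Rightarrow> real^3 \<Rightarrow> real^3 \<Rightarrow> real^3 \<Rightarrow> edges" where
  "positive_crossing p u v w =
     {(p - u - v, p + w), (p + w, p + u + v), (p + u - v, p - w), (p - w, p - u + v)}"

definition negative_crossing :: "real^3 \<Rightarrow> real^3 \<Rightarrow> real^3 \<Rightarrow> real^3 \<Rightarrow> edges" where
  "negative_crossing p u v w =
     {(p - u - v, p - w), (p - w, p + u + v), (p + u - v, p + w), (p + w, p - u + v)}"

definition smoothing :: "real^3 \<Rightarrow> real^3 \<Rightarrow> real^3 \<Rightarrow> edges" where
  "smoothing p u v = {(p - u - v, p - u + v), (p + u - v, p + u + v)}"

text \<open>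
  The three links agree outside an octahedron, and within it they consist of the two strands of a
  positive crossing, of a negative crossing and of their oriented smoothing, respectively.
\<close>

definition skein_triple :: "edges \<Rightarrow> edges \<Rightarrow> edges \<Rightarrow> bool" where
  "skein_triple Lp Lm L0 \<longleftrightarrow> oriented_link Lp \<and> oriented_link Lm \<and> oriented_link L0 \<and>
     (\<exists>p u v w R. det (vector [u, v, w] :: real^3^3) > 0 \<and>
        polygon_points R \<inter> convex hull (crossing_corners p u v \<union> {p + w, p - w})
          \<subseteq> crossing_corners p u v \<and>
        Lp = R \<union> positive_crossing p u v w \<and>
        Lm = R \<union> negative_crossing p u v w \<and>
        L0 = R \<union> smoothing p u v)"

text \<open>
  The conditions determine the values of \<open>P\<close> on oriented links; its values on sets of edges that
  are not oriented links are irrelevant.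
\<close>

definition homfly_polynomial :: "(edges \<Rightarrow> ratfun) \<Rightarrow> bool" where
  "homfly_polynomial P \<longleftrightarrow>
     (\<forall>L L'. isotopic L L' \<longrightarrow> P L = P L') \<and>
     (\<forall>a b c. \<not> collinear {a, b, c} \<longrightarrow> P {(a, b), (b, c), (c, a)} = 1) \<and>
     (\<forall>Lp Lm L0. skein_triple Lp Lm L0 \<longrightarrow>
        ell * P Lp - inverse ell * P Lm = (qhalf - inverse qhalf) * P L0)"


section \<open>Rational links\<close>

text \<open>
  The diagram is drawn in the plane \<open>z = 0\<close> and viewed from above. Strand \<open>r\<close> is at height
  \<open>y = r\<close>, the caps on the left are attached at \<open>x = 0\<close>, and the \<open>j\<close>-th crossing (counted from
  0) lies between \<open>x = j\<close> and \<open>x = j + 1\<close>. Strands 1 and 3 are oriented to the right, strands 2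
  and 4 to the left.
\<close>

definition pt :: "real \<Rightarrow> real \<Rightarrow> real^3" where
  "pt x y = vector [x, y, 0]"

definition bent_edge :: "real^3 \<Rightarrow> real^3 \<Rightarrow> real^3 \<Rightarrow> edges" where
  "bent_edge a c b = {(a, c), (c, b)}"

definition horizontal_strand :: "nat \<Rightarrow> nat \<Rightarrow> edges" where
  "horizontal_strand j r =
     (if odd r then {(pt j r, pt (j + 1) r)} else {(pt (j + 1) r, pt j r)})"

text \<open>
  The \<open>k\<close>-th crossing (counted from 0) of a twist region on the strands \<open>r\<close> and \<open>r + 1\<close>. Its two
  strands run in opposite horizontal directions, hence both upwards or both downwards. To the
  left of the crossing the position \<open>r\<close> carries a strand oriented to the right iff \<open>r + k\<close> is
  odd, since each of the \<open>k\<close> previous crossings exchanges the two strands; then both strands run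
  upwards. In the other case the picture is rotated by a half turn.
\<close>

definition twist_crossing :: "int \<Rightarrow> nat \<Rightarrow> nat \<Rightarrow> nat \<Rightarrow> edges" where
  "twist_crossing s j r k =
     (let p = pt (j + 1/2) (r + 1/2);
          d = (if odd (r + k) then 1/2 else -1/2);
          u = vector [d, 0, 0]; v = vector [0, d, 0]; w = vector [0, 0, 1]
      in if s = 1 then positive_crossing p u v w else negative_crossing p u v w)"

definition twist_column :: "int \<Rightarrow> nat \<Rightarrow> nat \<Rightarrow> nat \<Rightarrow> edges" where
  "twist_column s j r k =
     twist_crossing s j r k \<union> (\<Union>r'\<in>{1..4} - {r, r + 1}. horizontal_strand j r')"

definition twist_region :: "int list \<Rightarrow> nat \<Rightarrow> edges" where
  "twist_region bs i =
     (\<Union>k<nat \<bar>bs ! (i - 1)\<bar>.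
        twist_column (cf_type bs i) (cf_len bs (i - 1) + k) (if odd i then 2 else 3) k)"

definition left_caps :: edges where
  "left_caps = bent_edge (pt 0 2) (pt (-1) (3/2)) (pt 0 1) \<union> bent_edge (pt 0 4) (pt (-1) (7/2)) (pt 0 3)"

definition right_caps :: "nat \<Rightarrow> nat \<Rightarrow> edges" where
  "right_caps n N =
     (if odd n then
        bent_edge (pt N 1) (pt (N + 1) (3/2)) (pt N 2) \<union> bent_edge (pt N 3) (pt (N + 1) (7/2)) (pt N 4)
      else
        bent_edge (pt N 3) (pt (N + 1) (5/2)) (pt N 2) \<union> bent_edge (pt N 1) (pt (N + 2) (5/2)) (pt N 4))"

definition rational_link :: "int list \<Rightarrow> edges" where
  "rational_link bs =
     left_caps \<union> (\<Union>i\<in>{1..length bs}. twist_region bs i) \<union>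
     right_caps (length bs) (cf_len bs (length bs))"

end

(*
  Strip the diagram from its right end. In a skein triple at the last crossing of the last twist
  region, switching that crossing lets a Reidemeister II move cancel it against its neighbour, and
  smoothing it turns the rest of the region into kinks and the right caps into those of the other
  parity. If no crossing of the region is left, the twist region before it consists of kinks, too.
  Hence P satisfies a two-term recursion in |b_n|, with initial value P[b_1,...,b_{n-2}] and
  inhomogeneous term P[b_1,...,b_{n-1}]. On the other side, adding the elements of the path poset
  one at a time, the sums u and v over the order ideals without and with the last element evolve
  linearly, and y_{2i} y_{2i+1} = l^2 turns two steps into the same recursion.

  All isotopies take place in the half space to the right of the unchanged part of the link and
  move finitely many vertices with integral coordinates, so that the disjointness of a triangle
  from an edge reduces to a linear functional separating their vertices.
*)
theory Submission
  imports Defs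
begin

section \<open>Gluing and moving polygonal links\<close>

text \<open>The recursion for \<open>P\<close> refers to two earlier fractions, yet the induction
  proceeds by single terms: the pair (u, v) belonging to [b_1,...,b_n] encodes P[b_1,...,b_n] as m
  (u + v) and P[b_1,...,b_{n-1}] as a multiple of u alone if t_n = -1 and of v alone if t_n = 1. In
  each case this is the sum that is at most rescaled along the last twist region. For n = 1 the
  initial value is the two-component unlink. Its polynomial is smaller than m[b_1,...,b_{-1}] by ell
  q^{1/2}, so the general pattern fails there, and the exceptional weight of y_1 is what restores
  it. The geometric obstacle is uniformity: a move has to be valid in every column, for both
  crossing signs and next to an arbitrary diagram on the left. The column enters the separating
  functionals as an additive constant, the sign is a reflection in the plane of the diagram, and the
  diagram on the left is replaced by its four end points; what remains is a finite integral
  check.\<close>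

definition half_link :: "edges \<Rightarrow> bool" where
  "half_link E \<longleftrightarrow> finite E \<and> (\<forall>(a, b)\<in>E. a \<noteq> b) \<and> single_valued E \<and> single_valued (E\<inverse>) \<and>
     (\<forall>(a, b)\<in>E. \<forall>(c, d)\<in>E. (a, b) \<noteq> (c, d) \<longrightarrow>
        closed_segment a b \<inter> closed_segment c d \<subseteq> {a, b} \<inter> {c, d})"

definition src :: "edges \<Rightarrow> (real^3) set" where
  "src E = Domain E - Range E"

definition snk :: "edges \<Rightarrow> (real^3) set" where
  "snk E = Range E - Domain E"

lemma half_linkD:
  assumes "half_link E"
  shows "finite E" "(a, b) \<in> E \<Longrightarrow> a \<noteq> b" "(a, b) \<in> E \<Longrightarrow> (a, c) \<in> E \<Longrightarrow> b = c"
    "(b, a) \<in> E \<Longrightarrow> (c, a) \<in> E \<Longrightarrow> b = c"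
    "(a, b) \<in> E \<Longrightarrow> (c, d) \<in> E \<Longrightarrow> (a, b) \<noteq> (c, d) \<Longrightarrow> x \<in> closed_segment a b
      \<Longrightarrow> x \<in> closed_segment c d \<Longrightarrow> x \<in> {a, b} \<and> x \<in> {c, d}"
  using assms unfolding half_link_def single_valued_def by fast+

lemma half_linkI:
  assumes "finite E" "\<And>a b. (a, b) \<in> E \<Longrightarrow> a \<noteq> b"
    "\<And>a b c. (a, b) \<in> E \<Longrightarrow> (a, c) \<in> E \<Longrightarrow> b = c"
    "\<And>a b c. (b, a) \<in> E \<Longrightarrow> (c, a) \<in> E \<Longrightarrow> b = c"
    "\<And>a b c d x. (a, b) \<in> E \<Longrightarrow> (c, d) \<in> E \<Longrightarrow> (a, b) \<noteq> (c, d) \<Longrightarrow> x \<in> closed_segment a b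
      \<Longrightarrow> x \<in> closed_segment c d \<Longrightarrow> x \<in> {a, b} \<and> x \<in> {c, d}"
  shows "half_link E"
  unfolding half_link_def single_valued_def using assms(1-4)
  by (auto dest: assms(5))

text \<open>The conditions of \<open>half_link\<close> are inherited by pieces of a link, the
  existence of successors and predecessors is not. So existence is split off as an equality of two
  vertex sets; for a piece, \<open>src\<close> and \<open>snk\<close> measure its failure.\<close>

lemma oriented_link_iff:
  "oriented_link L \<longleftrightarrow> half_link L \<and> L \<noteq> {} \<and> Domain L = Range L"
proof
  assume L: "oriented_link L"
  have 1: "a \<noteq> b" "\<exists>!c. (b, c) \<in> L" "\<exists>!c. (c, a) \<in> L" if "(a, b) \<in> L" for a b
    using L that unfolding oriented_link_def by fast+
  have d: "Domain L = Range L"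
  proof (intro set_eqI iffI)
    show "x \<in> Range L" if "x \<in> Domain L" for x using that 1(3) by (meson DomainE RangeI)
    show "x \<in> Domain L" if "x \<in> Range L" for x using that 1(2) by (meson RangeE DomainI)
  qed
  have "half_link L"
  proof (rule half_linkI)
    show "finite L" using L unfolding oriented_link_def by blast
    show "a \<noteq> b" if "(a, b) \<in> L" for a b using 1(1) that .
    show "b = c" if "(a, b) \<in> L" "(a, c) \<in> L" for a b c
      using 1(3)[OF that(1)] 1(2) that by blast
    show "b = c" if "(b, a) \<in> L" "(c, a) \<in> L" for a b c
      using 1(2)[OF that(1)] 1(3) that by blast
    show "x \<in> {a, b} \<and> x \<in> {c, d}" if "(a, b) \<in> L" "(c, d) \<in> L" "(a, b) \<noteq> (c, d)"
      "x \<in> closed_segment a b" "x \<in> closed_segment c d" for a b c d x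
      using L that unfolding oriented_link_def by fast
  qed
  with d L show "half_link L \<and> L \<noteq> {} \<and> Domain L = Range L"
    unfolding oriented_link_def by blast
next
  assume L: "half_link L \<and> L \<noteq> {} \<and> Domain L = Range L"
  have *: "a \<noteq> b \<and> (\<exists>!c. (b, c) \<in> L) \<and> (\<exists>!c. (c, a) \<in> L)" if "(a, b) \<in> L" for a b
  proof (intro conjI)
    show "a \<noteq> b" using half_linkD(2) L that by metis
    have "b \<in> Domain L" "a \<in> Range L" using L that by auto
    then show "\<exists>!c. (b, c) \<in> L" "\<exists>!c. (c, a) \<in> L"
      using half_linkD(3,4)[of L] L by (meson DomainE RangeE)+
  qed
  have "\<forall>(a, b)\<in>L. a \<noteq> b \<and> (\<exists>!c. (b, c) \<in> L) \<and> (\<exists>!c. (c, a) \<in> L)"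
    by (rule ballI, rule case_prodI2, rule *, simp only:)
  moreover have "\<forall>(a, b)\<in>L. \<forall>(c, d)\<in>L. (a, b) \<noteq> (c, d) \<longrightarrow>
        closed_segment a b \<inter> closed_segment c d \<subseteq> {a, b} \<inter> {c, d}" "finite L" "L \<noteq> {}"
    using L unfolding half_link_def by simp_all
  ultimately show "oriented_link L" unfolding oriented_link_def by (intro conjI)
qed

section \<open>Removing and inserting a single vertex\<close>

lemma polygon_points_simps [simp]:
  "polygon_points {} = {}"
  "polygon_points (insert (a, b) R) = closed_segment a b \<union> polygon_points R"
  "polygon_points (R \<union> S) = polygon_points R \<union> polygon_points S"
  unfolding polygon_points_def by auto

lemma polygon_pointsI:
  "(a, b) \<in> R \<Longrightarrow> x \<in> closed_segment a b \<Longrightarrow> x \<in> polygon_points R"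
  unfolding polygon_points_def by auto

lemma polygon_points_Domain: "a \<in> Domain R \<Longrightarrow> a \<in> polygon_points R"
  and polygon_points_Range: "a \<in> Range R \<Longrightarrow> a \<in> polygon_points R"
  unfolding polygon_points_def by force+

lemma segment_not_subset_ends:
  fixes a b :: "'a::real_vector"
  assumes "a \<noteq> b" shows "\<not> closed_segment a b \<subseteq> {a, b}"
  by (metis assms finite.emptyI finite_closed_segment finite_insert finite_subset)

text \<open>Embeddedness passes to the shorter link: a point of the new edge on the rest is
  \<open>a\<close> or \<open>b\<close> by the triangle hypothesis, and as an end point of an old
  edge it is then also an end point of the other edge through it.\<close>

lemma remove_vertex:
  assumes L: "oriented_link (insert (a, c) (insert (c, b) R))"
    and t: "convex hull {a, b, c} \<inter> polygon_points R \<subseteq> {a, b}"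
  shows "oriented_link (insert (a, b) R)"
    and "triangle_move (insert (a, b) R) (insert (a, c) (insert (c, b) R))"
proof -
  let ?L = "insert (a, c) (insert (c, b) R)"
  have h: "half_link ?L" and d: "Domain ?L = Range ?L" using L oriented_link_iff by auto
  note hD = half_linkD[OF h]
  have ca: "c \<noteq> a" "c \<noteq> b" using hD(2) by blast+
  have ch: "c \<in> convex hull {a, b, c}" by (simp add: hull_inc)
  have cR: "c \<notin> polygon_points R" using t ch ca by blast
  have cR': "c \<notin> Domain R" "c \<notin> Range R" using cR polygon_points_Domain polygon_points_Range by blast+
  \<comment> \<open>Otherwise the edges to and from \<open>c\<close> would be one segment traversed
    twice.\<close>
  have ab: "a \<noteq> b"
  proof
    assume "a = b"
    then have "x \<in> {a, c}" if "x \<in> closed_segment a c" for x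
    proof -
      have "(a, c) \<in> ?L" "(c, a) \<in> ?L" "(a, c) \<noteq> (c, a)" "x \<in> closed_segment c a"
        using \<open>a = b\<close> ca(1) that by (auto simp: closed_segment_commute)
      from hD(5)[OF this(1-3) that this(4)] show ?thesis by blast
    qed
    then show False using segment_not_subset_ends[of a c] ca by blast
  qed
  have sub: "closed_segment a b \<subseteq> convex hull {a, b, c}"
    unfolding segment_convex_hull by (rule hull_mono) auto
  have seg: "x \<in> {a, b} \<and> x \<in> {d, e}"
    if "(d, e) \<in> R" "x \<in> closed_segment a b" "x \<in> closed_segment d e" for d e x
  proof -
    have x: "x \<in> {a, b}" using that sub t polygon_pointsI[OF that(1,3)] by blast
    have ne: "(d, e) \<noteq> (a, c)" "(d, e) \<noteq> (c, b)" using that cR' by auto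
    have "x \<in> {d, e}"
    proof (cases "x = a")
      case True
      then show ?thesis using hD(5)[of a c d e x] that ne by auto
    next
      case False
      then show ?thesis using hD(5)[of c b d e x] that ne x by auto
    qed
    with x show ?thesis by blast
  qed
  have abR: "(a, b) \<notin> R"
    using seg[of a b] segment_not_subset_ends[OF ab] by blast
  have "half_link (insert (a, b) R)"
  proof (rule half_linkI)
    show "finite (insert (a, b) R)" using hD(1) by auto
    show "x \<noteq> y" if "(x, y) \<in> insert (a, b) R" for x y using that ab hD(2)[of x y] by auto
    show "y = z" if "(x, y) \<in> insert (a, b) R" "(x, z) \<in> insert (a, b) R" for x y z
      using that hD(3)[of x y z] hD(3)[of a c y] hD(3)[of a c z] cR' by auto
    show "y = z" if "(y, x) \<in> insert (a, b) R" "(z, x) \<in> insert (a, b) R" for x y z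
      using that hD(4)[of y x z] hD(4)[of c b y] hD(4)[of c b z] cR' by auto
    show "x \<in> {p, q} \<and> x \<in> {d, e}" if "(p, q) \<in> insert (a, b) R" "(d, e) \<in> insert (a, b) R"
      "(p, q) \<noteq> (d, e)" "x \<in> closed_segment p q" "x \<in> closed_segment d e" for p q d e x
      using that seg[of d e x] seg[of p q x] hD(5)[of p q d e x] by auto
  qed
  moreover have "Domain (insert (a, b) R) = Range (insert (a, b) R)"
    using d cR' ca by (auto simp: set_eq_iff)
  ultimately show o: "oriented_link (insert (a, b) R)" using oriented_link_iff by auto
  have "insert (a, c) (insert (c, b) R) = insert (a, b) R - {(a, b)} \<union> {(a, c), (c, b)}"
    using abR by auto
  moreover have "convex hull {a, b, c} \<inter> polygon_points (insert (a, b) R) = closed_segment a b"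
    using sub t by auto
  ultimately show "triangle_move (insert (a, b) R) (insert (a, c) (insert (c, b) R))"
    unfolding triangle_move_def using o L by blast
qed

text \<open>The condition on the segments at \<open>c\<close> excludes backtracking: when the three
  points are collinear the new edges could overlap each other, which the triangle hypothesis cannot
  detect.\<close>

lemma insert_vertex:
  assumes L: "oriented_link (insert (a, b) R)"
    and t: "convex hull {a, b, c} \<inter> polygon_points R \<subseteq> {a, b}"
    and c: "c \<noteq> a" "c \<noteq> b" "closed_segment a c \<inter> closed_segment c b \<subseteq> {c}"
  shows "oriented_link (insert (a, c) (insert (c, b) R))"
    and "triangle_move (insert (a, b) R) (insert (a, c) (insert (c, b) R))"
proof -
  have h: "half_link (insert (a, b) R)" and d: "Domain (insert (a, b) R) = Range (insert (a, b) R)"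
    using L oriented_link_iff by auto
  note hD = half_linkD[OF h]
  have ch: "c \<in> convex hull {a, b, c}" by (simp add: hull_inc)
  have cR: "c \<notin> polygon_points R" using t ch c by blast
  have cR': "c \<notin> Domain R" "c \<notin> Range R" using cR polygon_points_Domain polygon_points_Range by blast+
  have ab: "a \<noteq> b" using hD(2) by blast
  have sub: "closed_segment a b \<subseteq> convex hull {a, b, c}" "closed_segment a c \<subseteq> convex hull {a, b, c}"
     "closed_segment c b \<subseteq> convex hull {a, b, c}"
    unfolding segment_convex_hull by (rule hull_mono; auto)+
  have abR: "(a, b) \<notin> R"
    using sub(1) t segment_not_subset_ends[OF ab] polygon_pointsI[of a b R] by blast
  have aD: "a \<notin> Domain R" using hD(3)[of a b] abR by auto
  have bR: "b \<notin> Range R" using hD(4)[of a b] abR by auto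
  have ends: "x \<in> {d, e}" if "(d, e) \<in> R" "x \<in> {a, b}" "x \<in> closed_segment d e" for d e x
    using that hD(5)[of a b d e x] abR by auto
  have nac: "a \<notin> closed_segment c b" using c by auto
  have nbc: "b \<notin> closed_segment a c" using c by auto
  have seg1: "x \<in> {a, c} \<and> x \<in> {d, e}"
    if "(d, e) \<in> R" "x \<in> closed_segment a c" "x \<in> closed_segment d e" for d e x
  proof -
    have "x \<in> {a, b}" using that sub t polygon_pointsI[OF that(1,3)] by blast
    with that nbc ends show ?thesis by auto
  qed
  have seg2: "x \<in> {c, b} \<and> x \<in> {d, e}"
    if "(d, e) \<in> R" "x \<in> closed_segment c b" "x \<in> closed_segment d e" for d e x
  proof -
    have "x \<in> {a, b}" using that sub t polygon_pointsI[OF that(1,3)] by blast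
    with that nac ends show ?thesis by auto
  qed
  let ?L = "insert (a, c) (insert (c, b) R)"
  have "half_link ?L"
  proof (rule half_linkI)
    show "finite ?L" using hD(1) by auto
    show "x \<noteq> y" if "(x, y) \<in> ?L" for x y using that c hD(2)[of x y] by auto
    show "y = z" if "(x, y) \<in> ?L" "(x, z) \<in> ?L" for x y z
      using that hD(3)[of x y z] aD cR' c by auto
    show "y = z" if "(y, x) \<in> ?L" "(z, x) \<in> ?L" for x y z
      using that hD(4)[of y x z] bR cR' c by auto
    show "x \<in> {p, q} \<and> x \<in> {d, e}" if "(p, q) \<in> ?L" "(d, e) \<in> ?L"
      "(p, q) \<noteq> (d, e)" "x \<in> closed_segment p q" "x \<in> closed_segment d e" for p q d e x
      using that seg1[of d e x] seg1[of p q x] seg2[of d e x] seg2[of p q x]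
        hD(5)[of p q d e x] c(3) by auto
  qed
  moreover have "Domain ?L = Range ?L"
    using d by (auto simp: set_eq_iff)
  ultimately show o: "oriented_link ?L" using oriented_link_iff by auto
  have "?L = insert (a, b) R - {(a, b)} \<union> {(a, c), (c, b)}"
    using abR by auto
  moreover have "convex hull {a, b, c} \<inter> polygon_points (insert (a, b) R) = closed_segment a b"
    using sub t by auto
  ultimately show "triangle_move (insert (a, b) R) ?L"
    unfolding triangle_move_def using o L by blast
qed

text \<open>A free end lying on an edge of its own piece is an end point of that edge, since it is
  already a vertex of the piece. So every common point is a vertex on both sides, and pairing
  sources with sinks keeps all in- and out-degrees at most one.\<close>

lemma half_link_glue:
  assumes h: "half_link E" "half_link F"
    and V: "polygon_points E \<inter> polygon_points F \<subseteq> (snk E \<inter> src F) \<union> (src E \<inter> snk F)"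
  shows "half_link (E \<union> F)"
proof (rule half_linkI)
  note hE = half_linkD[OF h(1)] and hF = half_linkD[OF h(2)]
  have V1: "x \<in> (snk E \<inter> src F) \<union> (src E \<inter> snk F)"
    if "(a, b) \<in> E" "(c, d) \<in> F" "x \<in> closed_segment a b" "x \<in> closed_segment c d" for a b c d x
    using V that polygon_pointsI by blast
  show "finite (E \<union> F)" using hE hF by auto
  show "a \<noteq> b" if "(a, b) \<in> E \<union> F" for a b using that hE(2) hF(2) by auto
  have DD: "x \<notin> Domain F" if "x \<in> Domain E" for x
    using that V polygon_points_Domain unfolding src_def snk_def by blast
  have RR: "x \<notin> Range F" if "x \<in> Range E" for x
    using that V polygon_points_Range unfolding src_def snk_def by blast
  show "b = c" if "(a, b) \<in> E \<union> F" "(a, c) \<in> E \<union> F" for a b c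
    using that hE(3) hF(3) DD by (metis DomainI UnE)
  show "b = c" if "(b, a) \<in> E \<union> F" "(c, a) \<in> E \<union> F" for a b c
    using that hE(4) hF(4) RR by (metis RangeI UnE)
  have endE: "x \<in> {a, b}" if "(a, b) \<in> E" "x \<in> closed_segment a b" and x: "x \<in> snk E \<union> src E" for a b x
  proof -
    obtain y z where yz: "(y, z) \<in> E" "x = y \<or> x = z" using x unfolding src_def snk_def by auto
    then have "x \<in> closed_segment y z" by auto
    then show ?thesis using hE(5)[OF that(1) yz(1)] that(2) yz(2) by fastforce
  qed
  have endF: "x \<in> {a, b}" if "(a, b) \<in> F" "x \<in> closed_segment a b" and x: "x \<in> snk F \<union> src F" for a b x
  proof -
    obtain y z where yz: "(y, z) \<in> F" "x = y \<or> x = z" using x unfolding src_def snk_def by auto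
    then have "x \<in> closed_segment y z" by auto
    then show ?thesis using hF(5)[OF that(1) yz(1)] that(2) yz(2) by fastforce
  qed
  have EF: "x \<in> {a, b} \<and> x \<in> {c, d}"
    if "(a, b) \<in> E" "(c, d) \<in> F" "x \<in> closed_segment a b" "x \<in> closed_segment c d" for a b c d x
    using V1[OF that(1,2,3,4)] endE[of a b x] endF[of c d x] that by blast
  show "x \<in> {a, b} \<and> x \<in> {c, d}" if "(a, b) \<in> E \<union> F" "(c, d) \<in> E \<union> F" "(a, b) \<noteq> (c, d)"
    "x \<in> closed_segment a b" "x \<in> closed_segment c d" for a b c d x
    using that hE(5)[of a b c d x] hF(5)[of a b c d x] EF[of a b c d x] EF[of c d a b x] by blast
qed

lemma isotopic_refl [simp]: "isotopic L L"
  and isotopic_sym: "isotopic L L' \<Longrightarrow> isotopic L' L"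
  and isotopic_trans [trans]: "isotopic L L' \<Longrightarrow> isotopic L' L'' \<Longrightarrow> isotopic L L''"
  and isotopic_move: "triangle_move L L' \<Longrightarrow> isotopic L L'"
  unfolding isotopic_def by (auto intro: equivclp_sym equivclp_trans)

text \<open>If the maximum of the functional on the first hull and its minimum on the second one agree,
  then both are attained at a single point, common to the two sets.\<close>

lemma separated_hulls:
  fixes T S :: "'a::real_inner set"
  assumes fin: "finite T" "finite S"
    and sep: "\<And>t s. t \<in> T \<Longrightarrow> s \<in> S \<Longrightarrow> t = s \<or> n \<bullet> t < n \<bullet> s"
  shows "convex hull T \<inter> convex hull S \<subseteq> T \<inter> S"
proof
  fix x assume x: "x \<in> convex hull T \<inter> convex hull S"
  then have ne: "T \<noteq> {}" "S \<noteq> {}" by auto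
  define k where "k = Max ((\<bullet>) n ` T)"
  define m where "m = Min ((\<bullet>) n ` S)"
  obtain t where t: "t \<in> T" "n \<bullet> t = k"
    using Max_in[of "(\<bullet>) n ` T"] fin ne unfolding k_def by fastforce
  obtain s where s: "s \<in> S" "n \<bullet> s = m"
    using Min_in[of "(\<bullet>) n ` S"] fin ne unfolding m_def by fastforce
  have T: "T \<subseteq> {y. n \<bullet> y \<le> k}" unfolding k_def using fin by auto
  have S: "S \<subseteq> {y. n \<bullet> y \<ge> m}" unfolding m_def using fin by auto
  have "convex hull T \<subseteq> {y. n \<bullet> y \<le> k}" by (rule hull_minimal[where S = convex, OF T convex_halfspace_le])
  moreover have "convex hull S \<subseteq> {y. n \<bullet> y \<ge> m}" by (rule hull_minimal[where S = convex, OF S convex_halfspace_ge])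
  ultimately have mk: "m \<le> n \<bullet> x" "n \<bullet> x \<le> k" using x by auto
  with sep[OF t(1) s(1)] t(2) s(2) have ts: "t = s" by auto
  with s t mk have nx: "n \<bullet> x = k" by auto
  have "x = t"
  proof (cases "T - {t} = {}")
    case True
    then have "T = {t}" using t by auto
    then show ?thesis using x by auto
  next
    case False
    have "T = insert t (T - {t})" using t by auto
    then have "x \<in> convex hull (insert t (T - {t}))" using x by auto
    then obtain u v y where u: "u \<ge> 0" "v \<ge> 0" "u + v = 1" "y \<in> convex hull (T - {t})"
      "x = u *\<^sub>R t + v *\<^sub>R y" unfolding convex_hull_insert[OF False] by blast
    have "T - {t} \<subseteq> {y. n \<bullet> y < k}" using sep[OF _ s(1)] ts s(2) t(2) by auto
    then have "convex hull (T - {t}) \<subseteq> {y. n \<bullet> y < k}"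
      by (rule hull_minimal) (rule convex_halfspace_lt)
    then have y: "n \<bullet> y < k" using u by auto
    have uk: "u = 1 - v" using u by auto
    have "n \<bullet> x = u * k + v * (n \<bullet> y)" using u t by (simp add: inner_add_right)
    then have "v * (k - n \<bullet> y) = 0" using nx unfolding uk by (simp add: algebra_simps)
    then have "v = 0" using y by auto
    then show ?thesis using u by auto
  qed
  then show "x \<in> T \<inter> S" using t s ts by auto
qed

section \<open>Tangles with integral vertices\<close>

type_synonym point = "int \<times> int \<times> int"

text \<open>Horizontal coordinates are doubled. The map with \<open>\<epsilon> = -1\<close> exchanges over and under
  strands.\<close>

definition emb :: "real \<Rightarrow> real \<Rightarrow> point \<Rightarrow> real^3" where
  "emb N \<epsilon> = (\<lambda>(x, y, z). vector [N + of_int x / 2, of_int y / 2, \<epsilon> * of_int z])"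

definition emb_edge :: "real \<Rightarrow> real \<Rightarrow> point \<times> point \<Rightarrow> (real^3) \<times> (real^3)" where
  "emb_edge N \<epsilon> = map_prod (emb N \<epsilon>) (emb N \<epsilon>)"

fun dot :: "point \<Rightarrow> point \<Rightarrow> int" where
  "dot (a, b, c) (x, y, z) = a * x + b * y + c * z"

text \<open>Found by a computer search: up to sign, every separation needed below is witnessed by one of these.\<close>

definition functionals :: "point list" where
  "functionals = [(1, -3, 1), (4, 3, -4), (1, -1, -4), (1, 3, 4), (0, 2, -3), (2, 1, 4), (1, -1, 1), (0, 2, -1)]"

definition below :: "point \<Rightarrow> point list \<Rightarrow> point list \<Rightarrow> bool" where
  "below n T S \<longleftrightarrow> list_all (\<lambda>t. list_all (\<lambda>s. dot n t < dot n s \<or> t = s) S) T"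

definition separated :: "point list \<Rightarrow> point list \<Rightarrow> bool" where
  "separated T S \<longleftrightarrow> list_ex (\<lambda>n. below n T S \<or> below n S T) functionals"

definition dual :: "real \<Rightarrow> point \<Rightarrow> real^3" where
  "dual \<epsilon> = (\<lambda>(a, b, c). vector [2 * of_int a, 2 * of_int b, \<epsilon> * of_int c])"

text \<open>The summand with \<open>N\<close> does not depend on \<open>p\<close>, and
  \<open>\<epsilon>\<close> has cancelled: one inequality between integral values of
  \<open>dot\<close> separates the points in every column and in both mirror images.\<close>

lemma inner_dual_emb:
  assumes "\<epsilon> * \<epsilon> = 1"
  shows "dual \<epsilon> n \<bullet> emb N \<epsilon> p = 2 * of_int (fst n) * N + of_int (dot n p)"
proof -
  obtain a b c x y z where n: "n = (a, b, c)" "p = (x, y, z)" by (metis prod_cases3)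
  have "\<epsilon> * of_int c * (\<epsilon> * of_int z) = (\<epsilon> * \<epsilon>) * (of_int c * of_int z :: real)" by simp
  then show ?thesis using assms
    by (simp add: n dual_def emb_def inner_vec_def sum_3 algebra_simps)
qed

lemma emb_eq_iff: "\<epsilon> \<noteq> 0 \<Longrightarrow> emb N \<epsilon> p = emb N \<epsilon> p' \<longleftrightarrow> p = p'"
  by (cases p; cases p') (auto simp: emb_def vec_eq_iff forall_3)

lemma inj_emb: "\<epsilon> \<noteq> 0 \<Longrightarrow> inj (emb N \<epsilon>)"
  by (simp add: inj_def emb_eq_iff)

lemma below_imp:
  assumes "below n T S" "\<epsilon> * \<epsilon> = 1"
  shows "convex hull (emb N \<epsilon> ` set T) \<inter> convex hull (emb N \<epsilon> ` set S) \<subseteq> emb N \<epsilon> ` (set T \<inter> set S)"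
proof -
  have "\<epsilon> \<noteq> 0" using assms(2) by auto
  then have "emb N \<epsilon> ` (set T \<inter> set S) = emb N \<epsilon> ` set T \<inter> emb N \<epsilon> ` set S"
    by (simp add: image_Int inj_emb)
  moreover have "convex hull (emb N \<epsilon> ` set T) \<inter> convex hull (emb N \<epsilon> ` set S)
      \<subseteq> emb N \<epsilon> ` set T \<inter> emb N \<epsilon> ` set S"
  proof (rule separated_hulls[where n = "dual \<epsilon> n"])
    fix t s assume "t \<in> emb N \<epsilon> ` set T" "s \<in> emb N \<epsilon> ` set S"
    then obtain t' s' where "t' \<in> set T" "s' \<in> set S" "t = emb N \<epsilon> t'" "s = emb N \<epsilon> s'" by blast
    moreover have "dot n t' < dot n s' \<or> t' = s'" 
      using assms(1) calculation unfolding below_def list_all_iff by blast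
    ultimately show "t = s \<or> dual \<epsilon> n \<bullet> t < dual \<epsilon> n \<bullet> s"
      by (auto simp: inner_dual_emb[OF assms(2)])
  qed auto
  ultimately show ?thesis by simp
qed

lemma separated_imp:
  assumes "separated T S" "\<epsilon> * \<epsilon> = 1"
  shows "convex hull (emb N \<epsilon> ` set T) \<inter> convex hull (emb N \<epsilon> ` set S) \<subseteq> emb N \<epsilon> ` (set T \<inter> set S)"
proof -
  obtain n where "below n T S \<or> below n S T" using assms(1) unfolding separated_def list_ex_iff by blast
  then show ?thesis
    using below_imp[of n T S \<epsilon> N] below_imp[of n S T \<epsilon> N] assms(2) by (metis Int_commute)
qed

text \<open>An edge is coloured by the index of the strand containing it; all edges of a strand are
  oriented as listed or, if the orientation is \<open>False\<close>, all of them are reversed.\<close>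

type_synonym tangle = "(nat \<times> point \<times> point) list"

definition strand :: "nat \<Rightarrow> point list \<Rightarrow> tangle" where
  "strand i vs = map (\<lambda>(a, b). (i, a, b)) (zip vs (tl vs))"

definition orient :: "(nat \<Rightarrow> bool) \<Rightarrow> nat \<times> point \<times> point \<Rightarrow> point \<times> point" where
  "orient d = (\<lambda>(i, a, b). if d i then (a, b) else (b, a))"

definition tangle_edges :: "real \<Rightarrow> real \<Rightarrow> (nat \<Rightarrow> bool) \<Rightarrow> tangle \<Rightarrow> edges" where
  "tangle_edges N \<epsilon> d S = (\<lambda>e. emb_edge N \<epsilon> (orient d e)) ` set S"

section \<open>Executable triangle moves with fixed end points\<close>

datatype move = Del point | Ins point point

text \<open>The points \<open>B\<close> stand for the rest of the diagram, which meets the half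
  space of non-negative first coordinate nowhere else; hence the test that the triangle lies in it.
  Separation confines an intersection to common vertices, and excluding \<open>c\<close> leaves only
  \<open>a\<close> and \<open>b\<close>.\<close>

definition free :: "point list \<Rightarrow> point \<Rightarrow> point \<Rightarrow> point \<Rightarrow> tangle \<Rightarrow> bool" where
  "free B a b c S \<longleftrightarrow> list_all (\<lambda>p. fst p \<ge> 0) [a, b, c] \<and>
     list_all (\<lambda>p. p \<noteq> c \<and> separated [a, b, c] [p]) B \<and>
     list_all (\<lambda>(i, p, q). p \<noteq> c \<and> q \<noteq> c \<and> separated [a, b, c] [p, q]) S"

text \<open>The test \<open>i = j\<close> guarantees that the two edges at \<open>c\<close> are
  oriented coherently. Reversing a strand only exchanges the roles of \<open>a\<close> and
  \<open>b\<close>, so the check is made once for both directions.\<close>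

fun make_move :: "point list \<Rightarrow> move \<Rightarrow> tangle \<Rightarrow> tangle option" where
  "make_move B (Del c) S =
     (case (find (\<lambda>(i, a, b). b = c) S, find (\<lambda>(i, a, b). a = c) S) of
        (Some (i, a, _), Some (j, _, b)) \<Rightarrow>
          let S' = filter (\<lambda>e. e \<noteq> (i, a, c) \<and> e \<noteq> (i, c, b)) S
          in if i = j \<and> free B a b c S' then Some ((i, a, b) # S') else None
      | _ \<Rightarrow> None)"
| "make_move B (Ins a c) S =
     (case find (\<lambda>(i, a', b). a' = a) S of
        Some (i, _, b) \<Rightarrow>
          let S' = filter (\<lambda>e. e \<noteq> (i, a, b)) S
          in if a \<noteq> c \<and> c \<noteq> b \<and> separated [a, c] [c, b] \<and> free B a b c S'
             then Some ((i, a, c) # (i, c, b) # S') else None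
      | _ \<Rightarrow> None)"

fun make_moves :: "point list \<Rightarrow> move list \<Rightarrow> tangle \<Rightarrow> tangle option" where
  "make_moves B [] S = Some S"
| "make_moves B (m # ms) S = Option.bind (make_move B m S) (make_moves B ms)"

lemma emb_nth1: "emb N \<epsilon> p $ 1 = N + of_int (fst p) / 2"
  by (cases p) (simp add: emb_def)

lemma emb_edge_simps [simp]: "emb_edge N \<epsilon> (a, b) = (emb N \<epsilon> a, emb N \<epsilon> b)"
  by (simp add: emb_edge_def)

lemma tangle_edges_Cons:
  "tangle_edges N \<epsilon> d ((i, a, b) # S) =
     insert (if d i then (emb N \<epsilon> a, emb N \<epsilon> b) else (emb N \<epsilon> b, emb N \<epsilon> a)) (tangle_edges N \<epsilon> d S)"
  by (simp add: tangle_edges_def orient_def)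

lemma polygon_points_tangle_edges:
  "polygon_points (tangle_edges N \<epsilon> d S) = (\<Union>(i, a, b)\<in>set S. convex hull {emb N \<epsilon> a, emb N \<epsilon> b})"
  by (force simp: polygon_points_def tangle_edges_def orient_def segment_convex_hull insert_commute
      split: if_splits)

lemma free_imp:
  assumes f: "free B a b c S" and e: "\<epsilon> * \<epsilon> = 1"
    and R: "polygon_points R \<inter> {x. x $ 1 \<ge> N} \<subseteq> emb N \<epsilon> ` set B"
  shows "convex hull {emb N \<epsilon> a, emb N \<epsilon> b, emb N \<epsilon> c} \<inter> polygon_points (R \<union> tangle_edges N \<epsilon> d S)
    \<subseteq> {emb N \<epsilon> a, emb N \<epsilon> b}"
proof
  let ?h = "convex hull {emb N \<epsilon> a, emb N \<epsilon> b, emb N \<epsilon> c}"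
  fix x assume x: "x \<in> ?h \<inter> polygon_points (R \<union> tangle_edges N \<epsilon> d S)"
  have sep: "x \<in> emb N \<epsilon> ` (set [a, b, c] \<inter> set T)"
    if "separated [a, b, c] T" "x \<in> convex hull (emb N \<epsilon> ` set T)" for T
    using separated_imp[OF that(1) e, of N] that(2) x by auto
  from x consider "x \<in> polygon_points R" | "x \<in> polygon_points (tangle_edges N \<epsilon> d S)" by auto
  then show "x \<in> {emb N \<epsilon> a, emb N \<epsilon> b}"
  proof cases
    case 1
    have "?h \<subseteq> {x. x $ 1 \<ge> N}"
    proof (rule hull_minimal)
      show "{emb N \<epsilon> a, emb N \<epsilon> b, emb N \<epsilon> c} \<subseteq> {x. x $ 1 \<ge> N}"
        using f by (auto simp: free_def emb_nth1)
      show "convex {x::real^3. x $ 1 \<ge> N}"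
        using convex_halfspace_ge[of N "axis 1 1 :: real^3"] by (simp add: inner_axis' )
    qed
    then obtain p where p: "p \<in> set B" "x = emb N \<epsilon> p" using R 1 x by auto
    then have "p \<noteq> c" "separated [a, b, c] [p]" using f by (auto simp: free_def list_all_iff)
    then show ?thesis using sep[of "[p]"] p by auto
  next
    case 2
    then obtain i p q where p: "(i, p, q) \<in> set S" "x \<in> convex hull {emb N \<epsilon> p, emb N \<epsilon> q}"
      unfolding polygon_points_tangle_edges by auto
    then have "p \<noteq> c" "q \<noteq> c" "separated [a, b, c] [p, q]" using f by (auto simp: free_def list_all_iff)
    then show ?thesis using sep[of "[p, q]"] p by auto
  qed
qed

lemma make_move_sound:
  assumes m: "make_move B m S = Some S'" and e: "\<epsilon> * \<epsilon> = 1"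
    and R: "polygon_points R \<inter> {x. x $ 1 \<ge> N} \<subseteq> emb N \<epsilon> ` set B"
    and L: "oriented_link (R \<union> tangle_edges N \<epsilon> d S)"
  shows "oriented_link (R \<union> tangle_edges N \<epsilon> d S') \<and>
    isotopic (R \<union> tangle_edges N \<epsilon> d S) (R \<union> tangle_edges N \<epsilon> d S')"
proof (cases m)
  case (Del c)
  from m obtain i a c1 j c2 b where f: "find (\<lambda>(i, a, b). b = c) S = Some (i, a, c1)"
    "find (\<lambda>(i, a, b). a = c) S = Some (j, c2, b)"
    unfolding Del by (auto split: option.splits)
  then have c: "c1 = c" "c2 = c" "(i, a, c) \<in> set S" "(j, c, b) \<in> set S"
    by (auto simp: find_Some_iff) (metis nth_mem)+
  define T where "T = filter (\<lambda>e. e \<noteq> (i, a, c) \<and> e \<noteq> (i, c, b)) S"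
  have ij: "i = j" and fr: "free B a b c T" and S': "S' = (i, a, b) # T"
    using m f c unfolding Del T_def by (auto simp: Let_def split: if_splits)
  have "set S = set ((i, a, c) # (i, c, b) # T)" using c ij unfolding T_def by auto
  then have S: "tangle_edges N \<epsilon> d S = tangle_edges N \<epsilon> d ((i, a, c) # (i, c, b) # T)"
    unfolding tangle_edges_def by simp
  note h = free_imp[OF fr e R, of d]
  show ?thesis
  proof (cases "d i")
    case True
    then show ?thesis
      using remove_vertex[of "emb N \<epsilon> a" "emb N \<epsilon> c" "emb N \<epsilon> b" "R \<union> tangle_edges N \<epsilon> d T"] h L
      unfolding S S' tangle_edges_Cons by (auto intro: isotopic_sym isotopic_move)
  next
    case False
    then show ?thesis
      using remove_vertex[of "emb N \<epsilon> b" "emb N \<epsilon> c" "emb N \<epsilon> a" "R \<union> tangle_edges N \<epsilon> d T"] h L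
      unfolding S S' tangle_edges_Cons
      by (auto intro: isotopic_sym isotopic_move simp: insert_commute)
  qed
next
  case (Ins a c)
  from m obtain i a1 b where f: "find (\<lambda>(i, a', b). a' = a) S = Some (i, a1, b)"
    unfolding Ins by (auto split: option.splits)
  then have c: "a1 = a" "(i, a, b) \<in> set S"
    by (auto simp: find_Some_iff) (metis nth_mem)+
  define T where "T = filter (\<lambda>e. e \<noteq> (i, a, b)) S"
  have ne: "a \<noteq> c" "c \<noteq> b" and sp: "separated [a, c] [c, b]" and fr: "free B a b c T"
    and S': "S' = (i, a, c) # (i, c, b) # T"
    using m f c unfolding Ins T_def by (auto simp: Let_def split: if_splits)
  have "set S = set ((i, a, b) # T)" using c unfolding T_def by auto
  then have S: "tangle_edges N \<epsilon> d S = tangle_edges N \<epsilon> d ((i, a, b) # T)"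
    unfolding tangle_edges_def by simp
  note h = free_imp[OF fr e R, of d]
  \<comment> \<open>\<open>separated\<close> bounds the intersection of the new edges by the common
    vertices of \<open>[a, c]\<close> and \<open>[c, b]\<close>, which is only \<open>c\<close> once
    \<open>a\<close> and \<open>b\<close> differ.\<close>
  have ab: "emb N \<epsilon> a \<noteq> emb N \<epsilon> b"
  proof -
    have "half_link (R \<union> tangle_edges N \<epsilon> d S)" using L oriented_link_iff by auto
    moreover have "(emb N \<epsilon> a, emb N \<epsilon> b) \<in> R \<union> tangle_edges N \<epsilon> d S \<or>
        (emb N \<epsilon> b, emb N \<epsilon> a) \<in> R \<union> tangle_edges N \<epsilon> d S"
      unfolding S tangle_edges_Cons by simp
    ultimately show ?thesis using half_linkD(2) by metis
  qed
  have e0: "\<epsilon> \<noteq> 0" using e by auto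
  have ne': "emb N \<epsilon> c \<noteq> emb N \<epsilon> a" "emb N \<epsilon> c \<noteq> emb N \<epsilon> b"
    using ne e0 by (auto simp: emb_eq_iff)
  have "set [a, c] \<inter> set [c, b] = {c}" using ab by auto
  then have sp': "closed_segment (emb N \<epsilon> a) (emb N \<epsilon> c) \<inter> closed_segment (emb N \<epsilon> c) (emb N \<epsilon> b)
    \<subseteq> {emb N \<epsilon> c}"
    using separated_imp[OF sp e, of N] unfolding \<open>set [a, c] \<inter> set [c, b] = {c}\<close>
    by (simp add: segment_convex_hull)
  show ?thesis
  proof (cases "d i")
    case True
    then show ?thesis
      using insert_vertex[of "emb N \<epsilon> a" "emb N \<epsilon> b" "R \<union> tangle_edges N \<epsilon> d T" "emb N \<epsilon> c"] h L sp' ne'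
      unfolding S S' tangle_edges_Cons by (auto intro: isotopic_sym isotopic_move)
  next
    case False
    then show ?thesis
      using insert_vertex[of "emb N \<epsilon> b" "emb N \<epsilon> a" "R \<union> tangle_edges N \<epsilon> d T" "emb N \<epsilon> c"] h L sp' ne'
      unfolding S S' tangle_edges_Cons
      by (auto intro: isotopic_sym isotopic_move simp: insert_commute closed_segment_commute Int_commute)
  qed
qed

lemma make_moves_sound:
  assumes "make_moves B ms S = Some S'" "\<epsilon> * \<epsilon> = 1"
    and "polygon_points R \<inter> {x. x $ 1 \<ge> N} \<subseteq> emb N \<epsilon> ` set B"
    and "oriented_link (R \<union> tangle_edges N \<epsilon> d S)"
  shows "oriented_link (R \<union> tangle_edges N \<epsilon> d S') \<and>
    isotopic (R \<union> tangle_edges N \<epsilon> d S) (R \<union> tangle_edges N \<epsilon> d S')"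
  using assms(1,4)
proof (induction ms arbitrary: S)
  case (Cons m ms)
  from Cons.prems(1) obtain S1 where S1: "make_move B m S = Some S1" "make_moves B ms S1 = Some S'"
    by (auto simp: Option.bind_eq_Some_conv)
  with make_move_sound[OF S1(1) assms(2,3) Cons.prems(2)] Cons.IH[OF S1(2)]
  show ?case by (blast intro: isotopic_trans)
qed simp

definition same_set :: "'a list \<Rightarrow> 'a list \<Rightarrow> bool" where
  "same_set xs ys \<longleftrightarrow> list_all (\<lambda>x. x \<in> set ys) xs \<and> list_all (\<lambda>x. x \<in> set xs) ys"

lemma same_set_iff [simp]: "same_set xs ys \<longleftrightarrow> set xs = set ys"
  by (auto simp: same_set_def list_all_iff)

text \<open>Moves put the changed edges in front of the list, so the outcome is compared with the
  target as a set.\<close>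

definition moves_to :: "point list \<Rightarrow> tangle \<Rightarrow> move list \<Rightarrow> tangle \<Rightarrow> bool" where
  "moves_to B S ms S' \<longleftrightarrow>
     (case make_moves B ms S of Some T \<Rightarrow> list_all (\<lambda>x. x \<in> set S') T \<and> list_all (\<lambda>x. x \<in> set T) S' | None \<Rightarrow> False)"

lemma moves_to_sound:
  assumes m: "moves_to B S ms S'" and "\<epsilon> * \<epsilon> = 1"
    and "polygon_points R \<inter> {x. x $ 1 \<ge> N} \<subseteq> emb N \<epsilon> ` set B"
    and "oriented_link (R \<union> tangle_edges N \<epsilon> d S)"
  shows "oriented_link (R \<union> tangle_edges N \<epsilon> d S')"
    "isotopic (R \<union> tangle_edges N \<epsilon> d S) (R \<union> tangle_edges N \<epsilon> d S')"
proof -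
  from m obtain T where T: "make_moves B ms S = Some T" "set T = set S'"
    by (auto simp: moves_to_def list_all_iff split: option.splits)
  have "tangle_edges N \<epsilon> d T = tangle_edges N \<epsilon> d S'" unfolding tangle_edges_def T(2) ..
  with make_moves_sound[OF T(1) assms(2-4)]
  show "oriented_link (R \<union> tangle_edges N \<epsilon> d S')"
    "isotopic (R \<union> tangle_edges N \<epsilon> d S) (R \<union> tangle_edges N \<epsilon> d S')" by auto
qed

section \<open>The local moves\<close>

text \<open>In what follows the Boolean \<open>b\<close> tells whether a twist region lies between the strands 2 and 3
  (\<open>True\<close>) or 3 and 4 (\<open>False\<close>), hence also whether a closure by caps is the one for odd or for
  even \<open>n\<close>. A kink is one crossing followed by the caps of the opposite parity, a clasp consists of
  two opposite crossings, and a turnback is a smoothed crossing, both followed by the caps of parity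
  \<open>b\<close>.\<close>

fun kink :: "bool \<Rightarrow> tangle" where
  "kink True =
     strand 0 [(0, 4, 0), (1, 5, 1), (2, 6, 0), (4, 5, 0), (2, 4, 0), (1, 5, -1), (0, 6, 0)] @
     strand 1 [(0, 2, 0), (2, 2, 0), (6, 5, 0), (2, 8, 0), (0, 8, 0)]"
| "kink False =
     strand 0 [(0, 6, 0), (1, 7, 1), (2, 8, 0), (4, 7, 0), (2, 6, 0), (1, 7, -1), (0, 8, 0)] @
     strand 1 [(0, 2, 0), (2, 2, 0), (4, 3, 0), (2, 4, 0), (0, 4, 0)]"

text \<open>A Reidemeister I move. The inserted vertices are the tips of the caps, one column
  further to the left than before.\<close>

fun kink_moves :: "bool \<Rightarrow> move list" where
  "kink_moves True =
     [Del (2, 6, 0), Del (2, 4, 0), Del (1, 5, 1), Ins (0, 4, 0) (2, 5, 0), Del (4, 5, 0),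
      Del (1, 5, -1), Del (2, 2, 0), Del (2, 8, 0), Ins (0, 2, 0) (4, 5, 0), Del (6, 5, 0)]"
| "kink_moves False =
     [Del (2, 8, 0), Del (2, 6, 0), Del (1, 7, 1), Ins (0, 6, 0) (2, 7, 0), Del (4, 7, 0),
      Del (1, 7, -1), Del (2, 2, 0), Ins (0, 2, 0) (2, 3, 0), Del (4, 3, 0), Del (2, 4, 0)]"

fun kink_end :: "bool \<Rightarrow> tangle" where
  "kink_end True =
     strand 0 [(0, 4, 0), (2, 5, 0), (0, 6, 0)] @
     strand 1 [(0, 2, 0), (4, 5, 0), (0, 8, 0)]"
| "kink_end False =
     strand 0 [(0, 6, 0), (2, 7, 0), (0, 8, 0)] @
     strand 1 [(0, 2, 0), (2, 3, 0), (0, 4, 0)]"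

fun clasp :: "bool \<Rightarrow> tangle" where
  "clasp True =
     strand 0 [(0, 2, 0), (2, 2, 0), (4, 2, 0), (6, 3, 0), (4, 4, 0), (3, 5, 1), (2, 6, 0),
      (1, 5, 1), (0, 4, 0)] @
     strand 1 [(0, 6, 0), (1, 5, -1), (2, 4, 0), (3, 5, -1), (4, 6, 0), (6, 7, 0), (4, 8, 0),
      (2, 8, 0), (0, 8, 0)]"
| "clasp False =
     strand 0 [(0, 6, 0), (1, 7, 1), (2, 8, 0), (3, 7, 1), (4, 6, 0), (6, 5, 0), (4, 4, 0),
      (2, 4, 0), (0, 4, 0)] @
     strand 1 [(0, 2, 0), (2, 2, 0), (4, 2, 0), (8, 5, 0), (4, 8, 0), (3, 7, -1), (2, 6, 0),
      (1, 7, -1), (0, 8, 0)]"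

text \<open>A Reidemeister II move: one strand passes over at both crossings and the other one under
  at both, so the crossing vertices can be deleted; then the caps are drawn back by two
  columns.\<close>

fun clasp_moves :: "bool \<Rightarrow> move list" where
  "clasp_moves True =
     [Del (2, 6, 0), Del (1, 5, 1), Del (2, 4, 0), Del (1, 5, -1), Del (3, 5, -1), Del (3, 5, 1),
      Del (4, 4, 0), Del (2, 2, 0), Ins (6, 3, 0) (2, 3, 0), Del (6, 3, 0), Del (4, 2, 0),
      Del (4, 6, 0), Del (2, 8, 0), Ins (0, 6, 0) (2, 7, 0), Del (6, 7, 0), Del (4, 8, 0)]"
| "clasp_moves False =
     [Del (2, 8, 0), Del (1, 7, 1), Del (2, 6, 0), Del (1, 7, -1), Del (3, 7, -1), Del (3, 7, 1),
      Del (4, 6, 0), Del (2, 4, 0), Ins (0, 6, 0) (2, 5, 0), Del (6, 5, 0), Del (4, 4, 0),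
      Del (4, 8, 0), Del (2, 2, 0), Del (4, 2, 0), Ins (0, 2, 0) (4, 5, 0), Del (8, 5, 0)]"

fun clasp_end :: "bool \<Rightarrow> tangle" where
  "clasp_end True =
     strand 0 [(0, 2, 0), (2, 3, 0), (0, 4, 0)] @
     strand 1 [(0, 6, 0), (2, 7, 0), (0, 8, 0)]"
| "clasp_end False =
     strand 0 [(0, 6, 0), (2, 5, 0), (0, 4, 0)] @
     strand 1 [(0, 2, 0), (4, 5, 0), (0, 8, 0)]"

fun turnback :: "bool \<Rightarrow> tangle" where
  "turnback True =
     strand 0 [(0, 4, 0), (0, 6, 0)] @
     strand 1 [(0, 2, 0), (2, 2, 0), (4, 3, 0), (2, 4, 0), (2, 6, 0), (4, 7, 0), (2, 8, 0),
      (0, 8, 0)]"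
| "turnback False =
     strand 0 [(0, 6, 0), (0, 8, 0)] @
     strand 1 [(0, 2, 0), (2, 2, 0), (6, 5, 0), (2, 8, 0), (2, 6, 0), (4, 5, 0), (2, 4, 0),
      (0, 4, 0)]"

text \<open>A planar isotopy: the left arc of the smoothing is bent into a cap, the right arc merges
  with the old caps into the other cap.\<close>

fun turnback_moves :: "bool \<Rightarrow> move list" where
  "turnback_moves True =
     [Del (2, 4, 0), Del (2, 6, 0), Ins (0, 4, 0) (2, 5, 0), Ins (4, 3, 0) (4, 5, 0),
      Del (4, 3, 0), Del (2, 2, 0), Del (4, 7, 0), Del (2, 8, 0)]"
| "turnback_moves False =
     [Del (2, 6, 0), Del (2, 8, 0), Del (4, 5, 0), Del (2, 4, 0), Del (2, 2, 0),
      Ins (0, 2, 0) (2, 3, 0), Del (6, 5, 0), Ins (0, 6, 0) (2, 7, 0)]"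

fun turnback_end :: "bool \<Rightarrow> tangle" where
  "turnback_end True =
     strand 0 [(0, 4, 0), (2, 5, 0), (0, 6, 0)] @
     strand 1 [(0, 2, 0), (4, 5, 0), (0, 8, 0)]"
| "turnback_end False =
     strand 0 [(0, 6, 0), (2, 7, 0), (0, 8, 0)] @
     strand 1 [(0, 2, 0), (2, 3, 0), (0, 4, 0)]"

definition unknot :: "tangle" where
  "unknot =
     strand 0 [(2, 2, 0), (6, 5, 0), (2, 8, 0), (0, 7, 0), (2, 6, 0), (4, 5, 0), (2, 4, 0),
      (0, 3, 0), (2, 2, 0)]"

definition unknot_moves :: "move list" where
  "unknot_moves =
     [Del (0, 7, 0), Del (2, 6, 0), Del (4, 5, 0), Del (2, 4, 0), Del (0, 3, 0)]"

definition unknot_end :: "tangle" where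
  "unknot_end =
     strand 0 [(2, 2, 0), (6, 5, 0), (2, 8, 0), (2, 2, 0)]"

text \<open>The smoothing of the closed kink: its second component is surrounded by the first one and has to
  leave the plane.\<close>

definition unlink :: "tangle" where
  "unlink =
     strand 0 [(2, 2, 0), (4, 2, 0), (8, 5, 0), (4, 8, 0), (2, 8, 0), (0, 7, 0), (2, 6, 0),
      (2, 4, 0), (0, 3, 0), (2, 2, 0)] @
     strand 1 [(4, 6, 0), (4, 4, 0), (6, 5, 0), (4, 6, 0)]"

text \<open>The vertices of positive height lift the inner component above the plane. The outer
  component then retracts to the lower pair of caps, and the inner one descends onto the place of
  the upper pair.\<close>

definition unlink_moves :: "move list" where
  "unlink_moves =
     [Ins (4, 4, 0) (5, 6, 2), Del (6, 5, 0), Ins (5, 6, 2) (4, 8, 1), Del (4, 6, 0),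
      Ins (4, 8, 1) (0, 7, 1), Del (4, 4, 0), Del (4, 8, 0), Del (2, 8, 0), Del (0, 7, 0),
      Del (2, 6, 0), Del (4, 2, 0), Ins (2, 2, 0) (4, 3, 0), Del (8, 5, 0),
      Ins (0, 7, 1) (2, 6, 0), Ins (2, 6, 0) (4, 7, 0), Del (5, 6, 2), Ins (4, 7, 0) (2, 8, 0),
      Ins (2, 8, 0) (0, 7, 0), Del (4, 8, 1), Del (0, 7, 1)]"

definition unlink_end :: "tangle" where
  "unlink_end =
     strand 0 [(2, 2, 0), (4, 3, 0), (2, 4, 0), (0, 3, 0), (2, 2, 0)] @
     strand 1 [(2, 6, 0), (4, 7, 0), (2, 8, 0), (0, 7, 0), (2, 6, 0)]"


definition flat_points :: "int \<Rightarrow> int list \<Rightarrow> point list" where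
  "flat_points x ys = map (\<lambda>y. (x, 2 * y, 0)) ys"

text \<open>The diagram on the left enters through its four end points only; neither the column nor
  the sign of the crossing occurs, so a single evaluation serves all of them.\<close>

lemma kink_moves_to: "\<forall>b. moves_to (flat_points 0 [1..4]) (kink b) (kink_moves b) (kink_end b)"
  by code_simp

lemma clasp_moves_to: "\<forall>b. moves_to (flat_points 0 [1..4]) (clasp b) (clasp_moves b) (clasp_end b)"
  by code_simp

lemma turnback_moves_to:
  "\<forall>b. moves_to (flat_points 0 [1..4]) (turnback b) (turnback_moves b) (turnback_end b)"
  by code_simp

text \<open>The tangle is the whole link here, so the list of fixed end points is empty.\<close>

lemma unknot_moves_to: "moves_to [] unknot unknot_moves unknot_end"
  by code_simp

lemma unlink_moves_to: "moves_to [] unlink unlink_moves unlink_end"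
  by code_simp

section \<open>Oriented pieces of the diagram and their finite checks\<close>

type_synonym edge_list = "(point \<times> point) list"

text \<open>The flag tells whether the two strands run upwards; the crossing is positive in the embedding
  with \<open>\<epsilon> = 1\<close> and negative in the one with \<open>\<epsilon> = -1\<close>.\<close>

fun crossing_list :: "bool \<Rightarrow> int \<Rightarrow> edge_list" where
  "crossing_list True r =
     [((0, 2 * r, 0), (1, 2 * r + 1, 1)), ((1, 2 * r + 1, 1), (2, 2 * r + 2, 0)),
      ((2, 2 * r, 0), (1, 2 * r + 1, -1)), ((1, 2 * r + 1, -1), (0, 2 * r + 2, 0))]"
| "crossing_list False r =
     [((2, 2 * r + 2, 0), (1, 2 * r + 1, 1)), ((1, 2 * r + 1, 1), (0, 2 * r, 0)),
      ((0, 2 * r + 2, 0), (1, 2 * r + 1, -1)), ((1, 2 * r + 1, -1), (2, 2 * r, 0))]"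

fun smoothing_list :: "bool \<Rightarrow> int \<Rightarrow> edge_list" where
  "smoothing_list True r =
     [((0, 2 * r, 0), (0, 2 * r + 2, 0)), ((2, 2 * r, 0), (2, 2 * r + 2, 0))]"
| "smoothing_list False r =
     [((2, 2 * r + 2, 0), (2, 2 * r, 0)), ((0, 2 * r + 2, 0), (0, 2 * r, 0))]"

fun strand_list :: "bool \<Rightarrow> edge_list" where
  "strand_list True = [((0, 2, 0), (2, 2, 0)), ((2, 8, 0), (0, 8, 0))]"
| "strand_list False = [((0, 2, 0), (2, 2, 0)), ((2, 4, 0), (0, 4, 0))]"

definition reverse_if :: "bool \<Rightarrow> edge_list \<Rightarrow> edge_list" where
  "reverse_if f es = (if f then map prod.swap es else es)"

text \<open>The flag \<open>f\<close> matters after a region on the other pair of strands: one cap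
  joins just the two strands of that region, and it is reversed if the number of crossings is
  odd.\<close>

fun cap_list :: "bool \<Rightarrow> bool \<Rightarrow> int \<Rightarrow> edge_list" where
  "cap_list True f x =
     [((x, 2, 0), (x + 2, 3, 0)), ((x + 2, 3, 0), (x, 4, 0))] @
     reverse_if f [((x, 6, 0), (x + 2, 7, 0)), ((x + 2, 7, 0), (x, 8, 0))]"
| "cap_list False f x =
     [((x, 2, 0), (x + 4, 5, 0)), ((x + 4, 5, 0), (x, 8, 0))] @
     reverse_if f [((x, 6, 0), (x + 2, 5, 0)), ((x + 2, 5, 0), (x, 4, 0))]"

definition left_list :: edge_list where
  "left_list = [((2, 4, 0), (0, 3, 0)), ((0, 3, 0), (2, 2, 0)), ((2, 8, 0), (0, 7, 0)), ((0, 7, 0), (2, 6, 0))]"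

definition pos :: "bool \<Rightarrow> int" where
  "pos b = (if b then 2 else 3)"

text \<open>The positions at which the strand runs to the right (to the left); \<open>f\<close> is the parity of the
  number of crossings of the current twist region, each of which exchanges the directions at the
  positions \<open>pos b\<close> and \<open>pos b + 1\<close>.\<close>

definition rightward :: "bool \<Rightarrow> bool \<Rightarrow> int list" where
  "rightward b f = filter (\<lambda>y. odd y \<noteq> (f \<and> (y = pos b \<or> y = pos b + 1))) [1..4]"

definition leftward :: "bool \<Rightarrow> bool \<Rightarrow> int list" where
  "leftward b f = filter (\<lambda>y. odd y = (f \<and> (y = pos b \<or> y = pos b + 1))) [1..4]"

definition sources :: "edge_list \<Rightarrow> point list" where
  "sources es = filter (\<lambda>p. p \<notin> set (map snd es)) (map fst es)"

definition sinks :: "edge_list \<Rightarrow> point list" where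
  "sinks es = filter (\<lambda>p. p \<notin> set (map fst es)) (map snd es)"

fun pairwise_separated :: "edge_list \<Rightarrow> bool" where
  "pairwise_separated [] = True"
| "pairwise_separated (e # es) =
     (list_all (\<lambda>f. separated [fst e, snd e] [fst f, snd f]) es \<and> pairwise_separated es)"

definition half_list :: "edge_list \<Rightarrow> bool" where
  "half_list es \<longleftrightarrow> list_all (\<lambda>e. fst e \<noteq> snd e) es \<and> distinct (map fst es) \<and> distinct (map snd es) \<and>
     pairwise_separated es"

text \<open>Strands enter from the left at the heights \<open>R\<close> and leave to the left at the
  heights \<open>L\<close>; \<open>A\<close> and \<open>B\<close> are the free ends that remain
  further to the right.\<close>

definition attachable :: "int list \<Rightarrow> int list \<Rightarrow> point list \<Rightarrow> point list \<Rightarrow> edge_list \<Rightarrow> bool" where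
  "attachable R L A B es \<longleftrightarrow> half_list es \<and> list_all (\<lambda>e. fst (fst e) \<ge> 0 \<and> fst (snd e) \<ge> 0) es \<and>
     same_set (sources es) (flat_points 0 R @ A) \<and> same_set (sinks es) (flat_points 0 L @ B) \<and>
     list_all (\<lambda>p. fst p > 0) (A @ B)"

text \<open>An edge with both ends on the right boundary would lie inside it; so at most one end is
  allowed there, and it has to be one of the four standard points.\<close>

definition right_end :: "edge_list \<Rightarrow> bool" where
  "right_end es \<longleftrightarrow> list_all (\<lambda>(p, q). fst p \<le> 2 \<and> fst q \<le> 2 \<and> (fst p < 2 \<or> fst q < 2) \<and>
     (fst p = 2 \<longrightarrow> p \<in> set (flat_points 2 [1..4])) \<and> (fst q = 2 \<longrightarrow> q \<in> set (flat_points 2 [1..4]))) es"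

definition octahedron :: "int \<Rightarrow> point list" where
  "octahedron r = [(0, 2 * r, 0), (2, 2 * r, 0), (0, 2 * r + 2, 0), (2, 2 * r + 2, 0),
     (1, 2 * r + 1, 1), (1, 2 * r + 1, -1)]"

text \<open>First coordinate 1 would admit the two apexes, which are not corners of the crossing.
  The second conjunct takes care of the diagram on the left, which can touch the octahedron only in
  its own end points.\<close>

definition avoids_octahedron :: "int \<Rightarrow> edge_list \<Rightarrow> bool" where
  "avoids_octahedron r es \<longleftrightarrow> list_all (\<lambda>(p, q). separated (octahedron r) [p, q] \<and>
       fst p \<noteq> 1 \<and> fst q \<noteq> 1) es \<and>
     list_all (\<lambda>y. y = r \<or> y = r + 1 \<or> separated (octahedron r) [(0, 2 * y, 0)]) [1..4]"

text \<open>The lower position \<open>pos b\<close> is even for \<open>b\<close> and odd otherwise,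
  so both strands run upwards exactly if \<open>b = f\<close>.\<close>

lemma attachable_column:
  "\<forall>b f. let es = crossing_list (b = f) (pos b) @ strand_list b in
     attachable (rightward b f) (leftward b f) (flat_points 2 (leftward b (\<not> f)))
       (flat_points 2 (rightward b (\<not> f))) es \<and> right_end es"
  by code_simp

lemma attachable_caps:
  "\<forall>b f. attachable (rightward b f) (leftward b f) [] [] (cap_list (\<not> b) f 0)"
  by code_simp

text \<open>The crossing to be changed is the last of an even number: an odd number precedes it,
  whence \<open>True\<close>, and the caps behind it see alternating directions, whence
  \<open>False\<close>.\<close>

lemma attachable_smoothing:
  "\<forall>b. attachable (rightward b True) (leftward b True) [] []
     (smoothing_list b (pos b) @ strand_list b @ cap_list b False 2)"
  by code_simp

lemma attachable_crossing:
  "\<forall>b. attachable (rightward b True) (leftward b True) [] []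
     (crossing_list b (pos b) @ strand_list b @ cap_list b False 2)"
  by code_simp

lemma avoids_octahedron_caps:
  "\<forall>b. avoids_octahedron (pos b) (strand_list b @ cap_list b False 2)"
  by code_simp

lemma attachable_kink:
  "attachable (rightward True False) (leftward True False) [] []
     (crossing_list False 2 @ strand_list True @ cap_list False True 2)"
  "attachable (rightward True False) (leftward True False) [] []
     (smoothing_list False 2 @ strand_list True @ cap_list False True 2)"
  "avoids_octahedron 2 (strand_list True @ cap_list False True 2)"
  by code_simp+

text \<open>The factor on the height puts two consecutive columns with crossings of opposite signs
  into one embedding, as the clasp requires.\<close>

definition shift :: "int \<Rightarrow> point \<times> point \<Rightarrow> point \<times> point" where
  "shift s = (\<lambda>((x, y, z), (x', y', z')). ((x + 2, y, s * z), (x' + 2, y', s * z')))"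

definition orient_first :: "bool \<Rightarrow> nat \<Rightarrow> bool" where
  "orient_first g i = (i = 0 \<longrightarrow> g)"

lemma kink_orient:
  "\<forall>b f. same_set (map (orient (orient_first (b = f))) (kink b))
     (crossing_list (b = f) (pos b) @ strand_list b @ cap_list (\<not> b) (\<not> f) 2)"
  "\<forall>b f. same_set (map (orient (orient_first (b = f))) (kink_end b)) (cap_list (\<not> b) f 0)"
  by code_simp+

lemma turnback_orient:
  "\<forall>b. same_set (map (orient (orient_first b)) (turnback b))
     (smoothing_list b (pos b) @ strand_list b @ cap_list b False 2)"
  "\<forall>b. same_set (map (orient (orient_first b)) (turnback_end b)) (cap_list (\<not> b) True 0)"
  by code_simp+

lemma clasp_orient:
  "\<forall>b. same_set (map (orient (orient_first True)) (clasp b))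
     (crossing_list (\<not> b) (pos b) @ strand_list b @
      map (shift (-1)) (crossing_list b (pos b) @ strand_list b) @ cap_list b False 4)"
  "\<forall>b. same_set (map (orient (orient_first True)) (clasp_end b)) (cap_list b False 0)"
  by code_simp+

lemma unknot_orient:
  "same_set (map (orient (orient_first True)) unknot) (left_list @ map (shift 1) (cap_list False False 0))"
  by code_simp

lemma unlink_orient:
  "same_set (map (orient (orient_first True)) unlink)
     (left_list @ map (shift 1) (smoothing_list False 2 @ strand_list True @ cap_list False True 2))"
  "same_set (map (orient (orient_first True)) unlink_end)
     (left_list @ map (shift 1) (cap_list True False 0))"
  by code_simp+

lemma left_list_check:
  "half_list left_list" "right_end left_list" "same_set (sources left_list) (flat_points 2 (leftward True False))"
  "same_set (sinks left_list) (flat_points 2 (rightward True False))"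
  by code_simp+

section \<open>Attaching tangles on the right\<close>

definition list_edges :: "real \<Rightarrow> real \<Rightarrow> edge_list \<Rightarrow> edges" where
  "list_edges N \<epsilon> es = emb_edge N \<epsilon> ` set es"

lemma list_edges_simps [simp]:
  "list_edges N \<epsilon> [] = {}"
  "list_edges N \<epsilon> (e # es) = insert (emb_edge N \<epsilon> e) (list_edges N \<epsilon> es)"
  "list_edges N \<epsilon> (es @ fs) = list_edges N \<epsilon> es \<union> list_edges N \<epsilon> fs"
  by (auto simp: list_edges_def)

lemma tangle_edges_eq: "tangle_edges N \<epsilon> d S = list_edges N \<epsilon> (map (orient d) S)"
  by (auto simp: tangle_edges_def list_edges_def)

lemma list_edges_cong: "same_set es fs \<Longrightarrow> list_edges N \<epsilon> es = list_edges N \<epsilon> fs"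
  by (simp add: list_edges_def)

lemma emb_flat_points: "emb N \<epsilon> ` set (flat_points x ys) = emb N 1 ` set (flat_points x ys)"
  by (force simp: flat_points_def emb_def)

lemma emb_flat_points_shift:
  "emb (N + 1) \<epsilon> ` set (flat_points 0 ys) = emb N \<epsilon>' ` set (flat_points 2 ys)"
  by (force simp: flat_points_def emb_def)

definition flat :: "edge_list \<Rightarrow> bool" where
  "flat es \<longleftrightarrow> list_all (\<lambda>e. snd (snd (fst e)) = 0 \<and> snd (snd (snd e)) = 0) es"

lemma list_edges_flat: "flat es \<Longrightarrow> list_edges N \<epsilon> es = list_edges N 1 es"
  unfolding list_edges_def by (rule image_cong) (auto simp: flat_def list_all_iff emb_def)

lemma flat_strand_list [simp]: "flat (strand_list b)"
  by (cases b) (auto simp: flat_def)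

lemma flat_cap_list [simp]: "flat (cap_list b f x)"
  by (cases b) (auto simp: flat_def reverse_if_def)

lemma flat_append [simp]: "flat (es @ fs) \<longleftrightarrow> flat es \<and> flat fs"
  by (auto simp: flat_def)

lemma list_edges_shift:
  "list_edges N \<epsilon> (map (shift s) es) = list_edges (N + 1) (of_int s * \<epsilon>) es"
proof -
  have "emb_edge N \<epsilon> (shift s e) = emb_edge (N + 1) (of_int s * \<epsilon>) e" for e
    by (cases e) (auto simp: shift_def emb_def add_divide_distrib ac_simps split: prod.splits)
  then show ?thesis by (simp add: list_edges_def image_image)
qed

lemma cap_list_shift: "cap_list b f (x + 2) = map (shift 1) (cap_list b f x)"
  by (cases b) (auto simp: shift_def reverse_if_def)

lemma list_edges_cap_shift:
  "list_edges N \<epsilon> (cap_list b f 2) = list_edges (N + 1) 1 (cap_list b f 0)"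
  using cap_list_shift[of b f 0] list_edges_shift[of N \<epsilon> 1 "cap_list b f 0"]
    list_edges_flat[of "cap_list b f 0" "N + 1" \<epsilon>] by simp

lemma polygon_points_list_edges:
  "polygon_points (list_edges N \<epsilon> es) = (\<Union>(p, q)\<in>set es. convex hull {emb N \<epsilon> p, emb N \<epsilon> q})"
  by (force simp: polygon_points_def list_edges_def segment_convex_hull)

lemma mem_polygon_points_list_edges:
  "x \<in> polygon_points (list_edges N \<epsilon> es) \<longleftrightarrow>
    (\<exists>p q. (p, q) \<in> set es \<and> x \<in> convex hull {emb N \<epsilon> p, emb N \<epsilon> q})"
  unfolding polygon_points_list_edges UN_iff case_prod_beta by (metis fst_conv snd_conv prod.collapse)

lemma pairwise_separatedD:
  "pairwise_separated es \<Longrightarrow> e \<in> set es \<Longrightarrow> f \<in> set es \<Longrightarrow> e \<noteq> f \<Longrightarrow>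
    separated [fst e, snd e] [fst f, snd f] \<or> separated [fst f, snd f] [fst e, snd e]"
  by (induction es) (auto simp: list_all_iff)

lemma half_list_imp:
  assumes h: "half_list es" and e: "\<epsilon> * \<epsilon> = 1"
  shows "half_link (list_edges N \<epsilon> es)"
proof (rule half_linkI)
  have e0: "\<epsilon> \<noteq> 0" using e by auto
  note inj = emb_eq_iff[OF e0]
  have mem: "\<exists>p q. (p, q) \<in> set es \<and> a = emb N \<epsilon> p \<and> b = emb N \<epsilon> q"
    if "(a, b) \<in> list_edges N \<epsilon> es" for a b
    using that unfolding list_edges_def image_iff by (metis emb_edge_simps prod.collapse prod.inject)
  show "finite (list_edges N \<epsilon> es)" by (simp add: list_edges_def)
  show "a \<noteq> b" if "(a, b) \<in> list_edges N \<epsilon> es" for a b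
    using mem[OF that] h inj by (fastforce simp: half_list_def list_all_iff)
  have d: "distinct (map fst es)" "distinct (map snd es)" using h by (auto simp: half_list_def)
  show "b = c" if "(a, b) \<in> list_edges N \<epsilon> es" "(a, c) \<in> list_edges N \<epsilon> es" for a b c
    using mem[OF that(1)] mem[OF that(2)] eq_key_imp_eq_value[OF d(1)] inj by auto
  show "b = c" if bc: "(b, a) \<in> list_edges N \<epsilon> es" "(c, a) \<in> list_edges N \<epsilon> es" for a b c
  proof -
    obtain p q p' q' where *: "(p, q) \<in> set es" "(p', q') \<in> set es" "b = emb N \<epsilon> p" "a = emb N \<epsilon> q"
      "c = emb N \<epsilon> p'" "a = emb N \<epsilon> q'" using mem[OF bc(1)] mem[OF bc(2)] by auto
    then have "q = q'" using inj by auto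
    then have "(p, q) = (p', q')"
      using d(2) * inj_onD[of snd "set es" "(p, q)" "(p', q')"] by (simp add: distinct_map)
    then show ?thesis using * by simp
  qed
  show "x \<in> {a, b} \<and> x \<in> {c, d}"
    if ab: "(a, b) \<in> list_edges N \<epsilon> es" "(c, d) \<in> list_edges N \<epsilon> es" and ne: "(a, b) \<noteq> (c, d)"
      and x: "x \<in> closed_segment a b" "x \<in> closed_segment c d" for a b c d x
  proof -
    obtain p q p' q' where *: "(p, q) \<in> set es" "(p', q') \<in> set es" "a = emb N \<epsilon> p" "b = emb N \<epsilon> q"
      "c = emb N \<epsilon> p'" "d = emb N \<epsilon> q'" using mem[OF ab(1)] mem[OF ab(2)] by auto
    then have "(p, q) \<noteq> (p', q')" using ne by auto
    then have "separated [p, q] [p', q'] \<or> separated [p', q'] [p, q]"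
      using pairwise_separatedD[of es "(p, q)" "(p', q')"] h * by (auto simp: half_list_def)
    then have "convex hull (emb N \<epsilon> ` set [p, q]) \<inter> convex hull (emb N \<epsilon> ` set [p', q'])
        \<subseteq> emb N \<epsilon> ` (set [p, q] \<inter> set [p', q'])"
      using separated_imp[OF _ e, of "[p, q]" "[p', q']" N] separated_imp[OF _ e, of "[p', q']" "[p, q]" N]
      by (metis Int_commute)
    then have "x \<in> emb N \<epsilon> ` (set [p, q] \<inter> set [p', q'])"
      using x * by (auto simp: segment_convex_hull)
    then show ?thesis using * by auto
  qed
qed

lemma Domain_list_edges: "Domain (list_edges N \<epsilon> es) = emb N \<epsilon> ` set (map fst es)"
  by (force simp: list_edges_def Domain_fst image_image)

lemma Range_list_edges: "Range (list_edges N \<epsilon> es) = emb N \<epsilon> ` set (map snd es)"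
  by (force simp: list_edges_def Range_snd image_image)

lemma src_list_edges: "\<epsilon> \<noteq> 0 \<Longrightarrow> src (list_edges N \<epsilon> es) = emb N \<epsilon> ` set (sources es)"
  unfolding src_def sources_def Domain_list_edges Range_list_edges set_filter
  by (subst image_set_diff[OF inj_emb, symmetric]) (auto intro!: image_cong)

lemma snk_list_edges: "\<epsilon> \<noteq> 0 \<Longrightarrow> snk (list_edges N \<epsilon> es) = emb N \<epsilon> ` set (sinks es)"
  unfolding snk_def sinks_def Domain_list_edges Range_list_edges set_filter
  by (subst image_set_diff[OF inj_emb, symmetric]) (auto intro!: image_cong)

section \<open>Partial diagrams ending in a vertical plane\<close>

definition ends_at :: "real \<Rightarrow> edges \<Rightarrow> bool" where
  "ends_at N E \<longleftrightarrow> polygon_points E \<inter> {x. x $ 1 \<ge> N} \<subseteq> emb N 1 ` set (flat_points 0 [1..4])"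

text \<open>A strand directed to the left begins at its right end, so the sources are the leftward
  positions.\<close>

definition braid_like :: "real \<Rightarrow> bool \<Rightarrow> bool \<Rightarrow> edges \<Rightarrow> bool" where
  "braid_like N b f E \<longleftrightarrow> half_link E \<and> ends_at N E \<and>
     src E = emb N 1 ` set (flat_points 0 (leftward b f)) \<and>
     snk E = emb N 1 ` set (flat_points 0 (rightward b f))"

lemma polygon_points_ge:
  assumes "\<And>p q. (p, q) \<in> set es \<Longrightarrow> fst p \<ge> 0 \<and> fst q \<ge> 0"
  shows "polygon_points (list_edges N \<epsilon> es) \<subseteq> {x. x $ 1 \<ge> N}"
proof -
  have "convex hull {emb N \<epsilon> p, emb N \<epsilon> q} \<subseteq> {x. x $ 1 \<ge> N}" if "(p, q) \<in> set es" for p q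
  proof (rule hull_minimal)
    show "{emb N \<epsilon> p, emb N \<epsilon> q} \<subseteq> {x. x $ 1 \<ge> N}" using assms[OF that] by (auto simp: emb_nth1)
    show "convex {x::real^3. x $ 1 \<ge> N}"
      using convex_halfspace_ge[of N "axis 1 1 :: real^3"] by (simp add: inner_axis')
  qed
  then show ?thesis using mem_polygon_points_list_edges by blast
qed

lemma leftward_rightward: "set (leftward b f) \<union> set (rightward b f) = set [1..4]"
  by (auto simp: leftward_def rightward_def)

text \<open>The old piece has only its four end points in the half space that contains the new
  piece, so the two meet in joints only. The new free ends lie strictly further right and therefore
  stay free.\<close>

lemma attach:
  assumes E: "braid_like N b f E" and a: "attachable (rightward b f) (leftward b f) A B es"
    and e: "\<epsilon> * \<epsilon> = 1"
  shows "half_link (E \<union> list_edges N \<epsilon> es)"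
    and "src (E \<union> list_edges N \<epsilon> es) = emb N \<epsilon> ` set A"
    and "snk (E \<union> list_edges N \<epsilon> es) = emb N \<epsilon> ` set B"
proof -
  define F where "F = list_edges N \<epsilon> es"
  have e0: "\<epsilon> \<noteq> 0" using e by auto
  define VL where "VL = emb N 1 ` set (flat_points 0 (leftward b f))"
  define VR where "VR = emb N 1 ` set (flat_points 0 (rightward b f))"
  have E1: "half_link E" "src E = VL" "snk E = VR"
    using E unfolding braid_like_def VL_def VR_def by blast+
  have "emb N 1 ` set (flat_points 0 [1..4]) = VL \<union> VR"
    unfolding VL_def VR_def flat_points_def set_map leftward_rightward[of b f, symmetric] image_Un ..
  then have E2: "polygon_points E \<inter> {x. x $ 1 \<ge> N} \<subseteq> VL \<union> VR"
    using E unfolding braid_like_def ends_at_def by blast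
  have "half_list es" using a unfolding attachable_def by blast
  then have F1: "half_link F" unfolding F_def by (rule half_list_imp[OF _ e])
  have "set (sources es) = set (flat_points 0 (rightward b f)) \<union> set A"
    "set (sinks es) = set (flat_points 0 (leftward b f)) \<union> set B"
    using a unfolding attachable_def same_set_iff set_append by blast+
  then have F2: "src F = VR \<union> emb N \<epsilon> ` set A" "snk F = VL \<union> emb N \<epsilon> ` set B"
    unfolding F_def src_list_edges[OF e0] snk_list_edges[OF e0] VL_def VR_def
    by (simp_all only: image_Un emb_flat_points[of N \<epsilon>])
  have F3: "polygon_points F \<subseteq> {x. x $ 1 \<ge> N}"
    unfolding F_def
  proof (rule polygon_points_ge)
    fix p q assume "(p, q) \<in> set es"
    moreover have "\<forall>e\<in>set es. fst (fst e) \<ge> 0 \<and> fst (snd e) \<ge> 0"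
      using a unfolding attachable_def list_all_iff by blast
    ultimately show "fst p \<ge> 0 \<and> fst q \<ge> 0" by (metis fst_conv snd_conv)
  qed
  have AB: "x \<notin> polygon_points E" if x: "x \<in> emb N \<epsilon> ` (set A \<union> set B)" for x
  proof
    assume "x \<in> polygon_points E"
    moreover have "\<forall>p\<in>set (A @ B). fst p > 0" using a unfolding attachable_def list_all_iff by blast
    then have "x $ 1 > N" using x by (force simp: emb_nth1)
    ultimately have "x \<in> VL \<union> VR" using E2 by auto
    then have "x $ 1 = N" by (auto simp: VL_def VR_def flat_points_def emb_nth1)
    with \<open>x $ 1 > N\<close> show False by simp
  qed
  have EF: "polygon_points E \<inter> polygon_points F \<subseteq> VL \<union> VR" using E2 F3 by auto
  show "half_link (E \<union> list_edges N \<epsilon> es)"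
    unfolding F_def[symmetric] by (rule half_link_glue[OF E1(1) F1]) (use EF E1 F2 in auto)
  have pE: "Domain E \<subseteq> polygon_points E" "Range E \<subseteq> polygon_points E"
    using polygon_points_Domain polygon_points_Range by blast+
  have pF: "Domain F \<subseteq> polygon_points F" "Range F \<subseteq> polygon_points F"
    using polygon_points_Domain polygon_points_Range by blast+
  have VLd: "VL \<subseteq> Range F - Domain F" "VL \<subseteq> Domain E - Range E"
     "VR \<subseteq> Domain F - Range F" "VR \<subseteq> Range E - Domain E"
    using E1 F2 unfolding src_def snk_def by auto
  have "src (E \<union> F) = emb N \<epsilon> ` set A"
  proof (intro set_eqI iffI)
    fix x assume x: "x \<in> src (E \<union> F)"
    then have "x \<in> src E \<or> x \<in> src F" unfolding src_def by auto
    then show "x \<in> emb N \<epsilon> ` set A" using x VLd E1 F2 unfolding src_def by auto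
  next
    fix x assume x: "x \<in> emb N \<epsilon> ` set A"
    then have "x \<in> src F" using F2 by auto
    moreover have "x \<notin> Range E" using AB[of x] x pE by auto
    ultimately show "x \<in> src (E \<union> F)" unfolding src_def by auto
  qed
  then show "src (E \<union> list_edges N \<epsilon> es) = emb N \<epsilon> ` set A" unfolding F_def .
  have "snk (E \<union> F) = emb N \<epsilon> ` set B"
  proof (intro set_eqI iffI)
    fix x assume x: "x \<in> snk (E \<union> F)"
    then have "x \<in> snk E \<or> x \<in> snk F" unfolding snk_def by auto
    then show "x \<in> emb N \<epsilon> ` set B" using x VLd E1 F2 unfolding snk_def by auto
  next
    fix x assume x: "x \<in> emb N \<epsilon> ` set B"
    then have "x \<in> snk F" using F2 by auto
    moreover have "x \<notin> Domain E" using AB[of x] x pE by auto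
    ultimately show "x \<in> snk (E \<union> F)" unfolding snk_def by auto
  qed
  then show "snk (E \<union> list_edges N \<epsilon> es) = emb N \<epsilon> ` set B" unfolding F_def .
qed

lemma oriented_link_attach:
  assumes "braid_like N b f E" "attachable (rightward b f) (leftward b f) [] [] es"
    "\<epsilon> * \<epsilon> = 1" "es \<noteq> []"
  shows "oriented_link (E \<union> list_edges N \<epsilon> es)"
  using attach[OF assms(1-3)] assms(4) unfolding oriented_link_iff src_def snk_def
  by (auto simp: list_edges_def)

text \<open>The first coordinate is affine along the segment, and strictly below \<open>M\<close> at
  all interior points as soon as one end is.\<close>

lemma segment_max_endpoint:
  fixes x y z :: "real^3"
  assumes "z \<in> convex hull {x, y}" "z $ 1 \<ge> M" "x $ 1 \<le> M" "y $ 1 \<le> M" "x $ 1 < M \<or> y $ 1 < M"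
  shows "z = x \<and> x $ 1 = M \<or> z = y \<and> y $ 1 = M"
proof -
  obtain u where u: "0 \<le> u" "u \<le> 1" "z = (1 - u) *\<^sub>R x + u *\<^sub>R y"
    using assms(1) by (auto simp: segment_convex_hull[symmetric] in_segment)
  then have z1: "z $ 1 = (1 - u) * x $ 1 + u * y $ 1" by simp
  consider "u = 0" | "u = 1" | "0 < u" "u < 1" using u by linarith
  then show ?thesis
  proof cases
    case 3
    have "(1 - u) * x $ 1 + u * y $ 1 < (1 - u) * M + u * M"
      using assms(5)
    proof
      assume "x $ 1 < M"
      with 3 assms(4) show ?thesis by (intro add_less_le_mono mult_strict_left_mono mult_left_mono) auto
    next
      assume "y $ 1 < M"
      with 3 assms(3) show ?thesis by (intro add_le_less_mono mult_strict_left_mono mult_left_mono) auto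
    qed
    then show ?thesis using z1 assms(2) by (simp add: algebra_simps)
  qed (use u assms in auto)
qed

lemma ends_at_right_end:
  assumes "right_end es"
  shows "ends_at (N + 1) (list_edges N \<epsilon> es)"
  unfolding ends_at_def
proof
  fix x assume x: "x \<in> polygon_points (list_edges N \<epsilon> es) \<inter> {x. x $ 1 \<ge> N + 1}"
  then obtain p q where pq: "(p, q) \<in> set es" "x \<in> convex hull {emb N \<epsilon> p, emb N \<epsilon> q}"
    unfolding Int_iff mem_polygon_points_list_edges by blast
  have *: "fst p \<le> 2" "fst q \<le> 2" "fst p < 2 \<or> fst q < 2"
     "fst p = 2 \<Longrightarrow> p \<in> set (flat_points 2 [1..4])" "fst q = 2 \<Longrightarrow> q \<in> set (flat_points 2 [1..4])"
    using assms pq(1) unfolding right_end_def list_all_iff by auto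
  have "x = emb N \<epsilon> p \<and> emb N \<epsilon> p $ 1 = N + 1 \<or> x = emb N \<epsilon> q \<and> emb N \<epsilon> q $ 1 = N + 1"
    using x * by (intro segment_max_endpoint[OF pq(2)]) (auto simp: emb_nth1)
  then have "x \<in> emb N \<epsilon> ` set (flat_points 2 [1..4])"
    using * by (auto simp: emb_nth1)
  then show "x \<in> emb (N + 1) 1 ` set (flat_points 0 [1..4])"
    unfolding emb_flat_points_shift[of N 1 _ \<epsilon>] .
qed

lemma ends_at_Un:
  assumes E: "ends_at N E" and F: "ends_at (N + 1) F"
  shows "ends_at (N + 1) (E \<union> F)"
proof -
  have "\<not> x $ 1 \<ge> N + 1" if "x \<in> polygon_points E" for x
  proof
    assume "x $ 1 \<ge> N + 1"
    then have "x \<in> emb N 1 ` set (flat_points 0 [1..4])" using E that unfolding ends_at_def by auto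
    then have "x $ 1 = N" by (auto simp: flat_points_def emb_nth1)
    with \<open>x $ 1 \<ge> N + 1\<close> show False by simp
  qed
  then show ?thesis using F unfolding ends_at_def by auto
qed

abbreviation column_list :: "bool \<Rightarrow> bool \<Rightarrow> edge_list" where
  "column_list b f \<equiv> crossing_list (b = f) (pos b) @ strand_list b"

lemma right_end_column: "right_end (column_list b f)"
  and attachable_column': "attachable (rightward b f) (leftward b f) (flat_points 2 (leftward b (\<not> f)))
       (flat_points 2 (rightward b (\<not> f))) (column_list b f)"
  using attachable_column unfolding Let_def by blast+

lemma braid_like_column:
  assumes E: "braid_like N b f E" and e: "\<epsilon> * \<epsilon> = 1"
  shows "braid_like (N + 1) b (\<not> f) (E \<union> list_edges N \<epsilon> (column_list b f))"
  using attach[OF E attachable_column' e] E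
    ends_at_Un[OF _ ends_at_right_end[OF right_end_column], of N E \<epsilon> b f]
  unfolding braid_like_def emb_flat_points_shift[of N 1 _ \<epsilon>] by blast

lemma leftward_False: "leftward b False = leftward True False"
  and rightward_False: "rightward b False = rightward True False"
  by (simp_all add: leftward_def rightward_def)

text \<open>After an even number of crossings the directions alternate, whichever pair of strands
  was twisted. This is where the evenness of the terms lets the next region use the other
  pair.\<close>

lemma braid_like_False: "braid_like N b False = braid_like N b' False"
  unfolding braid_like_def leftward_False[of b] rightward_False[of b]
    leftward_False[of b'] rightward_False[of b'] ..

section \<open>Braids closed by caps\<close>

lemma vec3_arith:
  "(vector [a, b, c] :: real^3) + vector [a', b', c'] = vector [a + a', b + b', c + c']"
  "(vector [a, b, c] :: real^3) - vector [a', b', c'] = vector [a - a', b - b', c - c']"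
  by (simp_all add: vec_eq_iff forall_3)

lemma vec3_eq_iff:
  "(vector [a, b, c] :: real^3) = vector [a', b', c'] \<longleftrightarrow> a = a' \<and> b = b' \<and> c = c'"
  by (auto simp: vec_eq_iff forall_3)

section \<open>Skein triples at the last crossing\<close>

context
  fixes N :: real and r :: int and p u v w :: "real^3" and up :: bool and d :: real
  assumes puvw: "p = vector [N + 1/2, of_int r + 1/2, 0]" "u = vector [d, 0, 0]" "v = vector [0, d, 0]"
    "w = vector [0, 0, 1]" and d: "d = (if up then 1/2 else -1/2)"
begin

text \<open>A downward pair of strands is the upward picture after a half turn, that is with
  \<open>d = -1/2\<close>; the reflection \<open>\<epsilon> = -1\<close> exchanges the two
  apexes.\<close>

lemma corners:
  "p - u - v = emb N \<epsilon> (if up then (0, 2 * r, 0) else (2, 2 * r + 2, 0))"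
  "p + u - v = emb N \<epsilon> (if up then (2, 2 * r, 0) else (0, 2 * r + 2, 0))"
  "p - u + v = emb N \<epsilon> (if up then (0, 2 * r + 2, 0) else (2, 2 * r, 0))"
  "p + u + v = emb N \<epsilon> (if up then (2, 2 * r + 2, 0) else (0, 2 * r, 0))"
  "p + w = emb N 1 (1, 2 * r + 1, 1)" "p - w = emb N 1 (1, 2 * r + 1, -1)"
  "p + w = emb N (-1) (1, 2 * r + 1, -1)" "p - w = emb N (-1) (1, 2 * r + 1, 1)"
  unfolding puvw d emb_def vec3_arith by (auto simp: vec3_eq_iff add_divide_distrib)

lemma positive_crossing_eq: "positive_crossing p u v w = list_edges N 1 (crossing_list up r)"
  unfolding positive_crossing_def corners(1-4)[of 1] corners(5,6)
  by (cases up) (auto simp: list_edges_def)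

lemma negative_crossing_eq: "negative_crossing p u v w = list_edges N (-1) (crossing_list up r)"
  unfolding negative_crossing_def corners(1-4)[of "-1"] corners(7,8)
  by (cases up) (auto simp: list_edges_def)

lemma smoothing_eq: "smoothing p u v = list_edges N 1 (smoothing_list up r)"
  unfolding smoothing_def corners(1-4)[of 1] corners(5,6)
  by (cases up) (auto simp: list_edges_def)

lemma octahedron_eq:
  "crossing_corners p u v \<union> {p + w, p - w} = emb N 1 ` set (octahedron r)"
  unfolding crossing_corners_def corners(1-4)[of 1] corners(5,6)
  by (cases up) (auto simp: octahedron_def)

lemma crossing_corners_eq:
  "crossing_corners p u v = emb N 1 ` {(0, 2 * r, 0), (2, 2 * r, 0), (0, 2 * r + 2, 0), (2, 2 * r + 2, 0)}"
  unfolding crossing_corners_def corners(1-4)[of 1] corners(5,6)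
  by (cases up) auto

lemma det_uvw: "det (vector [u, v, w] :: real^3^3) > 0"
  unfolding puvw d by (auto simp: det_3)

text \<open>The piece \<open>es\<close> behind the crossing is flat and hence invariant under the
  reflection that turns the positive crossing into the negative one. So all three links share the
  remainder \<open>R\<close>.\<close>

lemma skein_triple_attach:
  assumes E: "braid_like N b f E"
    and c: "attachable (rightward b f) (leftward b f) [] [] (crossing_list up r @ es)"
    and s: "attachable (rightward b f) (leftward b f) [] [] (smoothing_list up r @ es)"
    and o: "avoids_octahedron r es" and fl: "flat es"
  shows "skein_triple (E \<union> list_edges N 1 (crossing_list up r @ es))
    (E \<union> list_edges N (-1) (crossing_list up r @ es)) (E \<union> list_edges N 1 (smoothing_list up r @ es))"
proof -
  define R where "R = E \<union> list_edges N 1 es"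
  let ?C = "{(0, 2 * r, 0), (2, 2 * r, 0), (0, 2 * r + 2, 0), (2, 2 * r + 2, 0 :: int)}"
  let ?O = "convex hull (emb N 1 ` set (octahedron r))"
  have ne: "crossing_list up r @ es \<noteq> []" "smoothing_list up r @ es \<noteq> []" by (cases up; simp)+
  have "x \<in> emb N 1 ` ?C" if x: "x \<in> polygon_points R" "x \<in> ?O" for x
  proof -
    have *: "x \<in> emb N 1 ` (set (octahedron r) \<inter> set T)"
      if "separated (octahedron r) T" "x \<in> convex hull (emb N 1 ` set T)" for T
      using separated_imp[OF that(1), of 1 N] that(2) x(2) by auto
    consider "x \<in> polygon_points E" | "x \<in> polygon_points (list_edges N 1 es)" using x R_def by auto
    then show ?thesis
    proof cases
      case 1
      have "?O \<subseteq> {x. x $ 1 \<ge> N}"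
      proof (rule hull_minimal)
        show "emb N 1 ` set (octahedron r) \<subseteq> {x. x $ 1 \<ge> N}" by (auto simp: octahedron_def emb_nth1)
        show "convex {x::real^3. x $ 1 \<ge> N}"
          using convex_halfspace_ge[of N "axis 1 1 :: real^3"] by (simp add: inner_axis')
      qed
      then have "x \<in> emb N 1 ` set (flat_points 0 [1..4])"
        using 1 E x(2) unfolding braid_like_def ends_at_def by auto
      then obtain y where y: "y \<in> set [1..4]" "x = emb N 1 (0, 2 * y, 0)" by (auto simp: flat_points_def)
      show ?thesis
      proof (cases "y = r \<or> y = r + 1")
        case True
        then show ?thesis using y by (auto simp: distrib_left)
      next
        case False
        then have "separated (octahedron r) [(0, 2 * y, 0)]"
          using o y(1) unfolding avoids_octahedron_def list_all_iff by blast
        from *[OF this] y(2) False show ?thesis by (auto simp: octahedron_def)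
      qed
    next
      case 2
      then obtain p q where pq: "(p, q) \<in> set es" "x \<in> convex hull {emb N 1 p, emb N 1 q}"
        unfolding mem_polygon_points_list_edges by blast
      then have "separated (octahedron r) [p, q]" and 1: "fst p \<noteq> 1" "fst q \<noteq> 1"
        using o unfolding avoids_octahedron_def list_all_iff by blast+
      from *[OF this(1)] pq(2) obtain z where "z \<in> set (octahedron r)" "z = p \<or> z = q" "x = emb N 1 z"
        by auto
      moreover from this 1 have "fst z \<noteq> 1" by auto
      ultimately show ?thesis by (auto simp: octahedron_def)
    qed
  qed
  then have RO: "polygon_points R \<inter> convex hull (crossing_corners p u v \<union> {p + w, p - w})
      \<subseteq> crossing_corners p u v"
    unfolding octahedron_eq unfolding crossing_corners_eq by blast
  have "oriented_link (E \<union> list_edges N 1 (crossing_list up r @ es))"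
    "oriented_link (E \<union> list_edges N (-1) (crossing_list up r @ es))"
    "oriented_link (E \<union> list_edges N 1 (smoothing_list up r @ es))"
    using oriented_link_attach[OF E c _ ne(1)] oriented_link_attach[OF E s _ ne(2)] by auto
  moreover have "E \<union> list_edges N 1 (crossing_list up r @ es) = R \<union> positive_crossing p u v w"
    "E \<union> list_edges N (-1) (crossing_list up r @ es) = R \<union> negative_crossing p u v w"
    "E \<union> list_edges N 1 (smoothing_list up r @ es) = R \<union> smoothing p u v"
    unfolding R_def positive_crossing_eq negative_crossing_eq smoothing_eq
    using list_edges_flat[OF fl, of N "-1"] by auto
  ultimately show ?thesis unfolding skein_triple_def using RO det_uvw by metis
qed

end

section \<open>The diagram as a word of columns\<close>

type_synonym letter = "int \<times> bool \<times> nat"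

definition letter_edges :: "nat \<Rightarrow> letter \<Rightarrow> edges" where
  "letter_edges j = (\<lambda>(s, b, k). twist_column s j (if b then 2 else 3) k)"

text \<open>Columns are numbered through, without regard to regions, so that extending the diagram
  to the right is appending a letter.\<close>

definition braid :: "letter list \<Rightarrow> edges" where
  "braid w = left_caps \<union> (\<Union>j<length w. letter_edges j (w ! j))"

lemma braid_Nil: "braid [] = left_caps"
  by (simp add: braid_def)

lemma braid_snoc: "braid (w @ [c]) = braid w \<union> letter_edges (length w) c"
  by (auto simp: braid_def lessThan_Suc nth_append)

lemma left_caps_eq: "left_caps = list_edges (-1) 1 left_list"
  by (auto simp: left_caps_def bent_edge_def list_edges_def left_list_def pt_def emb_def vec3_eq_iff)

lemma right_caps_eq: "right_caps n N = list_edges N 1 (cap_list (odd n) False 0)"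
  by (cases "odd n") (auto simp: right_caps_def bent_edge_def list_edges_def reverse_if_def pt_def
      emb_def vec3_eq_iff)

lemma twist_crossing_eq:
  assumes "s = 1 \<or> s = -1"
  shows "twist_crossing s j r k = list_edges j (of_int s) (crossing_list (odd (r + k)) (int r))"
proof -
  have p: "pt (j + 1/2) (r + 1/2) = vector [real j + 1/2, of_int (int r) + 1/2, 0]" by (simp add: pt_def)
  show ?thesis using assms
      positive_crossing_eq[OF p refl refl refl refl, of "odd (r + k)"]
      negative_crossing_eq[OF p refl refl refl refl, of "odd (r + k)"]
    unfolding twist_crossing_def Let_def by auto
qed

lemma horizontal_strands_eq:
  "(\<Union>r'\<in>{1..4} - {r, r + 1}. horizontal_strand j r') = list_edges j \<epsilon> (strand_list b)"
  if "r = (if b then 2 else 3)"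
proof -
  have "{1..4} - {r, r + 1} = (if b then {1, 4} else {1, 2})"
    using that by (cases b) auto
  then show ?thesis
    by (cases b) (simp_all add: horizontal_strand_def pt_def emb_def insert_commute add.commute)
qed

lemma letter_edges_eq:
  assumes "s = 1 \<or> s = -1"
  shows "letter_edges j (s, b, k) = list_edges j (of_int s) (column_list b (odd k))"
proof -
  have "odd ((if b then 2 else 3) + k) = (b = odd k)" by auto
  moreover have "int (if b then 2 else 3) = pos b" by (simp add: pos_def)
  ultimately show ?thesis
    unfolding letter_edges_def prod.case twist_column_def twist_crossing_eq[OF assms]
      horizontal_strands_eq[OF refl, of j b "of_int s"] by simp
qed

definition signed :: "letter list \<Rightarrow> bool" where
  "signed w \<longleftrightarrow> (\<forall>(s, b, k)\<in>set w. s = 1 \<or> s = -1)"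

lemma signed_simps [simp]:
  "signed []" "signed (w @ w') \<longleftrightarrow> signed w \<and> signed w'"
  "signed ((s, b, k) # w) \<longleftrightarrow> (s = 1 \<or> s = -1) \<and> signed w"
  by (auto simp: signed_def)

lemma ends_at_braid: "signed w \<Longrightarrow> ends_at (length w) (braid w)"
proof (induction w rule: rev_induct)
  case Nil
  then show ?case
    using ends_at_right_end[OF left_list_check(2), of "-1" 1] by (simp add: braid_Nil left_caps_eq)
next
  case (snoc c w)
  obtain s b k where c: "c = (s, b, k)" by (metis prod_cases3)
  then have "signed w" and s: "s = 1 \<or> s = -1" using snoc.prems by auto
  then have "ends_at (length w) (braid w)" using snoc.IH by auto
  from ends_at_Un[OF this ends_at_right_end[OF right_end_column]]
  show ?case unfolding braid_snoc c letter_edges_eq[OF s] by (simp add: add.commute)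
qed

lemma braid_like_Nil: "braid_like 0 b False (braid [])"
proof -
  have "braid_like 0 True False (list_edges (-1) 1 left_list)"
    unfolding braid_like_def
    using half_list_imp[OF left_list_check(1), of 1 "-1"] ends_at_right_end[OF left_list_check(2), of "-1" 1]
      src_list_edges[of 1 "-1" left_list] snk_list_edges[of 1 "-1" left_list]
      left_list_check(3,4) emb_flat_points_shift[of "-1" 1 _ 1]
    by simp
  then show ?thesis unfolding braid_Nil left_caps_eq using braid_like_False by metis
qed

lemma braid_like_snoc:
  assumes "braid_like (length w) b (odd k) (braid w)" "s = 1 \<or> s = -1"
  shows "braid_like (length (w @ [(s, b, k)])) b (odd (Suc k)) (braid (w @ [(s, b, k)]))"
proof -
  have "of_int s * of_int s = (1::real)" using assms(2) by auto
  from braid_like_column[OF assms(1) this] show ?thesis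
    unfolding braid_snoc letter_edges_eq[OF assms(2)] by (simp add: add.commute)
qed

definition region :: "int \<Rightarrow> bool \<Rightarrow> nat \<Rightarrow> letter list" where
  "region s b m = map (\<lambda>k. (s, b, k)) [0..<m]"

lemma region_simps [simp]:
  "region s b 0 = []" "region s b (Suc m) = region s b m @ [(s, b, m)]" "length (region s b m) = m"
  by (simp_all add: region_def)

lemma signed_region: "s = 1 \<or> s = -1 \<Longrightarrow> signed (region s b m)"
  by (induction m) auto

lemma braid_like_region:
  assumes "braid_like (length w) b False (braid w)" "s = 1 \<or> s = -1"
  shows "braid_like (length (w @ region s b m)) b (odd m) (braid (w @ region s b m))"
proof (induction m)
  case (Suc m)
  from braid_like_snoc[OF Suc assms(2)] show ?case by simp
qed (use assms in simp)

text \<open>Parity and flag of the caps are independent of the word, because smoothing a crossing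
  leads to caps of the other parity behind an odd number of crossings.\<close>

definition closed_braid :: "letter list \<Rightarrow> bool \<Rightarrow> bool \<Rightarrow> edges" where
  "closed_braid w b f = braid w \<union> list_edges (length w) 1 (cap_list b f 0)"

lemma oriented_link_closure:
  assumes "braid_like (length w) b f (braid w)"
  shows "oriented_link (closed_braid w (\<not> b) f)"
proof -
  have "cap_list (\<not> b) f 0 \<noteq> []" by (cases b) auto
  with oriented_link_attach[OF assms attachable_caps[rule_format], of 1] show ?thesis
    unfolding closed_braid_def by simp
qed

lemma moves_braid:
  assumes "moves_to (flat_points 0 [1..4]) S ms S'" "signed w" "\<epsilon> * \<epsilon> = 1"
    and "same_set (map (orient d) S) es" "same_set (map (orient d) S') es'"
    and "oriented_link (braid w \<union> list_edges (length w) \<epsilon> es)"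
  shows "oriented_link (braid w \<union> list_edges (length w) \<epsilon> es') \<and>
    isotopic (braid w \<union> list_edges (length w) \<epsilon> es) (braid w \<union> list_edges (length w) \<epsilon> es')"
proof -
  have "polygon_points (braid w) \<inter> {x. x $ 1 \<ge> length w} \<subseteq> emb (length w) \<epsilon> ` set (flat_points 0 [1..4])"
    using ends_at_braid[OF assms(2)] unfolding ends_at_def emb_flat_points[of _ \<epsilon>] .
  from moves_to_sound[OF assms(1,3) this, of d] assms(6) show ?thesis
    unfolding tangle_edges_eq list_edges_cong[OF assms(4)] list_edges_cong[OF assms(5)] by blast
qed

text \<open>Orientedness of the result is part of the conclusion so that the kinks of a whole region
  can be removed one after the other.\<close>

lemma kink_isotopic:
  assumes w: "signed w" and s: "s = 1 \<or> s = -1"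
    and L: "oriented_link (closed_braid (w @ [(s, b, k)]) (\<not> b) (odd (Suc k)))"
  shows "oriented_link (closed_braid w (\<not> b) (odd k)) \<and>
    isotopic (closed_braid (w @ [(s, b, k)]) (\<not> b) (odd (Suc k))) (closed_braid w (\<not> b) (odd k))"
proof -
  have e: "of_int s * of_int s = (1::real)" using s by auto
  have 1: "closed_braid (w @ [(s, b, k)]) (\<not> b) (odd (Suc k)) = braid w \<union>
      list_edges (length w) (of_int s) (column_list b (odd k) @ cap_list (\<not> b) (\<not> odd k) 2)"
    unfolding closed_braid_def braid_snoc letter_edges_eq[OF s] list_edges_simps list_edges_cap_shift
    by (simp add: add.commute Un_assoc)
  have 2: "closed_braid w (\<not> b) (odd k) = braid w \<union>
      list_edges (length w) (of_int s) (cap_list (\<not> b) (odd k) 0)"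
    unfolding closed_braid_def list_edges_flat[OF flat_cap_list, of "length w" "of_int s"] ..
  show ?thesis
    unfolding 1 2
    by (rule moves_braid[where d = "orient_first (b = odd k)",
          OF kink_moves_to[rule_format] w e _ kink_orient(2)[rule_format]])
      (use kink_orient(1) L[unfolded 1] in auto)
qed

lemma kinks_isotopic:
  assumes w: "signed w" and s: "s = 1 \<or> s = -1"
    and L: "oriented_link (closed_braid (w @ region s b m) (\<not> b) (odd m))"
  shows "isotopic (closed_braid (w @ region s b m) (\<not> b) (odd m)) (closed_braid w (\<not> b) False)"
  using L
proof (induction m)
  case (Suc m)
  have "signed (w @ region s b m)" using w signed_region[OF s] by simp
  from kink_isotopic[OF this s, of b m] Suc show ?case
    by (auto intro: isotopic_trans)
qed simp

text \<open>In the embedding with \<open>\<epsilon> = s\<close> the first crossing is the one drawn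
  in \<open>clasp\<close>, so both signs use the same moves.\<close>

lemma clasp_isotopic:
  assumes w: "signed w" and s: "s = 1 \<or> s = -1" and k: "even k"
    and L: "oriented_link (closed_braid (w @ [(s, b, k), (- s, b, Suc k)]) b False)"
  shows "isotopic (closed_braid (w @ [(s, b, k), (- s, b, Suc k)]) b False) (closed_braid w b False)"
proof -
  have e: "of_int s * of_int s = (1::real)" using s by auto
  have s': "- s = 1 \<or> - s = -1" using s by auto
  have w2: "w @ [(s, b, k), (- s, b, Suc k)] = (w @ [(s, b, k)]) @ [(- s, b, Suc k)]" by simp
  have c: "list_edges (length w) \<epsilon> (cap_list b False 4) = list_edges (real (length w) + 1 + 1) 1 (cap_list b False 0)"
    for \<epsilon>
    using cap_list_shift[of b False 2] list_edges_shift[of "length w" \<epsilon> 1 "cap_list b False 2"]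
      list_edges_cap_shift[of "length w + 1" \<epsilon> b False] by (simp add: add.commute)
  have 1: "closed_braid (w @ [(s, b, k), (- s, b, Suc k)]) b False = braid w \<union>
      list_edges (length w) (of_int s) (column_list b False @ map (shift (-1)) (column_list b True)
        @ cap_list b False 4)"
    unfolding w2 closed_braid_def braid_snoc letter_edges_eq[OF s] letter_edges_eq[OF s']
    using k by (simp add: add.commute Un_assoc c list_edges_shift del: map_append)
  have 2: "closed_braid w b False = braid w \<union>
      list_edges (length w) (of_int s) (cap_list b False 0)"
    unfolding closed_braid_def list_edges_flat[OF flat_cap_list, of "length w" "of_int s"] ..
  show ?thesis
    unfolding 1 2
    by (rule moves_braid[where d = "orient_first True", THEN conjunct2,
          OF clasp_moves_to[rule_format] w e _ clasp_orient(2)[rule_format]])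
      (use clasp_orient(1) L[unfolded 1] in auto)
qed

lemma turnback_isotopic:
  assumes w: "signed w"
    and L: "oriented_link (braid w \<union> list_edges (length w) 1
      (smoothing_list b (pos b) @ strand_list b @ cap_list b False 2))"
  shows "oriented_link (closed_braid w (\<not> b) True) \<and> isotopic (braid w \<union> list_edges (length w) 1
      (smoothing_list b (pos b) @ strand_list b @ cap_list b False 2)) (closed_braid w (\<not> b) True)"
  unfolding closed_braid_def
  by (rule moves_braid[where d = "orient_first b",
        OF turnback_moves_to[rule_format] w _ _ turnback_orient(2)[rule_format]])
    (use turnback_orient(1) L in auto)

section \<open>The skein recursion\<close>

lemma moves_to_isotopic:
  assumes "moves_to [] S ms S'" "same_set (map (orient d) S) es" "oriented_link (list_edges N 1 es)"
  shows "isotopic (list_edges N 1 es) (tangle_edges N 1 d S')"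
  using moves_to_sound(2)[OF assms(1), of 1 "{}" N d] assms(3)
  unfolding tangle_edges_eq list_edges_cong[OF assms(2)] by simp

context
  fixes P :: "edges \<Rightarrow> ratfun"
  assumes P: "homfly_polynomial P"
begin

lemma P_isotopic: "isotopic L L' \<Longrightarrow> P L = P L'"
  using P unfolding homfly_polynomial_def by blast

lemma P_skein_triple:
  "skein_triple Lp Lm L0 \<Longrightarrow> ell * P Lp - inverse ell * P Lm = (qhalf - inverse qhalf) * P L0"
  using P unfolding homfly_polynomial_def by blast

lemma P_unknot: "P (closed_braid [] False False) = 1"
proof -
  have eq: "closed_braid [] False False = list_edges (-1) 1 (left_list @ map (shift 1) (cap_list False False 0))"
    unfolding closed_braid_def braid_Nil left_caps_eq list_edges_simps list_edges_shift by simp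
  have "oriented_link (closed_braid [] False False)"
    using oriented_link_closure[of "[]" True False] braid_like_Nil by simp
  from moves_to_isotopic[OF unknot_moves_to unknot_orient this[unfolded eq]]
  have "P (closed_braid [] False False) = P (tangle_edges (-1) 1 (orient_first True) unknot_end)"
    using P_isotopic eq by simp
  also have "tangle_edges (-1) 1 (orient_first True) unknot_end =
      {(emb (-1) 1 (2, 2, 0), emb (-1) 1 (6, 5, 0)), (emb (-1) 1 (6, 5, 0), emb (-1) 1 (2, 8, 0)),
       (emb (-1) 1 (2, 8, 0), emb (-1) 1 (2, 2, 0))}"
    by (simp add: tangle_edges_eq unknot_end_def strand_def orient_def orient_first_def)
  also have "P \<dots> = 1"
  proof -
    have "\<not> collinear {emb (-1) 1 (2, 2, 0), emb (-1) 1 (6, 5, 0), emb (-1) 1 (2, 8, 0)}"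
      unfolding collinear_3_expand by (auto simp: emb_def vec_eq_iff forall_3)
    then show ?thesis using P unfolding homfly_polynomial_def by blast
  qed
  finally show ?thesis .
qed

text \<open>A single crossing between the strands 2 and 3, closed by the even caps, is a kinked
  unknot for either sign, and its smoothing is the unlink. The value is kept multiplied by the skein
  coefficient, as the skein relation provides it.\<close>

lemma P_unlink: "(qhalf - inverse qhalf) * P (closed_braid [] True False) = ell - inverse ell"
proof -
  define es where "es = strand_list True @ cap_list False True 2"
  have b0: "braid_like 0 True False (braid [])" by (rule braid_like_Nil)
  have p: "pt (1/2) (5/2) = vector [0 + 1/2, of_int 2 + 1/2, 0]" by (simp add: pt_def)
  have sk: "skein_triple (braid [] \<union> list_edges 0 1 (crossing_list False 2 @ es))
    (braid [] \<union> list_edges 0 (-1) (crossing_list False 2 @ es))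
    (braid [] \<union> list_edges 0 1 (smoothing_list False 2 @ es))"
    by (rule skein_triple_attach[OF p refl refl refl refl b0])
      (simp_all only: attachable_kink es_def flat_append flat_strand_list flat_cap_list)
  then have o0: "oriented_link (braid [] \<union> list_edges 0 1 (smoothing_list False 2 @ es))"
    unfolding skein_triple_def by blast
  have kink: "P (braid [] \<union> list_edges 0 (of_int s) (crossing_list False 2 @ es)) = 1"
    if s: "s = 1 \<or> s = -1" for s
  proof -
    have eq: "braid [] \<union> list_edges 0 (of_int s) (crossing_list False 2 @ es) =
        closed_braid ([] @ [(s, True, 0)]) False True"
      unfolding closed_braid_def braid_snoc letter_edges_eq[OF s] es_def
      using list_edges_cap_shift[of 0 "of_int s" False True]
      by (simp add: pos_def Un_assoc del: crossing_list.simps strand_list.simps cap_list.simps)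
    have "oriented_link (closed_braid ([] @ [(s, True, 0)]) False True)"
      using oriented_link_closure[of "[] @ [(s, True, 0)]" True True] s
        braid_like_snoc[of "[]" True 0 s] b0 by simp
    then have "isotopic (closed_braid ([] @ [(s, True, 0)]) False True) (closed_braid [] False False)"
      using kink_isotopic[of "[]" s True 0] s by simp
    then show ?thesis unfolding eq using P_isotopic P_unknot by simp
  qed
  have eq0: "braid [] \<union> list_edges 0 1 (smoothing_list False 2 @ es) =
      list_edges (-1) 1 (left_list @ map (shift 1) (smoothing_list False 2 @ es))"
    unfolding braid_Nil left_caps_eq list_edges_simps(3)[of _ _ left_list] list_edges_shift by simp
  have eq1: "closed_braid [] True False = list_edges (-1) 1 (left_list @ map (shift 1) (cap_list True False 0))"
    unfolding closed_braid_def braid_Nil left_caps_eq list_edges_simps list_edges_shift by simp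
  have "isotopic (braid [] \<union> list_edges 0 1 (smoothing_list False 2 @ es))
      (tangle_edges (-1) 1 (orient_first True) unlink_end)"
    unfolding eq0
    by (rule moves_to_isotopic[OF unlink_moves_to]) (use unlink_orient(1) o0[unfolded eq0] in \<open>simp_all add: es_def\<close>)
  also have "tangle_edges (-1) 1 (orient_first True) unlink_end = closed_braid [] True False"
    unfolding tangle_edges_eq eq1 by (rule list_edges_cong[OF unlink_orient(2)])
  finally have "P (braid [] \<union> list_edges 0 1 (smoothing_list False 2 @ es)) = P (closed_braid [] True False)"
    by (rule P_isotopic)
  with P_skein_triple[OF sk] kink[of 1] kink[of "-1"] show ?thesis by simp
qed

lemma P_kinks:
  assumes "signed w" "braid_like (length w) b False (braid w)" "s = 1 \<or> s = -1" "even m"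
  shows "P (closed_braid (w @ region s b m) (\<not> b) False) = P (closed_braid w (\<not> b) False)"
proof -
  have "oriented_link (closed_braid (w @ region s b m) (\<not> b) (odd m))"
    by (rule oriented_link_closure[OF braid_like_region[OF assms(2,3)]])
  from kinks_isotopic[OF assms(1,3) this] show ?thesis using assms(4) P_isotopic by simp
qed

text \<open>For \<open>s = 1\<close> the longer region is the positive link of the skein triple, for
  \<open>s = -1\<close> the negative one. \<open>A\<close> counts crossings in pairs since switching
  the last crossing cancels it together with its neighbour.\<close>

lemma P_region:
  assumes w: "signed w" and E: "braid_like (length w) b False (braid w)" and s: "s = 1 \<or> s = -1"
  defines "A \<equiv> \<lambda>j. P (closed_braid (w @ region s b (2 * j)) b False)"
  shows "ell * A (if s = 1 then Suc j else j) - inverse ell * A (if s = 1 then j else Suc j) =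
    (qhalf - inverse qhalf) * P (closed_braid w (\<not> b) False)"
proof -
  \<comment> \<open>The index of the last of the \<open>2 * j + 2\<close> crossings, counted from 0,
    and also the odd number of crossings before it.\<close>
  define k where "k = Suc (2 * j)"
  define w' where "w' = w @ region s b k"
  define es where "es = strand_list b @ cap_list b False 2"
  have w': "signed w'" using w signed_region[OF s] by (simp add: w'_def)
  have E': "braid_like (length w') b True (braid w')"
    using braid_like_region[OF E s, of k] by (simp add: w'_def k_def)
  have p: "pt (length w' + 1/2) (of_int (pos b) + 1/2) =
      vector [real (length w') + 1/2, of_int (pos b) + 1/2, 0]"
    by (simp add: pt_def)
  have sk: "skein_triple (braid w' \<union> list_edges (length w') 1 (crossing_list b (pos b) @ es))
    (braid w' \<union> list_edges (length w') (-1) (crossing_list b (pos b) @ es))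
    (braid w' \<union> list_edges (length w') 1 (smoothing_list b (pos b) @ es))"
    by (rule skein_triple_attach[OF p refl refl refl refl E'])
      (use attachable_crossing attachable_smoothing avoids_octahedron_caps in \<open>simp_all add: es_def\<close>)
  have cr: "braid w' \<union> list_edges (length w') (of_int t) (crossing_list b (pos b) @ es) =
      closed_braid (w' @ [(t, b, k)]) b False" if t: "t = 1 \<or> t = -1" for t
    unfolding closed_braid_def braid_snoc letter_edges_eq[OF t] es_def
    using list_edges_cap_shift[of "length w'" "of_int t" b False]
    by (simp add: k_def Un_assoc add.commute)
  have o: "oriented_link (closed_braid (w' @ [(t, b, k)]) b False)" if t: "t = 1 \<or> t = -1" for t
  proof -
    have "oriented_link (braid w' \<union> list_edges (length w') 1 (crossing_list b (pos b) @ es))"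
      "oriented_link (braid w' \<union> list_edges (length w') (-1) (crossing_list b (pos b) @ es))"
      using sk unfolding skein_triple_def by blast+
    then show ?thesis using cr[of 1] cr[of "-1"] t by auto
  qed
  have o0: "oriented_link (braid w' \<union> list_edges (length w') 1 (smoothing_list b (pos b) @ es))"
    using sk unfolding skein_triple_def by blast
  have same: "P (closed_braid (w' @ [(s, b, k)]) b False) = A (Suc j)"
    by (simp add: A_def w'_def k_def)
  have wk: "w' @ [(- s, b, k)] = (w @ region s b (2 * j)) @ [(s, b, 2 * j), (- s, b, Suc (2 * j))]"
    by (simp add: w'_def k_def)
  have s': "- s = 1 \<or> - s = -1" using s by auto
  have opp: "P (closed_braid (w' @ [(- s, b, k)]) b False) = A j"
    unfolding A_def
    by (rule P_isotopic, unfold wk, rule clasp_isotopic[OF _ s])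
      (use w signed_region[OF s] o[OF s', unfolded wk] in auto)
  have t: "oriented_link (closed_braid w' (\<not> b) True)"
    "P (braid w' \<union> list_edges (length w') 1 (smoothing_list b (pos b) @ es)) = P (closed_braid w' (\<not> b) True)"
    using turnback_isotopic[OF w' o0[unfolded es_def]] P_isotopic by (auto simp: es_def)
  have "P (closed_braid w' (\<not> b) True) = P (closed_braid w (\<not> b) False)"
    using kinks_isotopic[OF w s, of b k] t(1) P_isotopic by (simp add: w'_def k_def)
  with t P_skein_triple[OF sk] cr[of 1] cr[of "-1"] same opp s show ?thesis
    by auto
qed

end

section \<open>The word of a continued fraction\<close>

definition letters :: "int list \<Rightarrow> letter list" where
  "letters bs = concat (map (\<lambda>i. region (cf_type bs i) (odd i) (nat \<bar>bs ! (i - 1)\<bar>)) [1..<length bs + 1])"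

lemma cf_type_append: "1 \<le> i \<Longrightarrow> i \<le> length bs \<Longrightarrow> cf_type (bs @ cs) i = cf_type bs i"
  by (simp add: cf_type_def nth_append)

lemma cf_len_append: "i \<le> length bs \<Longrightarrow> cf_len (bs @ cs) i = cf_len bs i"
  by (simp add: cf_len_def nth_append)

lemma cf_len_snoc: "cf_len (bs @ [c]) (Suc (length bs)) = cf_len bs (length bs) + nat \<bar>c\<bar>"
  using cf_len_append[of "length bs" bs "[c]"] by (simp add: cf_len_def nth_append)

lemma cf_type_snoc: "cf_type (bs @ [c]) (Suc (length bs)) = (-1) ^ length bs * sgn c"
  by (simp add: cf_type_def)

lemma letters_Nil [simp]: "letters [] = []"
  by (simp add: letters_def)

lemma letters_snoc:
  "letters (bs @ [c]) =
    letters bs @ region ((-1) ^ length bs * sgn c) (odd (Suc (length bs))) (nat \<bar>c\<bar>)"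
proof -
  have "map (\<lambda>i. region (cf_type (bs @ [c]) i) (odd i) (nat \<bar>(bs @ [c]) ! (i - 1)\<bar>)) [1..<length bs + 1] =
      map (\<lambda>i. region (cf_type bs i) (odd i) (nat \<bar>bs ! (i - 1)\<bar>)) [1..<length bs + 1]"
    by (rule map_cong) (auto simp: cf_type_append nth_append)
  moreover have "[1..<length (bs @ [c]) + 1] = [1..<length bs + 1] @ [Suc (length bs)]" by simp
  ultimately show ?thesis unfolding letters_def
    by (simp only: map_append concat_append) (simp add: cf_type_snoc)
qed

lemma length_letters: "length (letters bs) = cf_len bs (length bs)"
proof (induction bs rule: rev_induct)
  case (snoc c bs)
  then show ?case using cf_len_snoc[of bs c] by (simp add: letters_snoc)
qed (simp add: cf_len_def)

lemma braid_region:
  "braid (w @ region s b m) = braid w \<union> (\<Union>k<m. twist_column s (length w + k) (if b then 2 else 3) k)"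
proof (induction m)
  case (Suc m)
  then show ?case
    unfolding region_simps append_assoc[symmetric] braid_snoc
    by (simp add: letter_edges_def lessThan_Suc Un_ac)
qed simp

lemma braid_letters: "braid (letters bs) = left_caps \<union> (\<Union>i\<in>{1..length bs}. twist_region bs i)"
proof (induction bs rule: rev_induct)
  case (snoc c bs)
  have "twist_region (bs @ [c]) i = twist_region bs i" if "i \<in> {1..length bs}" for i
    using that by (auto simp: twist_region_def nth_append cf_type_append cf_len_append)
  moreover have "{1..length (bs @ [c])} = insert (Suc (length bs)) {1..length bs}" by auto
  moreover have "twist_region (bs @ [c]) (Suc (length bs)) =
      (\<Union>k<nat \<bar>c\<bar>. twist_column ((-1) ^ length bs * sgn c) (length (letters bs) + k)
        (if odd (Suc (length bs)) then 2 else 3) k)"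
    by (simp add: twist_region_def cf_type_snoc cf_len_append length_letters)
  ultimately show ?case
    using snoc by (simp add: letters_snoc braid_region Un_assoc Un_commute)
qed (simp add: braid_Nil)

lemma rational_link_eq: "rational_link bs = closed_braid (letters bs) (odd (length bs)) False"
  unfolding rational_link_def closed_braid_def braid_letters right_caps_eq length_letters by simp

lemma sign_power_sgn: "c \<noteq> 0 \<Longrightarrow> (-1) ^ n * sgn c = 1 \<or> (-1) ^ n * sgn c = (-1 :: int)"
  by (cases "even n") (auto simp: sgn_if)

text \<open>The induction is general in \<open>b\<close> because consecutive regions twist different
  pairs of strands.\<close>

lemma letters_braid_like:
  "even_continued_fraction bs \<Longrightarrow>
    signed (letters bs) \<and> braid_like (length (letters bs)) b False (braid (letters bs))"
proof (induction bs arbitrary: b rule: rev_induct)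
  case Nil
  then show ?case using braid_like_Nil by simp
next
  case (snoc c bs)
  define s :: int where "s = (-1) ^ length bs * sgn c"
  have c: "c \<noteq> 0" "even c" and bs: "even_continued_fraction bs"
    using snoc.prems by (auto simp: even_continued_fraction_def)
  have s: "s = 1 \<or> s = -1" unfolding s_def using sign_power_sgn c by blast
  have "even (nat \<bar>c\<bar>)" using c(2) by (simp add: even_nat_iff)
  then have "braid_like (length (letters (bs @ [c]))) (odd (Suc (length bs))) False (braid (letters (bs @ [c])))"
    using braid_like_region[OF _ s, of "letters bs" _ "nat \<bar>c\<bar>"] snoc.IH[OF bs]
    unfolding letters_snoc s_def[symmetric] by metis
  then have "braid_like (length (letters (bs @ [c]))) b False (braid (letters (bs @ [c])))"
    using braid_like_False by metis
  moreover have "signed (letters (bs @ [c]))"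
    using snoc.IH[OF bs] signed_region[OF s] unfolding letters_snoc s_def[symmetric] by simp
  ultimately show ?case by blast
qed

section \<open>Order ideals of path posets\<close>

text \<open>A path poset is built up from one end; \<open>u\<close> and \<open>v\<close> are the sums over the order ideals without
  and with the last element \<open>z\<close>.\<close>

inductive path_sums :: "(nat \<Rightarrow> 'a::comm_ring_1) \<Rightarrow> nat set \<Rightarrow> (nat \<times> nat) set \<Rightarrow> nat \<Rightarrow> 'a \<Rightarrow> 'a \<Rightarrow> bool"
  for y where
  single: "path_sums y {x} {} x 1 (y x)"
| above: "path_sums y E C z u v \<Longrightarrow> x \<notin> E \<Longrightarrow>
    path_sums y (insert x E) (insert (z, x) C) x (u + v) (y x * v)"
| below: "path_sums y E C z u v \<Longrightarrow> x \<notin> E \<Longrightarrow>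
    path_sums y (insert x E) (insert (x, z) C) x u (y x * (u + v))"

definition closed_subsets :: "nat set \<Rightarrow> (nat \<times> nat) set \<Rightarrow> nat set set" where
  "closed_subsets E C = {I. I \<subseteq> E \<and> (\<forall>(a, b)\<in>C. b \<in> I \<longrightarrow> a \<in> I)}"

lemma sum_insert_image:
  fixes y :: "'b \<Rightarrow> 'a::comm_ring_1"
  assumes "finite E" "x \<notin> E" "\<And>I. I \<in> A \<Longrightarrow> I \<subseteq> E"
  shows "(\<Sum>I\<in>insert x ` A. prod y I) = y x * (\<Sum>I\<in>A. prod y I)"
proof -
  have "inj_on (insert x) A" 
    using assms(2,3) by (intro inj_onI) (metis insert_ident subsetD)
  then have "(\<Sum>I\<in>insert x ` A. prod y I) = (\<Sum>I\<in>A. prod y (insert x I))"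
    by (simp add: sum.reindex)
  also have "\<dots> = (\<Sum>I\<in>A. y x * prod y I)"
  proof (rule sum.cong)
    fix I assume "I \<in> A"
    then have "x \<notin> I" "finite I" using assms finite_subset by blast+
    then show "prod y (insert x I) = y x * prod y I" by simp
  qed simp
  finally show ?thesis by (simp add: sum_distrib_left)
qed

lemma sum_split_mem:
  "finite A \<Longrightarrow> sum f A = sum f {I\<in>A. z \<notin> I} + sum f {I\<in>A. z \<in> I}"
  by (subst sum.union_disjoint[symmetric]) (auto intro!: sum.cong)

text \<open>A new element above the old last one joins only those ideals that contain the latter; a
  new element below it may be missing only from ideals that lack the latter.\<close>

lemma path_sums_sound:
  assumes "path_sums y E C z u v"
  shows "finite E \<and> z \<in> E \<and> C \<subseteq> E \<times> E \<and>
    u = (\<Sum>I\<in>{I\<in>closed_subsets E C. z \<notin> I}. prod y I) \<and>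
    v = (\<Sum>I\<in>{I\<in>closed_subsets E C. z \<in> I}. prod y I)"
  using assms
proof induction
  case (single x)
  have "{I \<in> closed_subsets {x} {}. x \<notin> I} = {{}}" "{I \<in> closed_subsets {x} {}. x \<in> I} = {{x}}"
    by (auto simp: closed_subsets_def)
  then show ?case by simp
next
  case (above E C z u v x)
  let ?N = "closed_subsets (insert x E) (insert (z, x) C)"
  have IH: "finite E" "z \<in> E" "C \<subseteq> E \<times> E"
    "u = (\<Sum>I\<in>{I\<in>closed_subsets E C. z \<notin> I}. prod y I)"
    "v = (\<Sum>I\<in>{I\<in>closed_subsets E C. z \<in> I}. prod y I)"
    using above.IH by blast+
  have C: "a \<noteq> x \<and> b \<noteq> x" if "(a, b) \<in> C" for a b using that IH(3) above.hyps(2) by auto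
  have all: "(\<Sum>I\<in>closed_subsets E C. prod y I) = u + v"
    using IH(1) unfolding IH(4,5) by (intro sum_split_mem) (simp add: closed_subsets_def)
  have 0: "{I\<in>?N. x \<notin> I} = closed_subsets E C"
    using IH above.hyps(2) by (auto simp: closed_subsets_def)
  have 1: "{I\<in>?N. x \<in> I} = insert x ` {I\<in>closed_subsets E C. z \<in> I}"
  proof (intro set_eqI iffI)
    fix I assume "I \<in> {I\<in>?N. x \<in> I}"
    then have "I - {x} \<in> {I\<in>closed_subsets E C. z \<in> I}" "I = insert x (I - {x})"
      using IH above.hyps(2) C by (fastforce simp: closed_subsets_def)+
    then show "I \<in> insert x ` {I\<in>closed_subsets E C. z \<in> I}" by blast
  qed (use IH above.hyps(2) C in \<open>auto simp: closed_subsets_def\<close>)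
  have 2: "(\<Sum>I\<in>insert x ` {I\<in>closed_subsets E C. z \<in> I}. prod y I) = y x * (\<Sum>I\<in>{I\<in>closed_subsets E C. z \<in> I}. prod y I)"
    by (rule sum_insert_image[OF IH(1) above.hyps(2)]) (simp add: closed_subsets_def)
  show ?case
    unfolding 0 1 2 all IH(4)[symmetric] IH(5)[symmetric] using IH(1-3) by auto
next
  case (below E C z u v x)
  let ?N = "closed_subsets (insert x E) (insert (x, z) C)"
  have IH: "finite E" "z \<in> E" "C \<subseteq> E \<times> E"
    "u = (\<Sum>I\<in>{I\<in>closed_subsets E C. z \<notin> I}. prod y I)"
    "v = (\<Sum>I\<in>{I\<in>closed_subsets E C. z \<in> I}. prod y I)"
    using below.IH by blast+
  have C: "a \<noteq> x \<and> b \<noteq> x" if "(a, b) \<in> C" for a b using that IH(3) below.hyps(2) by auto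
  have all: "(\<Sum>I\<in>closed_subsets E C. prod y I) = u + v"
    using IH(1) unfolding IH(4,5) by (intro sum_split_mem) (simp add: closed_subsets_def)
  have 0: "{I\<in>?N. x \<notin> I} = {I\<in>closed_subsets E C. z \<notin> I}"
    using IH below.hyps(2) by (auto simp: closed_subsets_def)
  have 1: "{I\<in>?N. x \<in> I} = insert x ` closed_subsets E C"
  proof (intro set_eqI iffI)
    fix I assume "I \<in> {I\<in>?N. x \<in> I}"
    then have "I - {x} \<in> closed_subsets E C" "I = insert x (I - {x})"
      using IH below.hyps(2) C by (fastforce simp: closed_subsets_def)+
    then show "I \<in> insert x ` closed_subsets E C" by blast
  qed (use IH below.hyps(2) C in \<open>auto simp: closed_subsets_def\<close>)
  have 2: "(\<Sum>I\<in>insert x ` closed_subsets E C. prod y I) = y x * (\<Sum>I\<in>closed_subsets E C. prod y I)"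
    by (rule sum_insert_image[OF IH(1) below.hyps(2)]) (simp add: closed_subsets_def)
  show ?case
    unfolding 0 1 2 all IH(4)[symmetric] IH(5)[symmetric] using IH(1-3) by auto
qed

text \<open>Closure under single covers propagates down every chain of covers, so the transitive
  closure need not be computed.\<close>

lemma order_ideals_eq_closed_subsets:
  assumes "C \<subseteq> A \<times> A"
  shows "order_ideals A (C\<^sup>* \<inter> A \<times> A) = closed_subsets A C"
proof (intro set_eqI iffI)
  fix I assume "I \<in> order_ideals A (C\<^sup>* \<inter> A \<times> A)"
  then show "I \<in> closed_subsets A C"
    using assms unfolding order_ideals_def closed_subsets_def by blast
next
  fix I assume I: "I \<in> closed_subsets A C"
  have "u \<in> I" if "(u, v) \<in> C\<^sup>*" "v \<in> I" for u v
    using that by (induction rule: converse_rtrancl_induct) (use I in \<open>auto simp: closed_subsets_def\<close>)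
  then show "I \<in> order_ideals A (C\<^sup>* \<inter> A \<times> A)"
    using I unfolding order_ideals_def closed_subsets_def by blast
qed

lemma F_cf_path_sums:
  assumes "path_sums y (Q_elements cs) (Q_covers cs) z u v"
  shows "F_cf cs y = u + v"
proof -
  let ?A = "closed_subsets (Q_elements cs) (Q_covers cs)"
  note s = path_sums_sound[OF assms]
  have "F_cf cs y = (\<Sum>I\<in>?A. prod y I)"
    using s unfolding F_cf_def F_poly_def Q_order_def by (simp add: order_ideals_eq_closed_subsets)
  also have "\<dots> = u + v"
    using s by (subst sum_split_mem[of _ _ z]) (auto simp: closed_subsets_def)
  finally show ?thesis .
qed

lemma F_cf_Nil: "F_cf [] y = 1"
proof -
  have "Q_elements [] = {}" "Q_covers [] = {}"
    by (auto simp: Q_elements_def Q_covers_def cf_len_def)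
  then show ?thesis by (simp add: F_cf_def F_poly_def order_ideals_def)
qed

definition edge :: "int \<Rightarrow> nat \<Rightarrow> nat \<Rightarrow> nat \<times> nat" where
  "edge t a b = (if t = 1 then (a, b) else (b, a))"

lemma path_sums_edge:
  assumes "path_sums y E C z u v" "x \<notin> E"
  shows "path_sums y (insert x E) (insert (edge t z x) C) x
    (if t = 1 then u + v else u) (y x * (if t = 1 then v else u + v))"
  using path_sums.above[OF assms] path_sums.below[OF assms] by (auto simp: edge_def)

text \<open>The effect on the two sums of two further elements, of weights \<open>e\<close> and \<open>d\<close>, in a twist region
  of type \<open>t\<close>.\<close>

fun extend :: "int \<Rightarrow> 'a::comm_ring_1 \<Rightarrow> 'a \<Rightarrow> 'a \<times> 'a \<Rightarrow> 'a \<times> 'a" where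
  "extend t e d (u, v) =
     (if t = 1 then (u + v + e * v, e * d * v) else (u, d * u + e * d * (u + v)))"

text \<open>Twist regions end at even labels, so each stage stops at an odd one and the following
  weights come in pairs \<open>e\<close>, \<open>d\<close>; hence steps of two labels.\<close>

lemma path_sums_extend:
  assumes "path_sums y E C a (fst s) (snd s)" "\<And>x. x \<in> E \<Longrightarrow> x \<le> a" "odd a"
    and y: "\<And>x. x > a \<Longrightarrow> y x = (if even x then e else d)"
  shows "path_sums y (E \<union> {a<..a + 2 * k}) (C \<union> (\<lambda>x. edge t x (Suc x)) ` {a..<a + 2 * k}) (a + 2 * k)
    (fst ((extend t e d ^^ k) s)) (snd ((extend t e d ^^ k) s))"
proof (induction k)
  case 0
  then show ?case using assms(1) by simp
next
  case (Suc k)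
  let ?E = "E \<union> {a<..a + 2 * k}" and ?C = "C \<union> (\<lambda>x. edge t x (Suc x)) ` {a..<a + 2 * k}"
  let ?b = "a + 2 * k"
  obtain u v where s: "(extend t e d ^^ k) s = (u, v)" by fastforce
  have 1: "Suc ?b \<notin> ?E" "Suc (Suc ?b) \<notin> insert (Suc ?b) ?E" using assms(2) by fastforce+
  have y1: "y (Suc ?b) = e" "y (Suc (Suc ?b)) = d" using y assms(3) by auto
  have E: "E \<union> {a<..a + 2 * Suc k} = insert (Suc (Suc ?b)) (insert (Suc ?b) ?E)" by auto
  have "{a..<a + 2 * Suc k} = insert (Suc ?b) (insert ?b {a..<?b})" by auto
  then have C: "C \<union> (\<lambda>x. edge t x (Suc x)) ` {a..<a + 2 * Suc k} =
      insert (edge t (Suc ?b) (Suc (Suc ?b))) (insert (edge t ?b (Suc ?b)) ?C)" by simp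
  have p: "path_sums y ?E ?C ?b u v" using Suc s by simp
  from path_sums_edge[OF path_sums_edge[OF p 1(1), of t] 1(2), of t] show ?case
    unfolding E C y1 by (auto simp: s algebra_simps)
qed

section \<open>The labeled path poset of an extended continued fraction\<close>

lemma even_continued_fraction_snoc:
  "even_continued_fraction (bs @ [c]) \<longleftrightarrow> even_continued_fraction bs \<and> even c \<and> c \<noteq> 0"
  by (auto simp: even_continued_fraction_def)

lemma cf_len_Suc: "cf_len cs (Suc i) = cf_len cs i + nat \<bar>cs ! i\<bar>"
  by (simp add: cf_len_def)

lemma cf_len_mono: "i \<le> j \<Longrightarrow> cf_len cs i \<le> cf_len cs j"
  by (rule lift_Suc_mono_le[of "cf_len cs"]) (simp_all add: cf_len_Suc)

lemma cf_len_gap: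
  assumes "even_continued_fraction cs" "i < j" "j \<le> length cs"
  shows "cf_len cs i + 2 \<le> cf_len cs j"
proof -
  have "even (cs ! i)" "cs ! i \<noteq> 0" using assms by (auto simp: even_continued_fraction_def)
  then have "2 \<le> nat \<bar>cs ! i\<bar>" by (elim evenE) auto
  then have "cf_len cs i + 2 \<le> cf_len cs (Suc i)" by (simp add: cf_len_Suc)
  also have "\<dots> \<le> cf_len cs j" using assms(2) by (intro cf_len_mono) simp
  finally show ?thesis .
qed

lemma even_cf_len: "even_continued_fraction cs \<Longrightarrow> i \<le> length cs \<Longrightarrow> even (cf_len cs i)"
  by (induction i) (auto simp: cf_len_Suc even_nat_iff even_continued_fraction_def cf_len_def[of _ 0])

lemma cf_type_cases:
  assumes "even_continued_fraction cs" "1 \<le> i" "i \<le> length cs"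
  shows "cf_type cs i = 1 \<or> cf_type cs i = -1"
proof -
  have "cs ! (i - 1) \<noteq> 0" using assms by (auto simp: even_continued_fraction_def)
  then show ?thesis using sign_power_sgn[of "cs ! (i - 1)" "i - 1"] assms by (auto simp: cf_type_def)
qed

lemma edge_simps: "edge 1 a b = (a, b)" "edge (-1) a b = (b, a)"
  by (simp_all add: edge_def)

text \<open>All types are 1 or -1, so \<open>edge\<close> unites upward and downward covers in one
  family; a removed label is bridged with the opposite sign.\<close>

lemma Q_covers_eq:
  assumes "even_continued_fraction cs"
  shows "Q_covers cs =
     {edge (cf_type cs i) u (u + 1) | u i. u \<in> Q_elements cs \<and> u + 1 \<in> Q_elements cs \<and> 1 \<le> i \<and>
        i \<le> length cs \<and> cf_len cs (i - 1) \<le> u \<and> u + 1 \<le> cf_len cs i} \<union>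
     {edge (- cf_type cs i) (cf_len cs i - 1) (cf_len cs i + 1) | i. 1 \<le> i \<and> i < length cs \<and>
        cf_type cs i = cf_type cs (i + 1)}" (is "_ = ?A \<union> ?B")
proof -
  let ?S = "\<lambda>t. {edge t u (u + 1) | u i. u \<in> Q_elements cs \<and> u + 1 \<in> Q_elements cs \<and> 1 \<le> i \<and>
        i \<le> length cs \<and> cf_len cs (i - 1) \<le> u \<and> u + 1 \<le> cf_len cs i \<and> cf_type cs i = t}"
  let ?T = "\<lambda>t. {edge (- t) (cf_len cs i - 1) (cf_len cs i + 1) | i. 1 \<le> i \<and> i < length cs \<and>
        cf_type cs i = t \<and> cf_type cs (i + 1) = t}"
  have "?A = ?S 1 \<union> ?S (-1)"
  proof (intro subset_antisym subsetI)
    fix e assume "e \<in> ?A"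
    then obtain u i where e: "e = edge (cf_type cs i) u (u + 1)" and i: "u \<in> Q_elements cs" "u + 1 \<in> Q_elements cs"
      "1 \<le> i" "i \<le> length cs" "cf_len cs (i - 1) \<le> u" "u + 1 \<le> cf_len cs i" by blast
    from cf_type_cases[OF assms i(3,4)] show "e \<in> ?S 1 \<union> ?S (-1)"
    proof
      assume t: "cf_type cs i = 1"
      show ?thesis
        by (rule UnI1, rule CollectI, rule exI[of _ u], rule exI[of _ i]) (use i e t in simp)
    next
      assume t: "cf_type cs i = -1"
      show ?thesis
        by (rule UnI2, rule CollectI, rule exI[of _ u], rule exI[of _ i]) (use i e t in simp)
    qed
  next
    fix e assume "e \<in> ?S 1 \<union> ?S (-1)"
    then obtain u i where "e = edge (cf_type cs i) u (u + 1)" "u \<in> Q_elements cs" "u + 1 \<in> Q_elements cs"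
      "1 \<le> i" "i \<le> length cs" "cf_len cs (i - 1) \<le> u" "u + 1 \<le> cf_len cs i" by force
    then show "e \<in> ?A" by blast
  qed
  moreover have "?B = ?T 1 \<union> ?T (-1)"
  proof (intro subset_antisym subsetI)
    fix e assume "e \<in> ?B"
    then obtain i where e: "e = edge (- cf_type cs i) (cf_len cs i - 1) (cf_len cs i + 1)" and i: "1 \<le> i"
      "i < length cs" "cf_type cs i = cf_type cs (i + 1)" by blast
    from cf_type_cases[OF assms i(1)] i(2) have "cf_type cs i = 1 \<or> cf_type cs i = -1" by simp
    then show "e \<in> ?T 1 \<union> ?T (-1)"
    proof
      assume t: "cf_type cs i = 1"
      show ?thesis
        by (rule UnI1, rule CollectI, rule exI[of _ i]) (use i e t in simp)
    next
      assume t: "cf_type cs i = -1"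
      show ?thesis
        by (rule UnI2, rule CollectI, rule exI[of _ i]) (use i e t in simp)
    qed
  next
    fix e assume "e \<in> ?T 1 \<union> ?T (-1)"
    then obtain i where "e = edge (- cf_type cs i) (cf_len cs i - 1) (cf_len cs i + 1)" "1 \<le> i"
      "i < length cs" "cf_type cs i = cf_type cs (i + 1)" by force
    then show "e \<in> ?B" by blast
  qed
  ultimately show ?thesis unfolding Q_covers_def by (simp add: edge_simps Un_assoc)
qed

context
  fixes bs :: "int list" and c :: int and n M L :: nat and t :: int
  assumes ecf: "even_continued_fraction (bs @ [c])"
  defines "n \<equiv> length bs" and "M \<equiv> cf_len bs (length bs)" and "L \<equiv> cf_len bs (length bs) + nat \<bar>c\<bar>"
    and "t \<equiv> (-1) ^ length bs * sgn c"
begin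

lemma ecf': "even_continued_fraction bs" "even c" "c \<noteq> 0"
  using ecf by (simp_all add: even_continued_fraction_snoc)

lemma cf_snoc_simps:
  "i \<le> n \<Longrightarrow> cf_len (bs @ [c]) i = cf_len bs i"
  "1 \<le> i \<Longrightarrow> i \<le> n \<Longrightarrow> cf_type (bs @ [c]) i = cf_type bs i"
  "cf_len (bs @ [c]) (Suc n) = L" "cf_type (bs @ [c]) (Suc n) = t" "length (bs @ [c]) = Suc n"
  using cf_len_append[of i bs "[c]"] cf_type_append[of i bs "[c]"] cf_len_snoc[of bs c] cf_type_snoc[of bs c]
  by (auto simp: n_def L_def t_def)

text \<open>The label \<open>M\<close> was the excluded upper bound of the old range and becomes
  interior now. It stays out if the types at the joint agree, and for \<open>n = 0\<close> because
  it is then the label 0.\<close>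

lemma mem_Q_elements_snoc:
  "x \<in> Q_elements (bs @ [c]) \<longleftrightarrow>
    x \<in> Q_elements bs \<or> M \<le> x \<and> x < L \<and> \<not> (x = M \<and> (n = 0 \<or> cf_type bs n = t))"
proof -
  have gap: "cf_len bs i < M" if "i < n" for i
    using cf_len_gap[OF ecf'(1) that] by (simp add: n_def M_def)
  have M0: "M \<ge> 1 \<longleftrightarrow> n \<noteq> 0"
    using gap[of 0] by (auto simp: M_def n_def cf_len_def)
  have M_le_L: "M \<le> L" by (simp add: M_def L_def)
  define R where "R = {cf_len bs i | i. 1 \<le> i \<and> i < n \<and> cf_type bs i = cf_type bs (i + 1)}"
  have Rl: "y < M" if "y \<in> R" for y using that gap by (auto simp: R_def)
  have "{cf_len (bs @ [c]) i | i. 1 \<le> i \<and> i < length (bs @ [c]) \<and>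
      cf_type (bs @ [c]) i = cf_type (bs @ [c]) (i + 1)} =
      R \<union> (if n \<noteq> 0 \<and> cf_type bs n = t then {M} else {})" (is "?R = _")
  proof (intro set_eqI iffI)
    fix y assume "y \<in> ?R"
    then obtain i where i: "y = cf_len (bs @ [c]) i" "1 \<le> i" "i \<le> n"
      "cf_type (bs @ [c]) i = cf_type (bs @ [c]) (i + 1)" by (auto simp: cf_snoc_simps(5) n_def)
    show "y \<in> R \<union> (if n \<noteq> 0 \<and> cf_type bs n = t then {M} else {})"
      using i cf_snoc_simps(1,2)[of i] cf_snoc_simps(3,4) cf_snoc_simps(2)[of "i + 1"]
      by (cases "i = n") (auto simp: R_def M_def n_def)
  next
    fix y assume y: "y \<in> R \<union> (if n \<noteq> 0 \<and> cf_type bs n = t then {M} else {})"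
    show "y \<in> ?R"
    proof (cases "y \<in> R")
      case True
      then obtain i where "y = cf_len bs i" "1 \<le> i" "i < n" "cf_type bs i = cf_type bs (i + 1)"
        by (auto simp: R_def)
      note pre = this
      show ?thesis
      by (rule CollectI, rule exI[of _ i])
        (use pre cf_snoc_simps(1,2)[of i] cf_snoc_simps(2)[of "i + 1"] cf_snoc_simps(5) in auto)
    next
      case False
      then have "n \<noteq> 0" "cf_type bs n = t" "y = M" using y by (auto split: if_splits)
      note pre = this
      show ?thesis
      by (rule CollectI, rule exI[of _ n])
        (use pre cf_snoc_simps(1,2)[of n] cf_snoc_simps(4,5) in \<open>auto simp: M_def n_def Suc_le_eq\<close>)
    qed
  qed
  then have "Q_elements (bs @ [c]) =
      {1..<L} - (R \<union> (if n \<noteq> 0 \<and> cf_type bs n = t then {M} else {}))"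
    unfolding Q_elements_def cf_snoc_simps(3,5) by simp
  moreover have "Q_elements bs = {1..<M} - R"
    unfolding Q_elements_def R_def M_def n_def ..
  ultimately show ?thesis
  proof (cases "M \<le> x")
    case True
    then have "x \<notin> R" using Rl by force
    with True \<open>Q_elements (bs @ [c]) = _\<close> \<open>Q_elements bs = _\<close> M0 show ?thesis by auto
  next
    case False
    with \<open>Q_elements (bs @ [c]) = _\<close> \<open>Q_elements bs = _\<close> M_le_L show ?thesis by auto
  qed
qed

text \<open>One edge ties the new part to the old path. If the label \<open>M\<close> is present,
  this edge still lies in the old last region and carries its type; otherwise it bridges the gap at
  \<open>M\<close>. All further edges form a chain of type \<open>t\<close>.\<close>

lemma Q_covers_snoc:
  assumes n: "n \<noteq> 0"
  defines "a \<equiv> if cf_type bs n = t then M + 1 else M"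
  shows "Q_covers (bs @ [c]) = Q_covers bs \<union>
    {if cf_type bs n = t then edge (- t) (M - 1) (M + 1) else edge (cf_type bs n) (M - 1) M} \<union>
    (\<lambda>u. edge t u (Suc u)) ` {a..<L - 1}" (is "_ = _ \<union> {?e} \<union> ?new")
proof -
  have gap: "cf_len bs i + 2 \<le> M" if "i < n" for i
    using cf_len_gap[OF ecf'(1) that] by (simp add: n_def M_def)
  have M2: "M \<ge> 2" using gap[of 0] n by simp
  have below: "x < M" if "x \<in> Q_elements bs" for x
    using that by (auto simp: Q_elements_def M_def)
  \<comment> \<open>Terms have absolute value at least 2, so no removed label is as large as
    \<open>M - 1\<close>.\<close>
  have M1: "M - 1 \<in> Q_elements bs"
    using M2 gap by (fastforce simp: Q_elements_def M_def n_def)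
  have len: "cf_len bs n = M" by (simp add: M_def n_def)
  have le: "cf_len bs i \<le> M" if "i \<le> n" for i
    using cf_len_mono[OF that, of bs] len by simp
  note Q = mem_Q_elements_snoc
  show ?thesis
    unfolding Q_covers_eq[OF ecf] Q_covers_eq[OF ecf'(1)]
  proof (intro subset_antisym Un_least subsetI, goal_cases)
    case (1 e)
    then obtain u i where e: "e = edge (cf_type (bs @ [c]) i) u (u + 1)"
      and u: "u \<in> Q_elements (bs @ [c])" "u + 1 \<in> Q_elements (bs @ [c])"
      and i: "1 \<le> i" "i \<le> Suc n" "cf_len (bs @ [c]) (i - 1) \<le> u" "u + 1 \<le> cf_len (bs @ [c]) i"
      unfolding cf_snoc_simps(5) by blast
    show ?case
    proof (cases "i = Suc n")
      case True
      then have "M \<le> u" using i cf_snoc_simps(1)[of n] len by simp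
      then have "u \<in> {a..<L - 1}" using u n below[of u] below[of "u + 1"] unfolding Q a_def
        by (auto split: if_splits)
      then show ?thesis using e True cf_snoc_simps(4) by auto
    next
      case False
      then have i': "i \<le> n" using i by simp
      then have s: "cf_len (bs @ [c]) (i - 1) = cf_len bs (i - 1)" "cf_len (bs @ [c]) i = cf_len bs i"
        "cf_type (bs @ [c]) i = cf_type bs i" using cf_snoc_simps i by simp_all
      show ?thesis
      proof (cases "u + 1 = M")
        case True
        then have "\<not> i < n" using gap[of i] i(4) s by linarith
        then have "i = n" using i' by simp
        moreover have "cf_type bs n \<noteq> t" using u(2) True below[of M] n unfolding Q by auto
        moreover have "u = M - 1" using True by simp
        ultimately show ?thesis using e s True by simp
      next
        case False
        then have "u + 1 < M" using i(4) s le[OF i'] by linarith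
        then have "u \<in> Q_elements bs" "u + 1 \<in> Q_elements bs" using u unfolding Q by auto
        note pre = this
        show ?thesis
          by (rule UnI1, rule UnI1, rule UnI1, rule CollectI, rule exI[of _ u], rule exI[of _ i])
            (use e s i i' pre in \<open>auto simp: n_def\<close>)
      qed
    qed
  next
    case (2 e)
    then obtain i where e: "e = edge (- cf_type (bs @ [c]) i) (cf_len (bs @ [c]) i - 1) (cf_len (bs @ [c]) i + 1)"
      and i: "1 \<le> i" "i \<le> n" "cf_type (bs @ [c]) i = cf_type (bs @ [c]) (i + 1)"
      unfolding cf_snoc_simps(5) by auto
    show ?case
    proof (cases "i = n")
      case True
      then show ?thesis using e i cf_snoc_simps(1,2)[of n] cf_snoc_simps(4) len by simp
    next
      case False
      then have "cf_len (bs @ [c]) i = cf_len bs i" "cf_type (bs @ [c]) i = cf_type bs i"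
        "cf_type (bs @ [c]) (i + 1) = cf_type bs (i + 1)" "i < length bs"
        using cf_snoc_simps(1,2)[of i] cf_snoc_simps(2)[of "i + 1"] i by (simp_all add: n_def)
      note s = this
      show ?thesis
        by (rule UnI1, rule UnI1, rule UnI2, rule CollectI, rule exI[of _ i]) (use e i s in auto)
    qed
  next
    case (3 e)
    then obtain u i where e: "e = edge (cf_type bs i) u (u + 1)"
      and u: "u \<in> Q_elements bs" "u + 1 \<in> Q_elements bs"
      and i: "1 \<le> i" "i \<le> n" "cf_len bs (i - 1) \<le> u" "u + 1 \<le> cf_len bs i" by (auto simp: n_def)
    note pre = this
    show ?case
      by (rule UnI1, rule CollectI, rule exI[of _ u], rule exI[of _ i])
        (use pre cf_snoc_simps(1,2)[of i] cf_snoc_simps(1)[of "i - 1"] cf_snoc_simps(5) in \<open>auto simp: Q\<close>)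
  next
    case (4 e)
    then obtain i where e: "e = edge (- cf_type bs i) (cf_len bs i - 1) (cf_len bs i + 1)"
      and i: "1 \<le> i" "i < n" "cf_type bs i = cf_type bs (i + 1)" by (auto simp: n_def)
    note pre = this
    show ?case
      by (rule UnI2, rule CollectI, rule exI[of _ i])
        (use pre cf_snoc_simps(1,2)[of i] cf_snoc_simps(2)[of "i + 1"] cf_snoc_simps(5) in auto)
  next
    case (5 e)
    show ?case
    proof (cases "cf_type bs n = t")
      case True
      note pre = this
      show ?thesis
      by (rule UnI2, rule CollectI, rule exI[of _ n])
        (use pre 5 n cf_snoc_simps(1,2)[of n] cf_snoc_simps(4,5) len in auto)
    next
      case False
      have "M < L" using ecf'(3) by (simp add: L_def M_def)
      then have "M \<in> Q_elements (bs @ [c])" "M - 1 \<in> Q_elements (bs @ [c])" using False M1 n unfolding Q by auto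
      moreover have "cf_len bs (n - 1) \<le> M - 1" using gap[of "n - 1"] n by linarith
      ultimately have pre: "M \<in> Q_elements (bs @ [c])" "M - 1 \<in> Q_elements (bs @ [c])"
        "cf_len bs (n - 1) \<le> M - 1" by blast+
      show ?thesis
        by (rule UnI1, rule CollectI, rule exI[of _ "M - 1"], rule exI[of _ n])
          (use pre 5 False n cf_snoc_simps(1,2)[of n] cf_snoc_simps(1)[of "n - 1"] cf_snoc_simps(5) len M2 in auto)
    qed
  next
    case (6 e)
    then obtain u where u: "a \<le> u" "u < L - 1" "e = edge t u (u + 1)" by auto
    then have "M \<le> u" "u \<in> Q_elements (bs @ [c])" "u + 1 \<in> Q_elements (bs @ [c])"
      using n unfolding Q a_def by (auto split: if_splits)
    note pre = this
    show ?case
      by (rule UnI1, rule CollectI, rule exI[of _ u], rule exI[of _ "Suc n"])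
        (use pre u cf_snoc_simps(1)[of n] cf_snoc_simps(3-5) len in auto)
  qed
qed

end

lemma Q_covers_single:
  assumes ecf: "even_continued_fraction [c]"
  shows "Q_covers [c] = (\<lambda>u. edge (sgn c) u (Suc u)) ` {1..<nat \<bar>c\<bar> - 1}"
proof -
  have "Q_elements [c] = {1..<nat \<bar>c\<bar>}" by (auto simp: Q_elements_def cf_len_def)
  then show ?thesis unfolding Q_covers_eq[OF ecf] 
    by (fastforce simp: cf_len_def cf_type_def)
qed

lemma Q_elements_single: "Q_elements [c] = {1..<nat \<bar>c\<bar>}"
  by (auto simp: Q_elements_def cf_len_def)

section \<open>Comparison of the two recursions\<close>

text \<open>Freed from the factor \<open>inverse (l ^ (2 * j))\<close>, \<open>A (Suc j)\<close>
  grows at each step by a multiple of \<open>l ^ (2 * j)\<close>; the total ideal sum grows by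
  \<open>e + l ^ 2\<close> times the second sum, which is multiplied by \<open>l ^ 2\<close> each
  time. The premise \<open>zB\<close> equates the increments. The start is \<open>A 1\<close> since
  the first pair of crossings belongs to the transition from the previous region.\<close>

lemma positive_region:
  fixes l z B :: "'a::field" and A :: "nat \<Rightarrow> 'a"
  assumes l: "l \<noteq> 0" and ed: "e * d = l ^ 2"
    and rec: "\<And>j. l * A (Suc j) - inverse l * A j = z * B"
    and A1: "A 1 = m * (u + v)" and zB: "m * (e + l ^ 2) * v = l * z * B"
  defines "s \<equiv> \<lambda>j. (extend 1 e d ^^ j) (u, v)"
  shows "snd (s j) = l ^ (2 * j) * v"
    and "A (Suc j) = m * inverse (l ^ (2 * j)) * (fst (s j) + snd (s j))"
proof -
  have s: "s (Suc j) = (fst (s j) + snd (s j) + e * snd (s j), l ^ 2 * snd (s j))" for j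
    by (cases "s j") (simp add: s_def ed)
  show snd: "snd (s j) = l ^ (2 * j) * v" for j
    by (induction j) (simp add: s_def, simp add: s power_add mult.assoc mult.left_commute power2_eq_square)
  show "A (Suc j) = m * inverse (l ^ (2 * j)) * (fst (s j) + snd (s j))"
  proof (induction j)
    case 0
    then show ?case using A1 by (simp add: s_def)
  next
    case (Suc j)
    let ?T = "fst (s j) + snd (s j)"
    have "l * A (Suc (Suc j)) = inverse l * A (Suc j) + z * B" using rec[of "Suc j"] by (simp add: algebra_simps)
    then have "l ^ 2 * A (Suc (Suc j)) = A (Suc j) + l * z * B"
      using l by (simp add: power2_eq_square field_simps)
    also have "\<dots> = m * inverse (l ^ (2 * j)) * (?T + (e + l ^ 2) * (l ^ (2 * j) * v))"
    proof -
      have "l ^ (2 * j) \<noteq> 0" using l by simp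
      then have "m * inverse (l ^ (2 * j)) * (?T + (e + l ^ 2) * (l ^ (2 * j) * v)) =
          m * inverse (l ^ (2 * j)) * ?T + m * (e + l ^ 2) * v"
        by (simp add: field_simps)
      then show ?thesis by (simp add: Suc zB)
    qed
    also have "\<dots> = m * inverse (l ^ (2 * j)) * (fst (s (Suc j)) + snd (s (Suc j)))"
      by (simp add: s snd algebra_simps)
    finally show ?case
      using l by (simp add: field_simps power2_eq_square)
  qed
qed

text \<open>Here the first sum is constant and plays the part of the inhomogeneous term, while the
  total is multiplied by \<open>e * d = l ^ 2\<close> at each step, just as \<open>A\<close>
  is.\<close>

lemma negative_region:
  fixes l z B :: "'a::field" and A :: "nat \<Rightarrow> 'a"
  assumes l: "l \<noteq> 0" and ed: "e * d = l ^ 2"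
    and rec: "\<And>j. l * A j - inverse l * A (Suc j) = z * B"
    and A1: "A 1 = m * (u + v)" and zB: "m * (1 + d) * u = - (l * z * B)"
  defines "s \<equiv> \<lambda>j. (extend (-1) e d ^^ j) (u, v)"
  shows "fst (s j) = u" and "A (Suc j) = m * (fst (s j) + snd (s j))"
proof -
  have s: "s (Suc j) = (fst (s j), d * fst (s j) + l ^ 2 * (fst (s j) + snd (s j)))" for j
    by (cases "s j") (simp add: s_def ed)
  show fst: "fst (s j) = u" for j
    by (induction j) (simp add: s_def, simp add: s)
  show "A (Suc j) = m * (fst (s j) + snd (s j))"
  proof (induction j)
    case 0
    then show ?case using A1 by (simp add: s_def)
  next
    case (Suc j)
    have "inverse l * A (Suc (Suc j)) = l * A (Suc j) - z * B" using rec[of "Suc j"] by (simp add: algebra_simps)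
    then have "A (Suc (Suc j)) = l ^ 2 * A (Suc j) - l * z * B"
      using l by (simp add: power2_eq_square field_simps)
    also have "\<dots> = l ^ 2 * (m * (fst (s j) + snd (s j))) + m * (1 + d) * u" by (simp add: Suc zB)
    also have "\<dots> = m * (fst (s (Suc j)) + snd (s (Suc j)))" by (simp add: s fst algebra_simps)
    finally show ?case .
  qed
qed

section \<open>The coefficients in the field of rational functions\<close>

lemma ell_neq_0: "ell \<noteq> 0" and qhalf_neq_0: "qhalf \<noteq> 0"
  and q_neq_1: "q \<noteq> 1" and ell_q_neq_1: "ell ^ 2 * q \<noteq> 1"
  by (simp_all add: ell_def qhalf_def Zero_fract_def One_fract_def eq_fract power2_eq_square
      one_pCons)

definition y_ratio :: ratfun where "y_ratio = (1 - ell ^ 2 * q) / (1 - inverse q)"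

lemma y_ratio_neq_0: "y_ratio \<noteq> 0"
  using ell_q_neq_1 q_neq_1 qhalf_neq_0 by (simp add: y_ratio_def)

lemma m_shift_append: "k \<le> Suc (length bs) \<Longrightarrow> m_shift (bs @ cs) k = m_shift bs k"
proof (induction bs k rule: m_shift.induct)
  case (3 bs k)
  have "cf_type (bs @ cs) (k + 1) = cf_type bs (k + 1)" using 3 by (intro cf_type_append) simp_all
  moreover have "cf_type (bs @ cs) k = cf_type bs k"
    using 3 cf_type_append[of k bs cs] by (cases k) (simp_all add: cf_type_def)
  ultimately show ?case using 3 by (simp add: Let_def nth_append)
qed simp_all

text \<open>For \<open>bs = []\<close> and \<open>t = 1\<close> the convention that the type with
  index 0 is -1 selects the middle case, and \<open>m_shift bs 0\<close> is the value at the formal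
  symbol.\<close>

lemma m_cf_snoc:
  assumes t: "t = (-1) ^ length bs * sgn c"
  shows "m_cf (bs @ [c]) =
    (if t = -1 then - (ell * qhalf * m_cf bs)
     else if cf_type bs (length bs) = -1 then ell powi (- \<bar>c\<bar>) * m_shift bs (length bs)
     else ell powi (1 - \<bar>c\<bar>) * qhalf * m_cf bs)"
proof -
  have "cf_type (bs @ [c]) (length bs) = cf_type bs (length bs)"
    using cf_type_append[of "length bs" bs "[c]"] by (cases "length bs") (simp_all add: cf_type_def)
  then show ?thesis
    using cf_type_snoc[of bs c] m_shift_append[of "Suc (length bs)" bs "[c]"]
      m_shift_append[of "length bs" bs "[c]"]
    by (simp add: m_cf_def Let_def t nth_append)
qed

lemma y_spec_snoc: "bs \<noteq> [] \<Longrightarrow> y_spec (bs @ [c]) = y_spec bs"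
  by (auto simp: y_spec_def nth_append fun_eq_iff)

lemma y_spec_ge_2: "k \<ge> 2 \<Longrightarrow> y_spec bs k = (if even k then - (ell ^ 2 * q) else - inverse q)"
  by (simp add: y_spec_def)

definition ideal_sums :: "int list \<Rightarrow> ratfun \<Rightarrow> ratfun \<Rightarrow> bool" where
  "ideal_sums bs u v \<longleftrightarrow>
     path_sums (y_spec bs) (Q_elements bs) (Q_covers bs) (cf_len bs (length bs) - 1) u v"

lemma F_tilde_ideal_sums: "ideal_sums bs u v \<Longrightarrow> F_tilde bs = u + v"
  unfolding ideal_sums_def F_tilde_def by (rule F_cf_path_sums)

abbreviation y_even :: ratfun where "y_even \<equiv> - (ell ^ 2 * q)"
abbreviation y_odd :: ratfun where "y_odd \<equiv> - inverse q"

lemma y_even_y_odd: "y_even * y_odd = ell ^ 2"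
  using qhalf_neq_0 by simp

lemma abs_eq_int: "nat \<bar>c\<bar> = m \<Longrightarrow> \<bar>c\<bar> = int m"
  by simp

lemma ideal_sums_single:
  assumes c: "nat \<bar>c\<bar> = 2 * Suc j"
  shows "ideal_sums [c] (fst ((extend (sgn c) y_even y_odd ^^ j) (1, y_spec [c] 1)))
    (snd ((extend (sgn c) y_even y_odd ^^ j) (1, y_spec [c] 1)))"
proof -
  have "even \<bar>c\<bar>" unfolding abs_eq_int[OF c] by simp
  then have ecf: "even_continued_fraction [c]" using c by (auto simp: even_continued_fraction_def)
  have 1: "Q_elements [c] = {1} \<union> {1<..1 + 2 * j}" unfolding Q_elements_single c by auto
  have 2: "Q_covers [c] = {} \<union> (\<lambda>u. edge (sgn c) u (Suc u)) ` {1..<1 + 2 * j}"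
    unfolding Q_covers_single[OF ecf] c by simp
  have 3: "cf_len [c] (length [c]) - 1 = 1 + 2 * j" using c by (simp add: cf_len_def)
  show ?thesis
    unfolding ideal_sums_def 1 2 3
    by (rule path_sums_extend) (auto intro: path_sums.single simp: y_spec_ge_2)
qed

text \<open>\<open>s1\<close> is the state at the odd label \<open>M + 1\<close>, from which the new
  region is uniform. If the types agree, one step across the missing label leads there, in the
  direction opposite to \<open>t\<close>; otherwise two steps do, the first in the direction of the
  old type and the second in that of \<open>t\<close>.\<close>

lemma ideal_sums_snoc:
  assumes ecf: "even_continued_fraction (bs @ [c])" and bs: "bs \<noteq> []"
    and c: "nat \<bar>c\<bar> = 2 * Suc j" and t: "t = (-1) ^ length bs * sgn c"
    and s: "ideal_sums bs u v"
  defines "s1 \<equiv> if cf_type bs (length bs) = t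
      then (if t = -1 then (u + v, y_odd * v) else (u, y_odd * (u + v)))
      else if t = 1 then (u + y_even * (u + v), y_odd * (y_even * (u + v)))
      else (u + v, y_odd * (u + v + y_even * v))"
  shows "ideal_sums (bs @ [c]) (fst ((extend t y_even y_odd ^^ j) s1)) (snd ((extend t y_even y_odd ^^ j) s1))"
proof -
  define M where "M = cf_len bs (length bs)"
  let ?y = "y_spec (bs @ [c])" and ?T = "cf_type bs (length bs)"
  let ?E = "Q_elements bs" and ?C = "Q_covers bs"
  have ecf': "even_continued_fraction bs" "c \<noteq> 0" using ecf by (auto simp: even_continued_fraction_snoc)
  have t1: "t = 1 \<or> t = -1" unfolding t by (rule sign_power_sgn[OF ecf'(2)])
  have T1: "?T = 1 \<or> ?T = -1" using cf_type_cases[OF ecf'(1), of "length bs"] bs by (simp add: Suc_le_eq)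
  have M2: "M \<ge> 2" using cf_len_gap[OF ecf'(1), of 0 "length bs"] bs by (simp add: M_def)
  have Me: "even M" unfolding M_def by (rule even_cf_len[OF ecf'(1)]) simp
  have below: "x < M" if "x \<in> ?E" for x using that by (auto simp: Q_elements_def M_def)
  have p: "path_sums ?y ?E ?C (M - 1) u v"
    using s y_spec_snoc[OF bs] by (simp add: ideal_sums_def M_def)
  have yM: "?y M = y_even" "?y (M + 1) = y_odd" using M2 Me y_spec_ge_2 by simp_all
  define E1 where "E1 = (if ?T = t then insert (M + 1) ?E else insert (M + 1) (insert M ?E))"
  define C1 where "C1 = (if ?T = t then insert (edge (- t) (M - 1) (M + 1)) ?C
      else insert (edge t M (M + 1)) (insert (edge ?T (M - 1) M) ?C))"
  have p1: "path_sums ?y E1 C1 (M + 1) (fst s1) (snd s1)"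
  proof (cases "?T = t")
    case True
    have "M + 1 \<notin> ?E" using below by fastforce
    from path_sums_edge[OF p this, of "- t"] show ?thesis
      using True t1 unfolding E1_def C1_def s1_def yM by auto
  next
    case False
    have 1: "M \<notin> ?E" "M + 1 \<notin> insert M ?E" using below by fastforce+
    from path_sums_edge[OF path_sums_edge[OF p 1(1), of ?T] 1(2), of t] show ?thesis
      using False t1 T1 unfolding E1_def C1_def s1_def yM by auto
  qed
  have L: "cf_len (bs @ [c]) (length (bs @ [c])) - 1 = M + 1 + 2 * j"
    using cf_len_snoc[of bs c] c by (simp add: M_def)
  have memQ: "x \<in> Q_elements (bs @ [c]) \<longleftrightarrow> x \<in> ?E \<or> M \<le> x \<and> x < M + 2 * Suc j \<and> \<not> (x = M \<and> ?T = t)" for x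
    using mem_Q_elements_snoc[OF ecf, of x] bs c by (simp add: M_def t)
  have E: "Q_elements (bs @ [c]) = E1 \<union> {M + 1<..M + 1 + 2 * j}"
    unfolding set_eq_iff memQ by (auto simp: E1_def)
  have "{M..<M + 2 * Suc j - 1} = insert M {M + 1..<M + 1 + 2 * j}" by auto
  then have C: "Q_covers (bs @ [c]) = C1 \<union> (\<lambda>u. edge t u (Suc u)) ` {M + 1..<M + 1 + 2 * j}"
    using Q_covers_snoc[OF ecf] bs c by (auto simp: C1_def M_def t)
  show ?thesis
    unfolding ideal_sums_def L E C
  proof (rule path_sums_extend[OF p1])
    show "x \<le> M + 1" if "x \<in> E1" for x using that below by (force simp: E1_def split: if_splits)
    show "odd (M + 1)" using Me by simp
    show "?y x = (if even x then y_even else y_odd)" if "M + 1 < x" for x using y_spec_ge_2 M2 that by simp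
  qed
qed

lemma powi_uminus_abs: "nat \<bar>c\<bar> = 2 * Suc j \<Longrightarrow> ell powi (- \<bar>c\<bar>) = inverse (ell ^ 2) * inverse (ell ^ (2 * j))"
proof -
  assume "nat \<bar>c\<bar> = 2 * Suc j"
  then have "\<bar>c\<bar> = int (2 * j + 2)" using abs_eq_int by fastforce
  then show ?thesis by (simp only: power_int_minus power_int_of_nat power_add inverse_mult_distrib mult.commute)
qed

lemma powi_one_minus_abs: "nat \<bar>c\<bar> = 2 * Suc j \<Longrightarrow> ell powi (1 - \<bar>c\<bar>) = inverse ell * inverse (ell ^ (2 * j))"
proof -
  assume "nat \<bar>c\<bar> = 2 * Suc j"
  then have "1 - \<bar>c\<bar> = - int (2 * j + 1)" using abs_eq_int by fastforce
  then show ?thesis by (simp only: power_int_minus power_int_of_nat power_add inverse_mult_distrib mult.commute power_one_right)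
qed

section \<open>Rational identities for the first two crossings of a region\<close>

context
  fixes l h z X k u v A0 A1 B F :: "'a::field"
  assumes l: "l \<noteq> 0" and h: "h \<noteq> 0" and z: "z = h - inverse h"
begin

text \<open>\<open>A0\<close> is the unlink, so \<open>A0\<close> and \<open>X\<close> share the
  denominator \<open>z\<close>, and multiplication by \<open>z\<close> clears it. The weight
  \<open>l ^ 2 * inverse X\<close> of the first element is the one forced by the second identity, in
  which \<open>X\<close> cancels.\<close>

lemma first_region_positive:
  assumes "l * A1 - inverse l * A0 = z" "z * A0 = l - inverse l" "z \<noteq> 0" "X \<noteq> 0" "X * z = h * (1 - l ^ 2 * h ^ 2)"
  shows "A1 = inverse (l ^ 2) * - (inverse l * inverse h * X) * (1 + l ^ 2 * inverse X)"
    "inverse (l ^ 2) * - (inverse l * inverse h * X) * (- (l ^ 2 * h ^ 2) + l ^ 2) * (l ^ 2 * inverse X) = l * z"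
proof -
  have "z * (inverse (l ^ 2) * - (inverse l * inverse h * X) * (1 + l ^ 2 * inverse X)) =
      inverse (l ^ 2) * - (inverse l * inverse h) * (X * z + l ^ 2 * z)"
  proof -
    have "X * (1 + l ^ 2 * inverse X) = X + l ^ 2" using assms(4) by (simp add: distrib_left)
    then have eq: "X * z + l ^ 2 * z = z * (X * (1 + l ^ 2 * inverse X))" by (simp add: algebra_simps)
    show ?thesis unfolding eq by (simp only: mult_minus_left mult_minus_right ac_simps)
  qed
  also have "\<dots> = inverse l * (z * z + inverse l * (z * A0))"
    unfolding assms(2,5) using l h by (simp add: z field_simps power2_eq_square)
  also have "\<dots> = z * (inverse l * (z + inverse l * A0))" by (simp add: algebra_simps)
  also have "inverse l * (z + inverse l * A0) = A1" using l assms(1) by (simp add: field_simps)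
  finally show "A1 = inverse (l ^ 2) * - (inverse l * inverse h * X) * (1 + l ^ 2 * inverse X)"
    using mult_left_cancel[OF assms(3)] by metis
  show "inverse (l ^ 2) * - (inverse l * inverse h * X) * (- (l ^ 2 * h ^ 2) + l ^ 2) * (l ^ 2 * inverse X) = l * z"
    using l h assms(4) by (simp add: z field_simps power2_eq_square)
qed

text \<open>For a negative first term it is the first identity, with the value of the unlink
  inserted, that forces the weight of the first element.\<close>

lemma first_region_negative:
  assumes "l * A0 - inverse l * A1 = z" "z * A0 = l - inverse l" "z \<noteq> 0" "X * z = h * (1 - l ^ 2 * h ^ 2)"
  shows "A1 = - (l * h) * (1 + inverse ((h ^ 2) ^ 2) * X)"
    "- (l * h) * (1 + - inverse (h ^ 2)) = - (l * z)"
proof -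
  have "z * (- (l * h) * (1 + inverse ((h ^ 2) ^ 2) * X)) = - (l * h) * (z + inverse ((h ^ 2) ^ 2) * (X * z))"
    by (simp add: algebra_simps)
  also have "\<dots> = l * (l * (z * A0) - z * z)"
    unfolding assms(2,4) using l h by (simp add: z field_simps power2_eq_square)
  also have "\<dots> = z * (l * (l * A0 - z))" by (simp add: algebra_simps)
  also have "l * (l * A0 - z) = A1" using l assms(1) by (simp add: field_simps)
  finally show "A1 = - (l * h) * (1 + inverse ((h ^ 2) ^ 2) * X)"
    using mult_left_cancel[OF assms(3)] by metis
  show "- (l * h) * (1 + - inverse (h ^ 2)) = - (l * z)"
    using l h by (simp add: z field_simps power2_eq_square)
qed

text \<open>The names give the type of the old last region, then that of the new one. After an old
  type -1, \<open>k\<close> is the factor m of the list without its last term and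
  \<open>- (l * h * k)\<close> that of the list itself. The identities are the premises
  \<open>A1\<close> and \<open>zB\<close> of \<open>positive_region\<close>.\<close>

lemma next_region_negative_positive:
  assumes "l * A1 - inverse l * (k * u) = z * (- (l * h * k) * (u + v))"
  shows "A1 = inverse (l ^ 2) * k * (u + - (l ^ 2 * h ^ 2) * (u + v) + - inverse (h ^ 2) * (- (l ^ 2 * h ^ 2) * (u + v)))"
    "inverse (l ^ 2) * k * (- (l ^ 2 * h ^ 2) + l ^ 2) * (- inverse (h ^ 2) * (- (l ^ 2 * h ^ 2) * (u + v))) =
      l * z * (- (l * h * k) * (u + v))"
proof -
  have eq: "A1 = inverse l * (inverse l * (k * u) + z * (- (l * h * k) * (u + v)))"
    using l assms by (simp add: field_simps)
  show "A1 = inverse (l ^ 2) * k * (u + - (l ^ 2 * h ^ 2) * (u + v) + - inverse (h ^ 2) * (- (l ^ 2 * h ^ 2) * (u + v)))"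
    unfolding eq using l h by (simp add: z field_simps power2_eq_square)
qed (use l h in \<open>simp add: z field_simps power2_eq_square\<close>)

lemma next_region_positive_positive:
  assumes "l * A1 - inverse l * (- (k * v * (l * h))) = z * (k * (u + v))"
  shows "A1 = inverse l * h * k * (u + - inverse (h ^ 2) * (u + v))"
    "inverse l * h * k * (- (l ^ 2 * h ^ 2) + l ^ 2) * (- inverse (h ^ 2) * (u + v)) = l * z * (k * (u + v))"
proof -
  have eq: "A1 = inverse l * (inverse l * (- (k * v * (l * h))) + z * (k * (u + v)))"
    using l assms by (simp add: field_simps)
  show "A1 = inverse l * h * k * (u + - inverse (h ^ 2) * (u + v))"
    unfolding eq using l h by (simp add: z field_simps power2_eq_square)
qed (use l h in \<open>simp add: z field_simps power2_eq_square\<close>)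

lemma next_region_positive_negative:
  assumes "l * (- (k * v * (l * h))) - inverse l * A1 = z * (k * (u + v))"
  shows "A1 = - (l * h * k) * (u + v + - inverse (h ^ 2) * (u + v + - (l ^ 2 * h ^ 2) * v))"
proof -
  have eq: "A1 = l * (l * (- (k * v * (l * h))) - z * (k * (u + v)))"
    using l assms by (simp add: field_simps)
  show ?thesis unfolding eq using l h by (simp add: z field_simps power2_eq_square)
qed

lemma next_region_negative_negative:
  assumes "l * (k * u) - inverse l * A1 = z * (- (l * h * k) * (u + v))"
  shows "A1 = - (l * h * (- (l * h * k))) * (u + v + - inverse (h ^ 2) * v)"
proof -
  have eq: "A1 = l * (l * (k * u) - z * (- (l * h * k) * (u + v)))"
    using l assms by (simp add: field_simps)
  show ?thesis unfolding eq using l h by (simp add: z field_simps power2_eq_square)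
qed

text \<open>A new region of type -1 starts with first sum \<open>u + v\<close> for either old type,
  so this one identity provides the premise \<open>zB\<close> of \<open>negative_region\<close> in
  both cases.\<close>

lemma negative_region_coefficient: "- (l * h * k) * (1 + - inverse (h ^ 2)) * F = - (l * z * (k * F))"
  using l h by (simp add: z field_simps power2_eq_square)

end

lemma y_ratio_times: "y_ratio * (qhalf - inverse qhalf) = qhalf * (1 - ell ^ 2 * q)"
proof -
  have "1 - inverse q \<noteq> 0" using q_neq_1 by (simp add: field_simps)
  moreover have "qhalf - inverse qhalf = qhalf * (1 - inverse q)"
    using qhalf_neq_0 by (simp add: field_simps power2_eq_square)
  ultimately show ?thesis by (simp add: y_ratio_def)
qed

lemma qhalf_diff_neq_0: "qhalf - inverse qhalf \<noteq> 0"
  using y_ratio_times y_ratio_neq_0 ell_q_neq_1 qhalf_neq_0 by auto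

lemma y_spec_1: "y_spec [c] 1 = (if c > 0 then ell ^ 2 * inverse y_ratio else inverse (q ^ 2) * y_ratio)"
  by (simp add: y_spec_def y_ratio_def)

section \<open>Induction on the continued fraction\<close>

context
  fixes P :: "edges \<Rightarrow> ratfun"
  assumes P: "homfly_polynomial P"
begin

lemma P_rational_Nil: "P (rational_link []) = 1"
  using P_unknot[OF P] by (simp add: rational_link_eq)

text \<open>The sequence \<open>A\<close> does not depend on the appended term, since the recursion
  connects closures with all numbers of crossings. At 0 crossings there is no fraction with a
  further term; the closure is then the unlink or an earlier rational link.\<close>

lemma P_rational_step:
  assumes bs: "even_continued_fraction bs" and t: "t = 1 \<or> t = -1"
  obtains A where
    "\<And>c j. nat \<bar>c\<bar> = 2 * Suc j \<Longrightarrow> (-1) ^ length bs * sgn c = t \<Longrightarrow> P (rational_link (bs @ [c])) = A (Suc j)"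
    "\<And>j. t = 1 \<Longrightarrow> ell * A (Suc j) - inverse ell * A j = (qhalf - inverse qhalf) * P (rational_link bs)"
    "\<And>j. t = -1 \<Longrightarrow> ell * A j - inverse ell * A (Suc j) = (qhalf - inverse qhalf) * P (rational_link bs)"
    "bs = [] \<Longrightarrow> (qhalf - inverse qhalf) * A 0 = ell - inverse ell"
    "bs \<noteq> [] \<Longrightarrow> A 0 = P (rational_link (butlast bs))"
proof
  define b where "b = odd (Suc (length bs))"
  define A where "A = (\<lambda>j. P (closed_braid (letters bs @ region t b (2 * j)) b False))"
  have w: "signed (letters bs)" "braid_like (length (letters bs)) b False (braid (letters bs))"
    using letters_braid_like[OF bs] by auto
  have B: "rational_link bs = closed_braid (letters bs) (\<not> b) False"
    by (simp add: rational_link_eq b_def)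
  note rec = P_region[OF P w t, folded A_def B]
  show "P (rational_link (bs @ [c])) = A (Suc j)"
    if "nat \<bar>c\<bar> = 2 * Suc j" "(-1) ^ length bs * sgn c = t" for c j
    using that by (simp add: A_def rational_link_eq letters_snoc b_def)
  show "ell * A (Suc j) - inverse ell * A j = (qhalf - inverse qhalf) * P (rational_link bs)" if "t = 1" for j
    using rec[of j] that by (simp add: A_def)
  show "ell * A j - inverse ell * A (Suc j) = (qhalf - inverse qhalf) * P (rational_link bs)" if "t = -1" for j
    using rec[of j] that by (simp add: A_def)
  show "(qhalf - inverse qhalf) * A 0 = ell - inverse ell" if "bs = []"
    using P_unlink[OF P] that by (simp add: A_def b_def)
  show "A 0 = P (rational_link (butlast bs))" if ne: "bs \<noteq> []"
  proof -
    obtain bs' d where bs': "bs = bs' @ [d]" using ne by (cases bs rule: rev_cases) simp_all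
    have d: "even d" "d \<noteq> 0" "even_continued_fraction bs'"
      using bs by (simp_all add: bs' even_continued_fraction_snoc)
    note lb = letters_braid_like[OF d(3), of "\<not> b"]
    have "even (nat \<bar>d\<bar>)" using d(1) by (simp add: even_nat_iff)
    then have "P (closed_braid (letters bs) b False) = P (closed_braid (letters bs') b False)"
      using P_kinks[OF P conjunct1[OF lb] conjunct2[OF lb] sign_power_sgn[OF d(2), of "length bs'"], of "nat \<bar>d\<bar>"]
      unfolding bs' letters_snoc by (simp add: b_def bs')
    then show ?thesis by (simp add: A_def bs' rational_link_eq b_def)
  qed
qed

text \<open>The last two clauses supply the value at 0 crossings for the next region. They hold for
  every length of the last region: for type -1 the first sum is constant along it, for type 1 the
  growth of the second sum cancels against the power of \<open>ell\<close> in m.\<close>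

lemma P_rational_invariant:
  assumes "even_continued_fraction bs" "bs \<noteq> []"
  shows "\<exists>u v. ideal_sums bs u v \<and> P (rational_link bs) = m_cf bs * (u + v) \<and>
    (cf_type bs (length bs) = -1 \<longrightarrow> P (rational_link (butlast bs)) = m_cf (butlast bs) * u) \<and>
    (cf_type bs (length bs) = 1 \<longrightarrow> P (rational_link (butlast bs)) = - (m_cf bs * v * (ell * qhalf)))"
  using assms
proof (induction bs rule: rev_induct)
  case (snoc c bs)
  define t :: int where "t = (-1) ^ length bs * sgn c"
  have c: "even c" "c \<noteq> 0" and bs: "even_continued_fraction bs"
    using snoc.prems(1) by (simp_all add: even_continued_fraction_snoc)
  have t: "t = 1 \<or> t = -1" unfolding t_def by (rule sign_power_sgn[OF c(2)])
  have tc: "cf_type (bs @ [c]) (length (bs @ [c])) = t" using cf_type_snoc[of bs c] by (simp add: t_def)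
  obtain j where j: "nat \<bar>c\<bar> = 2 * Suc j"
  proof -
    obtain k where "c = 2 * k" using c(1) by blast
    then have "nat \<bar>c\<bar> = 2 * Suc (nat \<bar>k\<bar> - 1)" using c(2) by auto
    then show ?thesis using that by blast
  qed
  obtain A where A: "P (rational_link (bs @ [c])) = A (Suc j)"
    "\<And>j. t = 1 \<Longrightarrow> ell * A (Suc j) - inverse ell * A j = (qhalf - inverse qhalf) * P (rational_link bs)"
    "\<And>j. t = -1 \<Longrightarrow> ell * A j - inverse ell * A (Suc j) = (qhalf - inverse qhalf) * P (rational_link bs)"
    "bs = [] \<Longrightarrow> (qhalf - inverse qhalf) * A 0 = ell - inverse ell"
    "bs \<noteq> [] \<Longrightarrow> A 0 = P (rational_link (butlast bs))"
    using P_rational_step[OF bs t] j t_def by metis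
  note l0 = ell_neq_0 and h0 = qhalf_neq_0 and rec1 = A(2)[of 0, folded One_nat_def]
    and rec2 = A(3)[of 0, folded One_nat_def]
  show ?case
  proof (cases "bs = []")
    case True
    let ?s = "(extend t y_even y_odd ^^ j) (1, y_spec [c] 1)"
    have sums: "ideal_sums (bs @ [c]) (fst ?s) (snd ?s)"
      using ideal_sums_single[OF j] True by (simp add: t_def)
    have m: "m_cf (bs @ [c]) = (if t = -1 then - (ell * qhalf) else
        inverse (ell ^ 2) * - (inverse ell * inverse qhalf * y_ratio) * inverse (ell ^ (2 * j)))"
      unfolding m_cf_snoc[OF t_def] powi_uminus_abs[OF j]
      by (simp add: True m_cf_def cf_type_def y_ratio_def)
    have B: "P (rational_link bs) = 1" using P_rational_Nil True by simp
    have P0: "P (rational_link (butlast (bs @ [c]))) = 1" using P_rational_Nil True by simp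
    from t show ?thesis
    proof
      assume t1: "t = 1"
      then have y1: "y_spec [c] 1 = ell ^ 2 * inverse y_ratio"
        using True by (simp add: y_spec_1[of c, simplified] t_def sgn_if split: if_splits)
      note alg = first_region_positive[OF l0 h0 refl, of "A 1" "A 0" y_ratio]
      have r: "ell * A 1 - inverse ell * A 0 = qhalf - inverse qhalf" using rec1 t1 B by simp
      note alg1 = alg(1)[OF r A(4)[OF True] qhalf_diff_neq_0 y_ratio_neq_0 y_ratio_times]
      note alg2 = alg(2)[OF r A(4)[OF True] qhalf_diff_neq_0 y_ratio_neq_0 y_ratio_times]
      note reg = positive_region[where l = ell and e = y_even and d = y_odd and z = "qhalf - inverse qhalf"
        and B = 1 and A = A and u = 1 and v = "ell ^ 2 * inverse y_ratio", OF l0 y_even_y_odd _ alg1]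
      have r': "ell * A (Suc i) - inverse ell * A i = (qhalf - inverse qhalf) * 1" for i
        using A(2)[OF t1] B by simp
      have s: "snd ?s = ell ^ (2 * j) * (ell ^ 2 * inverse y_ratio)"
        "A (Suc j) = m_cf (bs @ [c]) * (fst ?s + snd ?s)"
        using reg[OF r'] alg2 by (simp_all add: t1 y1[simplified] m)
      have "1 = - (m_cf (bs @ [c]) * snd ?s * (ell * qhalf))"
        unfolding s(1) m using t1 l0 h0 y_ratio_neq_0 by (simp add: field_simps power2_eq_square)
      then show ?thesis using sums s(2) t1 A(1) P0 tc by auto
    next
      assume t1: "t = -1"
      then have y1: "y_spec [c] 1 = inverse (q ^ 2) * y_ratio"
        using True by (simp add: y_spec_1[of c, simplified] t_def sgn_if split: if_splits)
      note alg = first_region_negative[OF l0 h0 refl, of "A 0" "A 1" y_ratio]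
      have r: "ell * A 0 - inverse ell * A 1 = qhalf - inverse qhalf" using rec2 t1 B by simp
      note alg1 = alg(1)[OF r A(4)[OF True] qhalf_diff_neq_0 y_ratio_times]
      note alg2 = alg(2)[OF r A(4)[OF True] qhalf_diff_neq_0 y_ratio_times]
      note reg = negative_region[where l = ell and e = y_even and d = y_odd and z = "qhalf - inverse qhalf"
        and B = 1 and A = A and u = 1 and v = "inverse (q ^ 2) * y_ratio", OF l0 y_even_y_odd _ alg1]
      have r': "ell * A i - inverse ell * A (Suc i) = (qhalf - inverse qhalf) * 1" for i
        using A(3)[OF t1] B by simp
      have s: "fst ?s = 1" "A (Suc j) = m_cf (bs @ [c]) * (fst ?s + snd ?s)"
        using reg[OF r'] alg2 unfolding t1 y1 m by simp_all
      have "m_cf (butlast (bs @ [c])) = 1" using True by (simp add: m_cf_def)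
      then show ?thesis using sums s t1 A(1) P0 tc by auto
    qed
  next
    case False
    from snoc.IH[OF bs False] obtain u v where uv: "ideal_sums bs u v"
      and Pbs: "P (rational_link bs) = m_cf bs * (u + v)"
      and neg: "cf_type bs (length bs) = -1 \<Longrightarrow> P (rational_link (butlast bs)) = m_cf (butlast bs) * u"
      and pos: "cf_type bs (length bs) = 1 \<Longrightarrow> P (rational_link (butlast bs)) = - (m_cf bs * v * (ell * qhalf))"
      by blast
    have T: "cf_type bs (length bs) = 1 \<or> cf_type bs (length bs) = -1"
      using cf_type_cases[OF bs, of "length bs"] False by (simp add: Suc_le_eq)
    note sums = ideal_sums_snoc[OF snoc.prems(1) False j t_def uv]
    have but: "butlast (bs @ [c]) = bs" by simp
    \<comment> \<open>Because of the shifted argument, \<open>m_shift bs (length bs)\<close> belongs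
      to the list without its last term.\<close>
    have mT: "m_cf bs = - (ell * qhalf * m_cf (butlast bs))" "m_shift bs (length bs) = m_cf (butlast bs)"
      if "cf_type bs (length bs) = -1"
    proof -
      obtain bs' d where bs': "bs = bs' @ [d]" using False by (cases bs rule: rev_cases) simp_all
      show "m_cf bs = - (ell * qhalf * m_cf (butlast bs))"
        using m_cf_snoc[OF refl, of bs' d] that cf_type_snoc[of bs' d] by (simp add: bs')
      show "m_shift bs (length bs) = m_cf (butlast bs)"
        using m_shift_append[of "Suc (length bs')" bs' "[d]"] by (simp add: bs' m_cf_def)
    qed
    note A0 = A(5)[OF False]
    from t show ?thesis
    proof
      assume t1: "t = 1"
      note reg = positive_region[where l = ell and e = y_even and d = y_odd and z = "qhalf - inverse qhalf"
        and A = A, OF l0 y_even_y_odd A(2)[OF t1]]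
      from T show ?thesis
      proof
        assume T1: "cf_type bs (length bs) = 1"
        let ?s = "(extend t y_even y_odd ^^ j) (u, y_odd * (u + v))"
        have sm: "ideal_sums (bs @ [c]) (fst ?s) (snd ?s)" using sums t1 T1 by simp
        have m: "m_cf (bs @ [c]) = inverse ell * qhalf * m_cf bs * inverse (ell ^ (2 * j))"
          unfolding m_cf_snoc[OF t_def] powi_one_minus_abs[OF j] using t1 T1 by simp
        note alg = next_region_positive_positive[OF l0 h0 refl, of "A 1" "m_cf bs" v u]
        have r: "ell * A 1 - inverse ell * (- (m_cf bs * v * (ell * qhalf))) =
            (qhalf - inverse qhalf) * (m_cf bs * (u + v))"
          using rec1[OF t1] A0 pos[OF T1] Pbs by simp
        have s: "snd ?s = ell ^ (2 * j) * (y_odd * (u + v))" "A (Suc j) = m_cf (bs @ [c]) * (fst ?s + snd ?s)"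
          using reg[OF alg(1)[OF r]] alg(2)[OF r] unfolding t1 m Pbs by simp_all
        have "P (rational_link bs) = - (m_cf (bs @ [c]) * snd ?s * (ell * qhalf))"
          unfolding s(1) m Pbs using l0 h0 by (simp add: field_simps power2_eq_square)
        then show ?thesis using sm s(2) A(1) tc t1 unfolding but by auto
      next
        assume T1: "cf_type bs (length bs) = -1"
        let ?s = "(extend t y_even y_odd ^^ j) (u + y_even * (u + v), y_odd * (y_even * (u + v)))"
        have sm: "ideal_sums (bs @ [c]) (fst ?s) (snd ?s)" using sums t1 T1 by simp
        have m: "m_cf (bs @ [c]) = inverse (ell ^ 2) * m_cf (butlast bs) * inverse (ell ^ (2 * j))"
          unfolding m_cf_snoc[OF t_def] powi_uminus_abs[OF j] using t1 T1 mT by simp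
        note alg = next_region_negative_positive[OF l0 h0 refl, of "A 1" "m_cf (butlast bs)" u v]
        have r: "ell * A 1 - inverse ell * (m_cf (butlast bs) * u) =
            (qhalf - inverse qhalf) * (- (ell * qhalf * m_cf (butlast bs)) * (u + v))"
          using rec1[OF t1] A0 neg[OF T1] Pbs mT(1)[OF T1] by simp
        have s: "snd ?s = ell ^ (2 * j) * (y_odd * (y_even * (u + v)))" "A (Suc j) = m_cf (bs @ [c]) * (fst ?s + snd ?s)"
          using reg[OF alg(1)[OF r]] alg(2)[OF r] unfolding t1 m Pbs mT(1)[OF T1] by simp_all
        have "P (rational_link bs) = - (m_cf (bs @ [c]) * snd ?s * (ell * qhalf))"
          unfolding s(1) m Pbs mT(1)[OF T1] using l0 h0 by (simp add: field_simps power2_eq_square)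
        then show ?thesis using sm s(2) A(1) tc t1 unfolding but by auto
      qed
    next
      assume t1: "t = -1"
      have m: "m_cf (bs @ [c]) = - (ell * qhalf * m_cf bs)"
        unfolding m_cf_snoc[OF t_def] using t1 by simp
      note reg = negative_region[where l = ell and e = y_even and d = y_odd and z = "qhalf - inverse qhalf"
        and A = A and u = "u + v", OF l0 y_even_y_odd A(3)[OF t1]]
      note coef = negative_region_coefficient[OF l0 h0 refl, of "m_cf bs" "u + v", folded Pbs]
      from T show ?thesis
      proof
        assume T1: "cf_type bs (length bs) = 1"
        let ?s = "(extend t y_even y_odd ^^ j) (u + v, y_odd * (u + v + y_even * v))"
        have sm: "ideal_sums (bs @ [c]) (fst ?s) (snd ?s)" using sums t1 T1 by simp
        have r: "ell * (- (m_cf bs * v * (ell * qhalf))) - inverse ell * A 1 =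
            (qhalf - inverse qhalf) * (m_cf bs * (u + v))"
          using rec2[OF t1] A0 pos[OF T1] Pbs by simp
        have s: "fst ?s = u + v" "A (Suc j) = m_cf (bs @ [c]) * (fst ?s + snd ?s)"
          using reg[OF next_region_positive_negative[OF l0 h0 refl r] coef] unfolding t1 m by simp_all
        then show ?thesis using sm A(1) tc t1 Pbs unfolding but by auto
      next
        assume T1: "cf_type bs (length bs) = -1"
        let ?s = "(extend t y_even y_odd ^^ j) (u + v, y_odd * v)"
        have sm: "ideal_sums (bs @ [c]) (fst ?s) (snd ?s)" using sums t1 T1 by simp
        have r: "ell * (m_cf (butlast bs) * u) - inverse ell * A 1 =
            (qhalf - inverse qhalf) * (- (ell * qhalf * m_cf (butlast bs)) * (u + v))"
          using rec2[OF t1] A0 neg[OF T1] Pbs mT(1)[OF T1] by simp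
        have s: "fst ?s = u + v" "A (Suc j) = m_cf (bs @ [c]) * (fst ?s + snd ?s)"
          using reg[OF next_region_negative_negative[OF l0 h0 refl r, folded mT(1)[OF T1]] coef]
          unfolding t1 m by simp_all
        then show ?thesis using sm A(1) tc t1 Pbs unfolding but by auto
      qed
    qed
  qed
qed simp

end

theorem theorem1p1:
  fixes bs :: "int list" and P :: "edges \<Rightarrow> ratfun"
  assumes "even_continued_fraction bs"
    and "homfly_polynomial P"
  shows "P (rational_link bs) = m_cf bs * F_tilde bs"
proof (cases "bs = []")
  case True
  then show ?thesis
    using P_rational_Nil[OF assms(2)] by (simp add: m_cf_def F_tilde_def F_cf_Nil)
next
  case False
  then show ?thesis
    using P_rational_invariant[OF assms(2,1)] F_tilde_ideal_sums by metis
qed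

end
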